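(* Fix $0<\alpha,\beta,M<+\infty$. Suppose $\alpha\beta M^2=16\pi^2$, and pick a point $\xi^\star\in(\mathbb{R}\times\{0\})\cup(\{0\}\times\mathbb{R})$ on the cross which is not in $\Lambda_{\alpha,\beta}$. If $\Lambda^\star_{\alpha,\beta}:=\Lambda_{\alpha,\beta}\cup\{\xi^\star\}$, then any measure $\mu\in\mathrm{AC}(\Gamma_M;\Lambda_{\alpha,\beta}^\star)$ is uniquely determined (among the elements of $\mathrm{AC}(\Gamma_M;\Lambda_{\alpha,\beta}^\star)$) by its restriction to the hyperbola branch $\Gamma_M^+$.
   Context: For a finite complex-valued Borel measure $\mu$ on $\mathbb{R}^2$, its Fourier transform is $\hat\mu(\xi)=\int_{\mathbb{R}^2}\mathrm{e}^{\mathrm{i}\pi\langle x,\xi\rangle}\,\mathrm{d}\mu(x)$, where $\langle x,\xi\rangle=x_1\xi_1+x_2\xi_2$. $\Gamma_M=\{x\in\mathbb{R}^2:\ x_1x_2=M^2/(4\pi^2)\}$, $\Gamma_M^+=\{x\in\Gamma_M:\ x_1>0\}$, and $\Lambda_{\alpha,\beta}=(\alpha\mathbb{Z}\times\{0\})\cup(\{0\}\times\beta\mathbb{Z})$. For $\Lambda\subset\mathbb{R}^2$, $\mathrm{AC}(\Gamma_M;\Lambda)$ is the space of finite complex-valued Borel measures $\mu$ on $\mathbb{R}^2$ supported on $\Gamma_M$, absolutely continuous with respect to arc length measure on $\Gamma_M$, and such that $\hat\mu=0$ on $\Lambda$. *)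

theory Defs
  imports "HOL-Analysis.Analysis"
begin

text \<open>
  A finite complex measure on the measurable space underlying \<open>N\<close> is a countably additive
  complex-valued set function on \<open>sets N\<close> (the values of \<open>emeasure N\<close> play no role).
  Countable additivity with complex values forces finite total variation.
  Setting the value to \<open>0\<close> outside \<open>sets N\<close> makes equality of
  complex measures the same as equality of set functions.
\<close>

definition complex_measures :: "'a measure \<Rightarrow> ('a set \<Rightarrow> complex) set" where
  "complex_measures N = {\<mu>. \<mu> {} = 0
     \<and> (\<forall>A. A \<notin> sets N \<longrightarrow> \<mu> A = 0)
     \<and> (\<forall>A :: nat \<Rightarrow> 'a set. range A \<subseteq> sets N \<and> disjoint_family A \<longrightarrow>
            (\<lambda>i. \<mu> (A i)) sums \<mu> (\<Union>i. A i))}"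

text \<open>
  Upper variation of a finite signed measure, that is, the positive part of its Jordan
  decomposition; the negative part is the upper variation of \<open>- \<nu>\<close>.
  Since \<open>\<nu> {} = 0\<close>, truncating negative values by \<^const>\<open>ennreal\<close> does not change the supremum.
\<close>

definition upper_variation :: "'a measure \<Rightarrow> ('a set \<Rightarrow> real) \<Rightarrow> 'a measure" where
  "upper_variation N \<nu> =
     measure_of (space N) (sets N) (\<lambda>A. SUP B\<in>{B \<in> sets N. B \<subseteq> A}. ennreal (\<nu> B))"

definition complex_measure_integral ::
    "'a measure \<Rightarrow> ('a set \<Rightarrow> complex) \<Rightarrow> ('a \<Rightarrow> complex) \<Rightarrow> complex" where
  "complex_measure_integral N \<mu> f =
     (integral\<^sup>L (upper_variation N (\<lambda>A. Re (\<mu> A))) f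
        - integral\<^sup>L (upper_variation N (\<lambda>A. - Re (\<mu> A))) f)
     + \<i> * (integral\<^sup>L (upper_variation N (\<lambda>A. Im (\<mu> A))) f
        - integral\<^sup>L (upper_variation N (\<lambda>A. - Im (\<mu> A))) f)"

definition fourier_transform ::
    "((real \<times> real) set \<Rightarrow> complex) \<Rightarrow> real \<times> real \<Rightarrow> complex" where
  "fourier_transform \<mu> \<xi> =
     complex_measure_integral borel \<mu> (\<lambda>x. exp (\<i> * complex_of_real (pi * (x \<bullet> \<xi>))))"

definition hyperbola :: "real \<Rightarrow> (real \<times> real) set" where
  "hyperbola M = {x. fst x * snd x = M\<^sup>2 / (4 * pi\<^sup>2)}"

definition hyperbola_plus :: "real \<Rightarrow> (real \<times> real) set" where
  "hyperbola_plus M = {x \<in> hyperbola M. fst x > 0}"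

text \<open>
  With \<open>c = M\<^sup>2 / (4 * pi\<^sup>2)\<close>, the hyperbola is the injective image of \<open>t \<mapsto> (t, c / t)\<close>, \<open>t \<noteq> 0\<close>,
  whose velocity is \<open>(1, - c / t\<^sup>2)\<close>; the parameter \<open>t = 0\<close> is a Lebesgue null set.
\<close>

definition hyperbola_arc_length :: "real \<Rightarrow> (real \<times> real) measure" where
  "hyperbola_arc_length M = (let c = M\<^sup>2 / (4 * pi\<^sup>2) in
     distr (density lborel (\<lambda>t. ennreal (norm (1 :: real, - c / t\<^sup>2)))) borel (\<lambda>t. (t, c / t)))"

definition AC :: "real \<Rightarrow> (real \<times> real) set \<Rightarrow> ((real \<times> real) set \<Rightarrow> complex) set" where
  "AC M \<Lambda> = {\<mu> \<in> complex_measures borel.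
     (\<forall>A \<in> sets borel. A \<inter> hyperbola M = {} \<longrightarrow> \<mu> A = 0)
     \<and> (\<forall>A \<in> sets borel. emeasure (hyperbola_arc_length M) A = 0 \<longrightarrow> \<mu> A = 0)
     \<and> (\<forall>\<xi> \<in> \<Lambda>. fourier_transform \<mu> \<xi> = 0)}"

definition cross :: "(real \<times> real) set" where
  "cross = (UNIV \<times> {0}) \<union> ({0} \<times> UNIV)"

definition lattice_cross :: "real \<Rightarrow> real \<Rightarrow> (real \<times> real) set" where
  "lattice_cross \<alpha> \<beta> =
     (range (\<lambda>j :: int. \<alpha> * of_int j) \<times> {0}) \<union> ({0} \<times> range (\<lambda>k :: int. \<beta> * of_int k))"

end

theory Submission
  imports Defs "HOL-Real_Asymp.Real_Asymp"
begin

text \<open>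
  The difference of the two measures lives on the branch \<open>t < 0\<close> of the hyperbola. In the rescaled coordinate
  \<open>u = - \<alpha> t / 2\<close> it has an integrable density \<open>g\<close> on \<open>(0, \<infinity>)\<close>, and since \<open>\<alpha> \<beta> M\<^sup>2 = 16 \<pi>\<^sup>2\<close> its
  transform vanishes on the lattice cross iff \<open>g\<close> annihilates all \<open>e\<^bsup>2\<pi>iju\<^esup>\<close> and all \<open>e\<^bsup>2\<pi>ik/u\<^esup>\<close>.
  Hence \<open>g\<close> annihilates all bounded \<open>1\<close>-periodic functions of \<open>u\<close> and of \<open>1 / u\<close>, which forces the
  restriction of \<open>g\<close> to \<open>(0, 1)\<close> to be invariant under the square of the Gauss map. The transfer operator of
  the Gauss map with respect to the Gauss measure \<open>dx / (1 + x)\<close> contracts the Lipschitz seminorm, so the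
  Gauss map is mixing and \<open>g\<close> is a multiple of \<open>1 / (1 + u)\<close> on \<open>(0, 1)\<close>; this also determines \<open>g\<close> on
  \<open>(1, \<infinity>)\<close>. At a further point of the cross the transform of this one-dimensional family is, up to sign, the
  integral of \<open>e\<^bsup>iyu\<^esup> - e\<^bsup>iy/u\<^esup>\<close> against the Gauss measure, which integration by parts shows to be nonzero
  unless \<open>y\<close> is a multiple of \<open>2\<pi>\<close>.
\<close>

section \<open>The transfer operator of the Gauss map\<close>

text \<open>The value \<open>16 * pi\<^sup>2\<close> is critical: the Gauss map preserves a finite
  measure, so the conditions on one half-line branch have a nonzero integrable solution, 1 / (1 + u)
  on (0, 1) continued by - 1 / (u (1 + u)) on (1, \<infinity>), up to a factor. The content is that
  there is no other integrable solution and that one more point of the cross excludes this one.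

  Integrability is all that is known of the density, while a contraction rate is available only on
  Lipschitz functions. It is carried over to integrable functions by approximation, which is
  harmless because composing the bounded test functions with iterates of the Gauss map does not
  enlarge them.

  The lattice is symmetric about the origin, so on it the real and imaginary parts of a density can
  be separated. The further point has no mirror image: it gives one complex equation for two real
  constants, which suffices because the complex factor in that equation does not vanish.\<close>

lemma lborel_integral_change_of_variables:
  fixes f :: "real \<Rightarrow> 'a::euclidean_space" and g h :: "real \<Rightarrow> real"
  assumes S: "S \<in> sets borel"
    and der: "\<And>x. x \<in> S \<Longrightarrow> (g has_field_derivative h x) (at x within S)"
    and inj: "inj_on g S"
    and f: "integrable lborel (\<lambda>x. indicator (g ` S) x *\<^sub>R f x)"
    and meas: "(\<lambda>x. indicator S x *\<^sub>R (\<bar>h x\<bar> *\<^sub>R f (g x))) \<in> borel_measurable borel"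
  shows "(\<integral>x. indicator (g ` S) x *\<^sub>R f x \<partial>lborel)
       = (\<integral>x. indicator S x *\<^sub>R (\<bar>h x\<bar> *\<^sub>R f (g x)) \<partial>lborel)"
proof -
  have S': "S \<in> sets lebesgue" using S by simp
  \<comment> \<open>In the completed measure the Borel function is absolutely integrable, which is
    the setting of the substitution rule; \<open>meas\<close> brings the result back to
    \<open>lborel\<close>.\<close>
  have fa: "f absolutely_integrable_on g ` S"
    unfolding set_integrable_def using f integrable_completion[of "\<lambda>x. indicator (g ` S) x *\<^sub>R f x" lborel]
    by (auto dest: borel_measurable_integrable)
  have *: "(\<lambda>x. \<bar>h x\<bar> *\<^sub>R f (g x)) absolutely_integrable_on S"
      "integral S (\<lambda>x. \<bar>h x\<bar> *\<^sub>R f (g x)) = integral (g ` S) f"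
    using has_absolute_integral_change_of_variables_real[OF S' der inj, of f "integral (g ` S) f"] fa
    by auto
  have "(\<integral>x. indicator (g ` S) x *\<^sub>R f x \<partial>lborel) = integral (g ` S) f"
    using set_lebesgue_integral_eq_integral(2)[OF fa] integral_completion[of "\<lambda>x. indicator (g ` S) x *\<^sub>R f x" lborel] f
    by (auto simp: set_lebesgue_integral_def dest: borel_measurable_integrable)
  also have "\<dots> = (\<integral>x. indicator S x *\<^sub>R (\<bar>h x\<bar> *\<^sub>R f (g x)) \<partial>lborel)"
    using set_lebesgue_integral_eq_integral(2)[OF *(1)] *(2) meas
      integral_completion[of "\<lambda>x. indicator S x *\<^sub>R (\<bar>h x\<bar> *\<^sub>R f (g x))" lborel]
    by (auto simp: set_lebesgue_integral_def)
  finally show ?thesis .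
qed

text \<open>The transfer operator acts on densities with respect to \<open>dx / (1 + x)\<close>, hence the factor
  \<open>1 + x\<close> in the weights, which makes it fix the constants.\<close>

definition gauss_weight :: "nat \<Rightarrow> real \<Rightarrow> real" where
  "gauss_weight j x = (1 + x) / ((x + real j + 1) * (x + real j + 2))"

definition gauss_op :: "(real \<Rightarrow> real) \<Rightarrow> real \<Rightarrow> real" where
  "gauss_op \<phi> x = (\<Sum>j. gauss_weight j x * \<phi> (1 / (x + real j + 1)))"

lemma gauss_weight_nonneg: "0 \<le> x \<Longrightarrow> 0 \<le> gauss_weight j x"
  by (simp add: gauss_weight_def)

text \<open>The partial fraction form makes the weights telescope. It yields both their total mass
  and the summation by parts in the contraction estimate.\<close>

lemma gauss_weight_diff:
  assumes "0 \<le> x"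
  shows "gauss_weight j x = (1 + x) / (x + real j + 1) - (1 + x) / (x + real (Suc j) + 1)"
proof -
  have "x + real j + 1 \<noteq> 0" "x + real j + 2 \<noteq> 0" using assms by auto
  then show ?thesis unfolding gauss_weight_def by (simp add: divide_simps) (simp add: algebra_simps)
qed

text \<open>Total mass 1 is the invariance of dx / (1 + x) under the Gauss map in pointwise
  form.\<close>

lemma gauss_weight_sums:
  assumes "0 \<le> x" shows "(\<lambda>j. gauss_weight j x) sums 1"
proof -
  have "(\<lambda>j. (1 + x) / (x + real j + 1)) \<longlonglongrightarrow> 0"
    by real_asymp
  from telescope_sums'[OF this] have "(\<lambda>j. gauss_weight j x) sums ((1 + x) / (x + real 0 + 1) - 0)"
    using gauss_weight_diff[OF assms] by simp
  moreover have "(1 + x) / (x + 1) = 1" using assms by simp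
  ultimately show ?thesis by simp
qed

lemma sum_gauss_weight_le: "0 \<le> x \<Longrightarrow> (\<Sum>j<N. gauss_weight j x) \<le> 1"
  using gauss_weight_sums[of x] sum_le_suminf[of "\<lambda>j. gauss_weight j x" "{..<N}"]
  by (auto simp: sums_iff gauss_weight_nonneg)

text \<open>At each \<open>x\<close> the weights form a probability distribution, so a bound for
  \<phi> on [0, 1] passes to all partial averages. The bound on partial sums later serves as a
  dominating constant.\<close>

lemma gauss_op_sums:
  assumes x: "x \<in> {0..1}" and B: "\<And>t. t \<in> {0..1} \<Longrightarrow> \<bar>\<phi> t\<bar> \<le> B"
  shows "(\<lambda>j. gauss_weight j x * \<phi> (1 / (x + real j + 1))) sums gauss_op \<phi> x"
    and "\<bar>\<Sum>j<N. gauss_weight j x * \<phi> (1 / (x + real j + 1))\<bar> \<le> B"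
proof -
  have B0: "0 \<le> B" using B[of 0] by auto
  have b: "\<bar>gauss_weight j x * \<phi> (1 / (x + real j + 1))\<bar> \<le> gauss_weight j x * B" for j
    unfolding abs_mult using x gauss_weight_nonneg[of x j] by (intro mult_mono B) auto
  have "summable (\<lambda>j. gauss_weight j x * \<phi> (1 / (x + real j + 1)))"
    by (rule summable_comparison_test'[where g = "\<lambda>j. gauss_weight j x * B" and N = 0])
       (use b x gauss_weight_sums[of x] in \<open>auto intro!: summable_mult2 simp: sums_iff\<close>)
  then show "(\<lambda>j. gauss_weight j x * \<phi> (1 / (x + real j + 1))) sums gauss_op \<phi> x"
    unfolding gauss_op_def by (rule summable_sums)
  have "\<bar>\<Sum>j<N. gauss_weight j x * \<phi> (1 / (x + real j + 1))\<bar> \<le> (\<Sum>j<N. gauss_weight j x * B)"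
    by (rule order_trans[OF sum_abs]) (intro sum_mono b)
  also have "\<dots> = (\<Sum>j<N. gauss_weight j x) * B" by (simp add: sum_distrib_right)
  also have "\<dots> \<le> 1 * B" using sum_gauss_weight_le[of x N] x B0 by (intro mult_right_mono) auto
  finally show "\<bar>\<Sum>j<N. gauss_weight j x * \<phi> (1 / (x + real j + 1))\<bar> \<le> B" by simp
qed

lemma sum_inverse_cubes_le: "(\<Sum>j<N. 1 / (real j + 2) ^ 3) \<le> 1 / 4"
proof -
  \<comment> \<open>The strengthened bound is the exact partial sum of 1 / ((j + 1) (j + 2) (j +
    3)), which telescopes and dominates the inverse cubes term by term.\<close>
  have "(\<Sum>j<N. 1 / (real j + 2) ^ 3) \<le> 1/4 - 1 / (2 * (real N + 1) * (real N + 2))"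
  proof (induction N)
    case (Suc N)
    have "1 / (real N + 2) ^ 3 \<le> 1 / ((real N + 1) * (real N + 2) * (real N + 3))"
      by (intro divide_left_mono mult_pos_pos zero_less_power) (auto simp: algebra_simps power3_eq_cube)
    also have "\<dots> = 1 / (2 * (real N + 1) * (real N + 2)) - 1 / (2 * (real (Suc N) + 1) * (real (Suc N) + 2))"
      by (simp add: divide_simps) (simp add: algebra_simps)
    finally show ?case using Suc by simp
  qed simp
  also have "\<dots> \<le> 1 / 4" by simp
  finally show ?thesis .
qed

text \<open>Summation by parts, so that only differences of \<open>\<phi>\<close> enter, gives a contraction of the
  Lipschitz seminorm; the rate \<open>7/8\<close> is a crude version of Wirsing's \<open>2 \<zeta>(3) - \<zeta>(2)\<close>.\<close>

lemma lipschitz_on_gauss_op: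
  assumes \<phi>: "L-lipschitz_on {0..1} \<phi>"
  shows "(7 / 8 * L)-lipschitz_on {0..1} (gauss_op \<phi>)"
proof (rule lipschitz_onI)
  have L: "0 \<le> L" using \<phi> by (rule lipschitz_on_nonneg)
  then show "0 \<le> 7 / 8 * L" by simp
  fix x y :: real assume x: "x \<in> {0..1}" and y: "y \<in> {0..1}"
  define z where "z j t = 1 / (t + real j + 1)" for j :: nat and t :: real
  \<comment> \<open>\<open>S j t\<close> is the tail sum of the weights from index \<open>j\<close>
    on; \<open>d j\<close> compares the tails at the two points.\<close>
  define S where "S j t = (1 + t) / (t + real j + 1)" for j :: nat and t :: real
  define d where "d j = S j x - S j y" for j
  have z01: "z j t \<in> {0..1}" if "t \<in> {0..1}" for j t using that by (auto simp: z_def)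
  have Lip: "\<bar>\<phi> s - \<phi> t\<bar> \<le> L * \<bar>s - t\<bar>" if "s \<in> {0..1}" "t \<in> {0..1}" for s t
    using lipschitz_onD[OF \<phi> that] by (simp add: dist_real_def)
  define B where "B = \<bar>\<phi> 0\<bar> + L"
  have B: "\<bar>\<phi> t\<bar> \<le> B" if "t \<in> {0..1}" for t
  proof -
    have "L * \<bar>t\<bar> \<le> L * 1" using that L by (intro mult_left_mono) auto
    then show ?thesis using Lip[of t 0] that by (auto simp: B_def)
  qed
  \<comment> \<open>\<open>e\<close> measures how far the branch points move while the weights are
    kept, \<open>f\<close> how far the weights move once summation by parts has turned values of
    \<phi> into differences. Their sums, at most 5/8 and 1/4, add up to the rate 7/8.\<close>
  define e where "e j = gauss_weight j y * (z j x * z j y)" for j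
  define f where "f j = (real j + 1) / ((x + real j + 2) * (y + real j + 2)) * (z j x * z (Suc j) x)" for j
  have e0: "0 \<le> e j" for j
    using x y by (auto simp: e_def z_def gauss_weight_def)
  have f_le: "f j \<le> 1 / (real j + 2) ^ 3" for j
  proof -
    have a: "x + real j + 1 > 0" "x + real j + 2 > 0" "y + real j + 2 > 0" using x y by auto
    have "f j = ((real j + 1) / (x + real j + 1)) * (1 / ((x + real j + 2) * (y + real j + 2) * (x + real j + 2)))"
      by (simp add: f_def z_def algebra_simps)
    also have "\<dots> \<le> 1 * (1 / ((real j + 2) * (real j + 2) * (real j + 2)))"
      using x y a by (intro mult_mono divide_left_mono mult_mono) (auto simp: divide_simps)
    finally show ?thesis by (simp add: power3_eq_cube)
  qed
  \<comment> \<open>Index 0 is kept apart because \<open>e 0\<close> reaches 1/2 at x = y = 0; from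
    index 1 on, a factor (1 + y) / (y + j + 3) of at most 1/2 improves the inverse cube.\<close>
  have e_le0: "e 0 \<le> 1 / 2"
  proof -
    have "e 0 = 1 / ((y + 2) * (x + 1) * (y + 1))"
      using x y by (simp add: e_def z_def gauss_weight_def divide_simps)
    also have "\<dots> \<le> 1 / (2 * 1 * 1)"
      using x y by (intro divide_left_mono mult_mono) auto
    finally show ?thesis by simp
  qed
  have e_le: "e (Suc j) \<le> 1 / 2 * (1 / (real j + 2) ^ 3)" for j
  proof -
    have a: "x + real j + 2 > 0" "y + real j + 2 > 0" "y + real j + 3 > 0" using x y by auto
    have "e (Suc j) = ((1 + y) / (y + real j + 3)) * (1 / ((y + real j + 2) * (x + real j + 2) * (y + real j + 2)))"
      by (simp add: e_def z_def gauss_weight_def algebra_simps)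
    also have "\<dots> \<le> (1/2) * (1 / ((real j + 2) * (real j + 2) * (real j + 2)))"
      using x y a by (intro mult_mono divide_left_mono mult_mono) (auto simp: divide_simps)
    finally show ?thesis by (simp add: power3_eq_cube)
  qed
  have sum_e: "(\<Sum>j<N. e j) \<le> 5 / 8" for N
  proof -
    have "(\<Sum>j<N. e j) \<le> (\<Sum>j<Suc N. e j)" using e0 by simp
    also have "\<dots> = e 0 + (\<Sum>j<N. e (Suc j))" by (rule sum.lessThan_Suc_shift)
    also have "\<dots> \<le> 1/2 + (\<Sum>j<N. 1 / 2 * (1 / (real j + 2) ^ 3))"
      by (intro add_mono e_le0 sum_mono e_le)
    also have "\<dots> = 1/2 + 1/2 * (\<Sum>j<N. 1 / (real j + 2) ^ 3)" by (simp only: sum_distrib_left)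
    also have "\<dots> \<le> 5 / 8" using sum_inverse_cubes_le[of N] by simp
    finally show ?thesis .
  qed
  have sum_f: "(\<Sum>j<N. f j) \<le> 1 / 4" for N
    by (rule order_trans[OF sum_mono[OF f_le] sum_inverse_cubes_le])
  \<comment> \<open>The full tail has mass 1 at every point, so summation by parts leaves no
    boundary term at index 0. The one at \<open>N\<close> vanishes in the limit.\<close>
  have d0: "d 0 = 0"
  proof -
    have "(1 + x) / (x + 1) = 1" "(1 + y) / (y + 1) = 1" using x y by auto
    moreover have "d 0 = (1 + x) / (x + 1) - (1 + y) / (y + 1)" by (simp add: d_def S_def)
    ultimately show ?thesis by linarith
  qed
  have dSuc: "d (Suc j) = (x - y) * ((real j + 1) / ((x + real j + 2) * (y + real j + 2)))" for j
  proof -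
    have "x + real j + 2 \<noteq> 0" "y + real j + 2 \<noteq> 0" using x y by auto
    then show ?thesis by (simp add: d_def S_def divide_simps) (simp add: algebra_simps)
  qed
  have w_diff: "gauss_weight j x - gauss_weight j y = d j - d (Suc j)" for j
    using x y by (simp add: gauss_weight_diff d_def S_def)
  have parts: "(\<Sum>j<N. (d j - d (Suc j)) * \<phi> (z j x))
      = (\<Sum>j<N. d (Suc j) * (\<phi> (z (Suc j) x) - \<phi> (z j x))) - d N * \<phi> (z N x)" for N
    by (induction N) (simp_all add: d0 algebra_simps)
  have z_diff: "\<bar>z j x - z j y\<bar> = \<bar>x - y\<bar> * (z j x * z j y)" for j
  proof -
    have "x + real j + 1 > 0" "y + real j + 1 > 0" using x y by auto
    then have "z j x - z j y = (y - x) * (z j x * z j y)" "0 \<le> z j x * z j y"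
      by (auto simp: z_def divide_simps)
    then show ?thesis by (metis abs_minus_commute abs_mult abs_of_nonneg)
  qed
  have z_diff': "\<bar>z (Suc j) x - z j x\<bar> = z j x * z (Suc j) x" for j
  proof -
    have a: "x + real j + 1 > 0" "x + real j + 2 > 0" using x by auto
    then have "z j x - z (Suc j) x = z j x * z (Suc j) x"
      by (simp add: z_def divide_simps)
    moreover have "0 \<le> z j x * z (Suc j) x" using x by (auto simp: z_def)
    ultimately show ?thesis by linarith
  qed
  have fin: "\<bar>(\<Sum>j<N. gauss_weight j x * \<phi> (z j x)) - (\<Sum>j<N. gauss_weight j y * \<phi> (z j y))\<bar>
      \<le> 7 / 8 * L * \<bar>x - y\<bar> + \<bar>d N\<bar> * B" for N
  proof -
    have "(\<Sum>j<N. gauss_weight j x * \<phi> (z j x)) - (\<Sum>j<N. gauss_weight j y * \<phi> (z j y))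
        = (\<Sum>j<N. gauss_weight j y * (\<phi> (z j x) - \<phi> (z j y)) + (d j - d (Suc j)) * \<phi> (z j x))"
      unfolding sum_subtractf[symmetric] w_diff[symmetric] by (intro sum.cong) (auto simp: algebra_simps)
    also have "\<dots> = (\<Sum>j<N. gauss_weight j y * (\<phi> (z j x) - \<phi> (z j y)) + d (Suc j) * (\<phi> (z (Suc j) x) - \<phi> (z j x))) - d N * \<phi> (z N x)"
      by (simp only: sum.distrib parts add_diff_eq)
    finally have eq: "(\<Sum>j<N. gauss_weight j x * \<phi> (z j x)) - (\<Sum>j<N. gauss_weight j y * \<phi> (z j y)) = \<dots>" .
    have "\<bar>(\<Sum>j<N. gauss_weight j x * \<phi> (z j x)) - (\<Sum>j<N. gauss_weight j y * \<phi> (z j y))\<bar> \<le> (\<Sum>j<N. \<bar>gauss_weight j y * (\<phi> (z j x) - \<phi> (z j y)) + d (Suc j) * (\<phi> (z (Suc j) x) - \<phi> (z j x))\<bar>) + \<bar>d N * \<phi> (z N x)\<bar>"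
      unfolding eq by (rule order_trans[OF abs_triangle_ineq4]) (intro add_right_mono sum_abs)
    also have "\<dots> \<le> (\<Sum>j<N. L * \<bar>x - y\<bar> * (e j + f j)) + \<bar>d N\<bar> * B"
    proof (rule add_mono[OF sum_mono])
      show "\<bar>d N * \<phi> (z N x)\<bar> \<le> \<bar>d N\<bar> * B"
        unfolding abs_mult by (rule mult_left_mono[OF B[OF z01[OF x]]]) simp
      fix j
      have "\<bar>gauss_weight j y * (\<phi> (z j x) - \<phi> (z j y))\<bar> = gauss_weight j y * \<bar>\<phi> (z j x) - \<phi> (z j y)\<bar>"
        using gauss_weight_nonneg[of y j] y by (simp add: abs_mult)
      also have "\<dots> \<le> gauss_weight j y * (L * \<bar>z j x - z j y\<bar>)"
        using gauss_weight_nonneg[of y j] y by (intro mult_left_mono Lip z01 x) auto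
      also have "\<dots> = L * \<bar>x - y\<bar> * e j" by (simp only: z_diff e_def mult_ac)
      finally have 1: "\<bar>gauss_weight j y * (\<phi> (z j x) - \<phi> (z j y))\<bar> \<le> L * \<bar>x - y\<bar> * e j" .
      have "\<bar>d (Suc j) * (\<phi> (z (Suc j) x) - \<phi> (z j x))\<bar> \<le> \<bar>d (Suc j)\<bar> * (L * \<bar>z (Suc j) x - z j x\<bar>)"
        unfolding abs_mult by (intro mult_left_mono Lip z01 x) auto
      also have "\<bar>d (Suc j)\<bar> = \<bar>x - y\<bar> * ((real j + 1) / ((x + real j + 2) * (y + real j + 2)))"
        unfolding dSuc abs_mult using x y by (subst abs_of_nonneg[of "_ / _"]) auto
      also have "\<dots> * (L * \<bar>z (Suc j) x - z j x\<bar>) = L * \<bar>x - y\<bar> * f j" by (simp only: z_diff' f_def mult_ac)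
      finally have 2: "\<bar>d (Suc j) * (\<phi> (z (Suc j) x) - \<phi> (z j x))\<bar> \<le> L * \<bar>x - y\<bar> * f j" .
      show "\<bar>gauss_weight j y * (\<phi> (z j x) - \<phi> (z j y)) + d (Suc j) * (\<phi> (z (Suc j) x) - \<phi> (z j x))\<bar>
          \<le> L * \<bar>x - y\<bar> * (e j + f j)"
        unfolding distrib_left[of "L * \<bar>x - y\<bar>"] by (rule order_trans[OF abs_triangle_ineq add_mono[OF 1 2]])
    qed
    also have "\<dots> = L * \<bar>x - y\<bar> * ((\<Sum>j<N. e j) + (\<Sum>j<N. f j)) + \<bar>d N\<bar> * B"
      by (simp only: sum_distrib_left[symmetric] sum.distrib[symmetric])
    also have "\<dots> \<le> L * \<bar>x - y\<bar> * (5/8 + 1/4) + \<bar>d N\<bar> * B"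
      using L add_mono[OF sum_e[of N] sum_f[of N]] by (intro add_right_mono mult_left_mono) auto
    finally show ?thesis by simp
  qed
  have lim: "(\<lambda>N. \<Sum>j<N. gauss_weight j t * \<phi> (z j t)) \<longlonglongrightarrow> gauss_op \<phi> t" if "t \<in> {0..1}" for t
    using gauss_op_sums(1)[OF that B] by (simp add: sums_def z_def)
  have dlim: "d \<longlonglongrightarrow> 0" unfolding d_def S_def by real_asymp
  have "\<bar>gauss_op \<phi> x - gauss_op \<phi> y\<bar> \<le> 7 / 8 * L * \<bar>x - y\<bar> + \<bar>0\<bar> * B"
    by (rule LIMSEQ_le[OF tendsto_rabs[OF tendsto_diff[OF lim[OF x] lim[OF y]]]
          tendsto_add[OF tendsto_const tendsto_mult[OF tendsto_rabs[OF dlim] tendsto_const]]])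
       (use fin in auto)
  then show "dist (gauss_op \<phi> x) (gauss_op \<phi> y) \<le> 7 / 8 * L * dist x y"
    by (simp add: dist_real_def)
qed

section \<open>The Gauss map, its invariant measure and the duality with the transfer
  operator\<close>

definition gauss_map :: "real \<Rightarrow> real" where
  "gauss_map x = frac (1 / x)"

text \<open>The measure is left unnormalised; its total mass is ln 2, which enters the mixing
  estimates as the factor \<open>m\<close>.\<close>

definition gauss_measure :: "real measure" where
  "gauss_measure = density lborel (\<lambda>x. ennreal (indicator {0<..<1} x / (1 + x)))"

lemma sets_gauss_measure [measurable_cong, simp]: "sets gauss_measure = sets borel"
  and space_gauss_measure [simp]: "space gauss_measure = UNIV"
  by (simp_all add: gauss_measure_def)

lemma borel_measurable_frac [measurable]: "(frac :: real \<Rightarrow> real) \<in> borel_measurable borel"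
  unfolding frac_def by measurable

lemma borel_measurable_gauss_map [measurable]: "gauss_map \<in> borel_measurable borel"
  unfolding gauss_map_def by measurable

lemma borel_measurable_gauss_op [measurable]:
  assumes [measurable]: "\<phi> \<in> borel_measurable borel"
  shows "gauss_op \<phi> \<in> borel_measurable borel"
  unfolding gauss_op_def gauss_weight_def by measurable

lemma gauss_measure_integral:
  fixes f :: "real \<Rightarrow> 'a::{banach, second_countable_topology}"
  assumes [measurable]: "f \<in> borel_measurable borel"
  shows "integral\<^sup>L gauss_measure f = (\<integral>x. (indicator {0<..<1} x / (1 + x)) *\<^sub>R f x \<partial>lborel)"
    and "integrable gauss_measure f \<longleftrightarrow> integrable lborel (\<lambda>x. (indicator {0<..<1} x / (1 + x)) *\<^sub>R f x)"
  unfolding gauss_measure_def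
  by (intro integral_density integrable_density; auto simp: indicator_def)+

lemma AE_gauss_measure: "AE x in gauss_measure. P x" if "AE x in lborel. x \<in> {0<..<1} \<longrightarrow> P x"
  using that unfolding gauss_measure_def
  by (subst AE_density) (auto simp: indicator_def elim!: eventually_mono split: if_splits)

lemma AE_gauss_measure_unit: "AE x in gauss_measure. x \<in> {0<..<1}"
  by (rule AE_gauss_measure) simp

lemma finite_gauss_measure: "finite_measure gauss_measure"
proof (rule finite_measureI)
  have "emeasure gauss_measure UNIV = (\<integral>\<^sup>+x. ennreal (indicator {0<..<1} x / (1 + x)) \<partial>lborel)"
    by (simp add: gauss_measure_def emeasure_density)
  also have "\<dots> \<le> (\<integral>\<^sup>+x. indicator {0<..<1::real} x \<partial>lborel)"
    by (intro nn_integral_mono) (auto simp: indicator_def intro!: ennreal_leI)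
  also have "\<dots> < \<infinity>" by simp
  finally show "emeasure gauss_measure (space gauss_measure) \<noteq> \<infinity>" by auto
qed

interpretation gauss: finite_measure gauss_measure
  by (rule finite_gauss_measure)

lemma gauss_measure_pos: "0 < measure gauss_measure UNIV"
proof -
  have "measure gauss_measure UNIV \<noteq> 0"
  proof
    assume "measure gauss_measure UNIV = 0"
    then have "AE x in gauss_measure. False"
      by (intro AE_I'[of UNIV]) (auto simp: null_sets_def gauss.emeasure_eq_measure)
    then have "AE x in lborel. x \<notin> {0<..<1::real}"
      unfolding gauss_measure_def by (subst (asm) AE_density) (auto simp: indicator_def elim!: eventually_mono)
    then have "emeasure lborel {0<..<1::real} = 0"
      by (subst (asm) AE_iff_measurable[OF _ refl]) (auto simp: greaterThanLessThan_def greaterThan_def lessThan_def Int_def)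
    then show False by simp
  qed
  then show ?thesis by (simp add: zero_less_measure_iff)
qed

lemma integrable_gauss_bounded:
  fixes f :: "real \<Rightarrow> real"
  assumes "f \<in> borel_measurable borel" and "\<And>x. x \<in> {0<..<1} \<Longrightarrow> \<bar>f x\<bar> \<le> B"
  shows "integrable gauss_measure f"
proof (rule gauss.integrable_const_bound[where B = B])
  show "AE x in gauss_measure. norm (f x) \<le> B"
    using AE_gauss_measure_unit by eventually_elim (use assms(2) in simp)
qed (use assms(1) in simp)

text \<open>Substitution along the inverse branch u = 1 / (v + j + 1): the Jacobian 1 / (v + j +
  1)^2 times the density 1 / (1 + u) is 1 / ((v + j + 1) (v + j + 2)), that is,
  \<open>gauss_weight j v\<close> times the density at \<open>v\<close>.\<close>

lemma gauss_branch_integral: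
  assumes [measurable]: "\<phi> \<in> borel_measurable borel" "\<psi> \<in> borel_measurable borel"
    and \<phi>: "\<And>t. t \<in> {0..1} \<Longrightarrow> \<bar>\<phi> t\<bar> \<le> B" and \<psi>: "\<And>t. \<bar>\<psi> t\<bar> \<le> C"
  shows "(\<integral>u. indicator {1 / (real j + 2)<..<1 / (real j + 1)} u * (\<phi> u * \<psi> (gauss_map u)) \<partial>gauss_measure)
       = (\<integral>v. gauss_weight j v * \<phi> (1 / (v + real j + 1)) * \<psi> v \<partial>gauss_measure)"
proof -
  define I where "I = {1 / (real j + 2)<..<1 / (real j + 1)}"
  define g where "g v = 1 / (v + real j + 1)" for v
  define F where "F u = \<phi> u * \<psi> (gauss_map u) / (1 + u)" for u
  have [measurable]: "F \<in> borel_measurable borel" "g \<in> borel_measurable borel" "I \<in> sets borel"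
    unfolding F_def g_def I_def by measurable
  have gI: "g ` {0<..<1} = I"
  proof (intro equalityI subsetI)
    fix u assume "u \<in> g ` {0<..<1}" then show "u \<in> I" by (auto simp: g_def I_def divide_simps)
  next
    fix u assume u: "u \<in> I"
    then have "0 < u" by (auto simp: I_def intro: less_trans[rotated])
    then have "1 / u - real j - 1 \<in> {0<..<1}" "u = g (1 / u - real j - 1)"
      using u by (auto simp: I_def g_def field_simps)
    then show "u \<in> g ` {0<..<1}" by blast
  qed
  have I01: "I \<subseteq> {0<..<1}"
    unfolding gI[symmetric] by (auto simp: g_def divide_simps)
  have F_bound: "\<bar>indicator I u *\<^sub>R F u\<bar> \<le> B * C" for u
  proof (cases "u \<in> I")
    case True
    then have u: "u \<in> {0<..<1}" using I01 by auto
    have "\<bar>F u\<bar> = \<bar>\<phi> u\<bar> * \<bar>\<psi> (gauss_map u)\<bar> * (1 / (1 + u))" using u by (simp add: F_def abs_mult)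
    also have "\<dots> \<le> (B * C) * 1" using u \<phi>[of u] \<psi>[of "gauss_map u"]
      by (intro mult_mono) auto
    finally show ?thesis using True by simp
  next
    case False
    have "0 \<le> B * C" using \<phi>[of 0] \<psi>[of 0] by (intro mult_nonneg_nonneg) auto
    then show ?thesis using False by simp
  qed
  have Fint: "integrable lborel (\<lambda>u. indicator I u *\<^sub>R F u)"
  proof (rule Bochner_Integration.integrable_bound[of lborel "\<lambda>u. indicator {0<..<1} u *\<^sub>R (B * C)"])
    show "AE x in lborel. norm (indicat_real I x *\<^sub>R F x) \<le> norm (indicat_real {0<..<1} x *\<^sub>R (B * C))"
    proof (intro AE_I2)
      fix x show "norm (indicat_real I x *\<^sub>R F x) \<le> norm (indicat_real {0<..<1} x *\<^sub>R (B * C))"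
        using F_bound[of x] I01 by (cases "x \<in> I") auto
    qed
  qed (auto intro!: integrable_real_mult_indicator)
  have "(\<integral>u. indicator I u * (\<phi> u * \<psi> (gauss_map u)) \<partial>gauss_measure) = (\<integral>u. indicator I u *\<^sub>R F u \<partial>lborel)"
    using I01 by (subst gauss_measure_integral) (auto simp: F_def indicator_def intro!: Bochner_Integration.integral_cong)
  also have "\<dots> = (\<integral>v. indicator {0<..<1} v *\<^sub>R (\<bar>- (1 / (v + real j + 1)\<^sup>2)\<bar> *\<^sub>R F (g v)) \<partial>lborel)"
    unfolding gI[symmetric]
  proof (rule lborel_integral_change_of_variables)
    show "(g has_real_derivative - (1 / (v + real j + 1)\<^sup>2)) (at v within {0<..<1})" if "v \<in> {0<..<1}" for v
      unfolding g_def using that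
      by (auto intro!: derivative_eq_intros simp: power2_eq_square divide_simps)
    show "inj_on g {0<..<1}" by (auto simp: inj_on_def g_def)
  qed (use Fint gI in auto)
  also have "\<dots> = (\<integral>v. gauss_weight j v * \<phi> (1 / (v + real j + 1)) * \<psi> v \<partial>gauss_measure)"
  proof (subst gauss_measure_integral)
    show "(\<lambda>v. gauss_weight j v * \<phi> (1 / (v + real j + 1)) * \<psi> v) \<in> borel_measurable borel"
      unfolding gauss_weight_def by measurable
    have "indicator {0<..<1} v *\<^sub>R (\<bar>- (1 / (v + real j + 1)\<^sup>2)\<bar> *\<^sub>R F (g v))
        = (indicator {0<..<1} v / (1 + v)) *\<^sub>R (gauss_weight j v * \<phi> (1 / (v + real j + 1)) * \<psi> v)" for v
    proof (cases "v \<in> {0<..<1}")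
      case True
      have "frac (v + real (Suc j)) = v"
        using True frac_unique_iff[of "v + real (Suc j)" v] by auto
      then have "gauss_map (g v) = v" by (simp add: gauss_map_def g_def algebra_simps)
      moreover have "v + real j + 1 > 0" "v + real j + 2 > 0" "1 + v > 0" using True by auto
      ultimately show ?thesis using True
        by (simp add: F_def gauss_weight_def g_def divide_simps power2_eq_square)
    qed simp
    then show "(\<integral>v. indicator {0<..<1} v *\<^sub>R (\<bar>- (1 / (v + real j + 1)\<^sup>2)\<bar> *\<^sub>R F (g v)) \<partial>lborel)
      = (\<integral>v. (indicator {0<..<1} v / (1 + v)) *\<^sub>R (gauss_weight j v * \<phi> (1 / (v + real j + 1)) * \<psi> v) \<partial>lborel)"
      by simp
  qed
  finally show ?thesis unfolding I_def .
qed

lemma unit_interval_branch_sums: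
  fixes u :: real
  assumes u: "u \<in> {0<..<1}" and "1 / u \<notin> \<int>"
  shows "(\<lambda>j. indicator {1 / (real j + 2)<..<1 / (real j + 1)} u) sums (1 :: real)"
proof -
  \<comment> \<open>Branch \<open>j\<close> contains the points where 1 / u has integer part j + 1,
    whence the shift by 1.\<close>
  define m where "m = nat \<lfloor>1 / u\<rfloor> - 1"
  have "1 < 1 / u" using u by simp
  then have 1: "1 \<le> \<lfloor>1 / u\<rfloor>" by linarith
  have "real_of_int \<lfloor>1 / u\<rfloor> \<noteq> 1 / u" using assms(2) by (metis Ints_of_int)
  then have 2: "real_of_int \<lfloor>1 / u\<rfloor> < 1 / u" "1 / u < 1 + real_of_int \<lfloor>1 / u\<rfloor>" by linarith+
  have m: "real m = real_of_int \<lfloor>1 / u\<rfloor> - 1" using 1 unfolding m_def by linarith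
  have iff: "u \<in> {1 / (real j + 2)<..<1 / (real j + 1)} \<longleftrightarrow> j = m" for j
  proof -
    have "u \<in> {1 / (real j + 2)<..<1 / (real j + 1)} \<longleftrightarrow> real j + 1 < 1 / u \<and> 1 / u < real j + 2"
      using u by (auto simp: field_simps)
    also have "\<dots> \<longleftrightarrow> j = m"
    proof
      assume *: "real j + 1 < 1 / u \<and> 1 / u < real j + 2"
      then have "\<lfloor>1 / u\<rfloor> = int j + 1" by linarith
      then show "j = m" by (simp add: m_def)
    qed (use 2 m in auto)
    finally show ?thesis .
  qed
  have "(\<lambda>j. indicator {1 / (real j + 2)<..<1 / (real j + 1)} u :: real) = (\<lambda>j. if j = m then 1 else 0)"
    using iff by (auto simp: indicator_def fun_eq_iff)
  then show ?thesis using sums_single[of m "\<lambda>_. 1 :: real"] by simp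
qed

text \<open>The operator is adjoint to composition with the Gauss map: the branch identities are
  summed. Both partial sums stay below B * C, since branch indicators and weights each add up to at
  most 1. The bound on \<phi> is confined to [0, 1] because that is where Lipschitz control is
  available.\<close>

lemma gauss_op_integral:
  assumes [measurable]: "\<phi> \<in> borel_measurable borel" "\<psi> \<in> borel_measurable borel"
    and \<phi>: "\<And>t. t \<in> {0..1} \<Longrightarrow> \<bar>\<phi> t\<bar> \<le> B" and \<psi>: "\<And>t. \<bar>\<psi> t\<bar> \<le> C"
  shows "(\<integral>u. \<phi> u * \<psi> (gauss_map u) \<partial>gauss_measure) = (\<integral>v. gauss_op \<phi> v * \<psi> v \<partial>gauss_measure)"
proof -
  have B: "0 \<le> B" and C: "0 \<le> C" using \<phi>[of 0] \<psi>[of 0] by auto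
  define I where "I j = {1 / (real j + 2)<..<1 / (real j + 1)}" for j :: nat
  have [measurable]: "I j \<in> sets borel" for j unfolding I_def by simp
  have [measurable]: "gauss_weight j \<in> borel_measurable borel" for j unfolding gauss_weight_def by measurable
  have I1: "(\<lambda>j. indicator (I j) u) sums (1 :: real)" if "u \<in> {0<..<1}" "1 / u \<notin> \<int>" for u
    unfolding I_def using that by (rule unit_interval_branch_sums)
  \<comment> \<open>The open branch intervals miss only the reciprocals of integers inside the unit
    interval, a countable set.\<close>
  have "AE u::real in lborel. 1 / u \<notin> \<int>"
  proof (rule AE_I'[of "{u::real. 1 / u \<in> \<int>}"])
    have "{u::real. 1 / u \<in> \<int>} \<subseteq> range (\<lambda>k::int. 1 / of_int k)"
    proof
      fix u :: real assume "u \<in> {u. 1 / u \<in> \<int>}"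
      then obtain k :: int where "1 / u = of_int k" by (auto elim: Ints_cases)
      then have "u = 1 / of_int k" by (metis div_by_1 divide_divide_eq_right mult_1)
      then show "u \<in> range (\<lambda>k::int. 1 / of_int k)" by auto
    qed
    then have "countable {u::real. 1 / u \<in> \<int>}" by (rule countable_subset) simp
    then show "{u::real. 1 / u \<in> \<int>} \<in> null_sets lborel"
      by (rule countable_imp_null_set_lborel)
  qed auto
  then have nint: "AE u in gauss_measure. 1 / u \<notin> \<int>"
    by (intro AE_gauss_measure) (auto elim: eventually_mono)
  let ?s = "\<lambda>N u. \<Sum>j<N. indicator (I j) u * (\<phi> u * \<psi> (gauss_map u))"
  let ?t = "\<lambda>N v. \<Sum>j<N. gauss_weight j v * \<phi> (1 / (v + real j + 1)) * \<psi> v"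
  have lhs: "(\<lambda>N. \<integral>u. ?s N u \<partial>gauss_measure) \<longlonglongrightarrow> (\<integral>u. \<phi> u * \<psi> (gauss_map u) \<partial>gauss_measure)"
  proof (rule integral_dominated_convergence[where w = "\<lambda>_. B * C"])
    show "AE u in gauss_measure. (\<lambda>N. ?s N u) \<longlonglongrightarrow> \<phi> u * \<psi> (gauss_map u)"
      using nint AE_gauss_measure_unit
    proof eventually_elim
      case (elim u)
      from sums_mult2[OF I1[OF elim(2,1)], of "\<phi> u * \<psi> (gauss_map u)"]
      show ?case by (simp add: sums_def)
    qed
    fix N
    show "AE u in gauss_measure. norm (?s N u) \<le> B * C"
      using nint AE_gauss_measure_unit
    proof eventually_elim
      case (elim u)
      have "(\<Sum>j<N. indicator (I j) u) \<le> (1::real)"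
        using sum_le_suminf[of "\<lambda>j. indicator (I j) u :: real" "{..<N}"] I1[OF elim(2,1)]
        by (auto simp: sums_iff)
      moreover have "0 \<le> (\<Sum>j<N. indicator (I j) u :: real)" by (intro sum_nonneg) simp
      ultimately have "\<bar>\<Sum>j<N. indicator (I j) u\<bar> * (\<bar>\<phi> u\<bar> * \<bar>\<psi> (gauss_map u)\<bar>) \<le> 1 * (B * C)"
        using elim \<phi>[of u] \<psi> B C by (intro mult_mono) auto
      then show ?case by (simp add: sum_distrib_right[symmetric] abs_mult)
    qed
  qed simp_all
  have rhs: "(\<lambda>N. \<integral>v. ?t N v \<partial>gauss_measure) \<longlonglongrightarrow> (\<integral>v. gauss_op \<phi> v * \<psi> v \<partial>gauss_measure)"
  proof (rule integral_dominated_convergence[where w = "\<lambda>_. B * C"])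
    show "AE v in gauss_measure. (\<lambda>N. ?t N v) \<longlonglongrightarrow> gauss_op \<phi> v * \<psi> v"
      using AE_gauss_measure_unit
    proof eventually_elim
      case (elim v)
      then have "v \<in> {0..1}" by auto
      from sums_mult2[OF gauss_op_sums(1)[where \<phi> = \<phi> and B = B, OF this \<phi>], of "\<psi> v"]
      show ?case by (simp add: sums_def)
    qed
    fix N
    show "AE v in gauss_measure. norm (?t N v) \<le> B * C"
      using AE_gauss_measure_unit
    proof eventually_elim
      case (elim v)
      then have "v \<in> {0..1}" by auto
      from gauss_op_sums(2)[where \<phi> = \<phi> and B = B, OF this \<phi>, of N]
      have "\<bar>\<Sum>j<N. gauss_weight j v * \<phi> (1 / (v + real j + 1))\<bar> * \<bar>\<psi> v\<bar> \<le> B * C"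
        using \<psi> B by (intro mult_mono) auto
      then show ?case by (simp add: sum_distrib_right[symmetric] abs_mult)
    qed
  qed simp_all
  have "(\<integral>u. ?s N u \<partial>gauss_measure) = (\<integral>v. ?t N v \<partial>gauss_measure)" for N
  proof -
    have "integrable gauss_measure (\<lambda>u. indicator (I j) u * (\<phi> u * \<psi> (gauss_map u)))" for j
      by (rule integrable_gauss_bounded[where B = "B * C"])
         (auto simp: abs_mult indicator_def intro!: mult_mono mult_nonneg_nonneg \<phi> \<psi> B C)
    moreover have "integrable gauss_measure (\<lambda>v. gauss_weight j v * \<phi> (1 / (v + real j + 1)) * \<psi> v)" for j
    proof (rule integrable_gauss_bounded[where B = "1 * B * C"])
      fix v :: real assume v: "v \<in> {0<..<1}"
      have "gauss_weight j v \<le> (\<Sum>j<Suc j. gauss_weight j v)"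
        using v by (simp add: sum_nonneg gauss_weight_nonneg)
      then have "\<bar>gauss_weight j v\<bar> \<le> 1"
        using sum_gauss_weight_le[of v "Suc j"] v gauss_weight_nonneg[of v j] by auto
      moreover have "\<bar>\<phi> (1 / (v + real j + 1))\<bar> \<le> B" using v by (intro \<phi>) auto
      ultimately show "\<bar>gauss_weight j v * \<phi> (1 / (v + real j + 1)) * \<psi> v\<bar> \<le> 1 * B * C"
        unfolding abs_mult using B C \<psi> by (intro mult_mono) auto
    qed measurable
    ultimately show ?thesis
      using gauss_branch_integral[where \<phi> = \<phi> and \<psi> = \<psi> and B = B and C = C, OF _ _ \<phi> \<psi>] by (simp only: Bochner_Integration.integral_sum I_def assms)
  qed
  then show ?thesis using LIMSEQ_unique[OF lhs] rhs by simp
qed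

section \<open>Mixing of the Gauss map\<close>

lemma lipschitz_on_unit_interval_bound:
  fixes \<phi> :: "real \<Rightarrow> real"
  assumes "L-lipschitz_on {0..1} \<phi>" and "t \<in> {0..1}"
  shows "\<bar>\<phi> t - \<phi> 0\<bar> \<le> L"
proof -
  have "\<bar>\<phi> t - \<phi> 0\<bar> \<le> L * \<bar>t - 0\<bar>"
    using lipschitz_onD[OF assms(1), of t 0] assms(2) by (simp add: dist_real_def)
  also have "\<dots> \<le> L * 1"
    using assms(2) lipschitz_on_nonneg[OF assms(1)] by (intro mult_left_mono) auto
  finally show ?thesis by simp
qed

lemma borel_measurable_gauss_op_funpow [measurable]:
  "\<phi> \<in> borel_measurable borel \<Longrightarrow> (gauss_op ^^ n) \<phi> \<in> borel_measurable borel"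
  by (induction n) auto

lemma borel_measurable_gauss_map_funpow [measurable]: "gauss_map ^^ n \<in> borel_measurable borel"
  by (induction n) (auto simp: id_def)

lemma lipschitz_on_gauss_op_funpow:
  "L-lipschitz_on {0..1} \<phi> \<Longrightarrow> ((7 / 8) ^ n * L)-lipschitz_on {0..1} ((gauss_op ^^ n) \<phi>)"
proof (induction n)
  case (Suc n)
  from lipschitz_on_gauss_op[OF Suc.IH[OF Suc.prems]] show ?case by (simp add: mult.assoc)
qed simp

text \<open>The innermost Gauss map is moved over first, so the induction has to range over all
  \<phi>; each step passes to \<open>gauss_op \<phi>\<close>, whose Lipschitz constant again
  supplies a bound on [0, 1].\<close>

lemma gauss_op_funpow_integral:
  assumes "\<phi> \<in> borel_measurable borel" and [measurable]: "\<psi> \<in> borel_measurable borel"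
    and "L-lipschitz_on {0..1} \<phi>" and \<psi>: "\<And>t. \<bar>\<psi> t\<bar> \<le> C"
  shows "(\<integral>u. \<phi> u * \<psi> ((gauss_map ^^ n) u) \<partial>gauss_measure)
       = (\<integral>v. (gauss_op ^^ n) \<phi> v * \<psi> v \<partial>gauss_measure)"
  using assms(1,3)
proof (induction n arbitrary: \<phi> L)
  case (Suc n)
  note [measurable] = Suc.prems(1)
  have "(\<integral>u. \<phi> u * \<psi> ((gauss_map ^^ Suc n) u) \<partial>gauss_measure)
      = (\<integral>u. \<phi> u * \<psi> ((gauss_map ^^ n) (gauss_map u)) \<partial>gauss_measure)"
    by (simp add: funpow_swap1)
  also have "\<dots> = (\<integral>v. gauss_op \<phi> v * \<psi> ((gauss_map ^^ n) v) \<partial>gauss_measure)"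
  proof (rule gauss_op_integral[where B = "\<bar>\<phi> 0\<bar> + L" and C = C])
    show "\<bar>\<phi> t\<bar> \<le> \<bar>\<phi> 0\<bar> + L" if "t \<in> {0..1}" for t
      using lipschitz_on_unit_interval_bound[OF Suc.prems(2) that] by linarith
  qed (use \<psi> in measurable)
  also have "\<dots> = (\<integral>v. (gauss_op ^^ n) (gauss_op \<phi>) v * \<psi> v \<partial>gauss_measure)"
    by (rule Suc.IH[OF _ lipschitz_on_gauss_op[OF Suc.prems(2)]]) measurable
  finally show ?case by (simp add: funpow_swap1)
qed simp

text \<open>After \<open>n\<close> steps the transferred function differs from its value at 0 by at
  most q = (7/8)^n L on [0, 1]. For a constant function the difference of products is exactly 0, so
  only this deviation is paid for, once in each product. Multiplying by the mass \<open>m\<close>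
  avoids normalising.\<close>

lemma gauss_map_mixing:
  assumes [measurable]: "\<phi> \<in> borel_measurable borel" "\<psi> \<in> borel_measurable borel"
    and \<phi>: "L-lipschitz_on {0..1} \<phi>" and \<psi>: "\<And>t. \<bar>\<psi> t\<bar> \<le> C"
  defines "m \<equiv> measure gauss_measure UNIV"
  shows "\<bar>m * (\<integral>u. \<phi> u * \<psi> ((gauss_map ^^ n) u) \<partial>gauss_measure)
           - (\<integral>u. \<phi> u \<partial>gauss_measure) * (\<integral>u. \<psi> u \<partial>gauss_measure)\<bar> \<le> 2 * ((7 / 8) ^ n * L) * C * m\<^sup>2"
proof -
  define h where "h = (gauss_op ^^ n) \<phi>"
  define q where "q = (7 / 8) ^ n * L"
  have [measurable]: "h \<in> borel_measurable borel" unfolding h_def by measurable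
  have h: "\<bar>h t - h 0\<bar> \<le> q" if "t \<in> {0..1}" for t
    using lipschitz_on_unit_interval_bound[OF lipschitz_on_gauss_op_funpow[OF \<phi>] that]
    by (simp add: h_def q_def)
  have q0: "0 \<le> q" using h[of 0] by simp
  have m0: "0 \<le> m" by (simp add: m_def)
  have h_int: "integrable gauss_measure h"
    by (rule integrable_gauss_bounded[where B = "\<bar>h 0\<bar> + q"], measurable) (smt (verit) h atLeastAtMost_iff greaterThanLessThan_iff)
  have \<psi>_int: "integrable gauss_measure \<psi>"
    by (rule integrable_gauss_bounded[where B = C]) (use \<psi> in auto)
  have h\<psi>_int: "integrable gauss_measure (\<lambda>u. (h u - h 0) * \<psi> u)"
    by (rule integrable_gauss_bounded[where B = "q * C"])
       (use h \<psi> q0 in \<open>auto simp: abs_mult intro!: mult_mono\<close>)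
  have const: "(\<integral>u. c \<partial>gauss_measure) = m * c" for c :: real by (simp add: m_def)
  have 1: "(\<integral>u. \<phi> u * \<psi> ((gauss_map ^^ n) u) \<partial>gauss_measure) = (\<integral>u. h u * \<psi> u \<partial>gauss_measure)"
    unfolding h_def by (rule gauss_op_funpow_integral[OF _ _ \<phi> \<psi>]) measurable
  \<comment> \<open>Duality tested on the constant 1: the operator preserves the integral.\<close>
  have 2: "(\<integral>u. \<phi> u \<partial>gauss_measure) = (\<integral>u. h u \<partial>gauss_measure)"
    using gauss_op_funpow_integral[of \<phi> "\<lambda>_. 1" L 1 n] \<phi> by (simp add: h_def)
  have "\<bar>\<integral>u. (h u - h 0) * \<psi> u \<partial>gauss_measure\<bar> \<le> (\<integral>u. q * C \<partial>gauss_measure)"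
  proof (rule order_trans[OF integral_abs_bound], rule integral_mono_AE)
    show "AE u in gauss_measure. \<bar>(h u - h 0) * \<psi> u\<bar> \<le> q * C"
      using AE_gauss_measure_unit
      by eventually_elim (use h \<psi> q0 in \<open>auto simp: abs_mult intro!: mult_mono\<close>)
  qed (use h\<psi>_int in auto)
  then have 3: "\<bar>\<integral>u. (h u - h 0) * \<psi> u \<partial>gauss_measure\<bar> \<le> m * (q * C)" by (simp only: const)
  have "\<bar>\<integral>u. h u - h 0 \<partial>gauss_measure\<bar> \<le> (\<integral>u. q \<partial>gauss_measure)"
  proof (rule order_trans[OF integral_abs_bound], rule integral_mono_AE)
    show "AE u in gauss_measure. \<bar>h u - h 0\<bar> \<le> q"
      using AE_gauss_measure_unit by eventually_elim (use h in auto)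
  qed (use h_int in auto)
  then have 4: "\<bar>\<integral>u. h u - h 0 \<partial>gauss_measure\<bar> \<le> m * q" by (simp only: const)
  have "\<bar>\<integral>u. \<psi> u \<partial>gauss_measure\<bar> \<le> (\<integral>u. C \<partial>gauss_measure)"
    by (rule order_trans[OF integral_abs_bound], rule integral_mono) (use \<psi> \<psi>_int in auto)
  then have 5: "\<bar>\<integral>u. \<psi> u \<partial>gauss_measure\<bar> \<le> m * C" by (simp only: const)
  have "(\<integral>u. h u * \<psi> u \<partial>gauss_measure) = (\<integral>u. (h u - h 0) * \<psi> u + h 0 * \<psi> u \<partial>gauss_measure)"
    by (simp add: algebra_simps)
  also have "\<dots> = (\<integral>u. (h u - h 0) * \<psi> u \<partial>gauss_measure) + h 0 * (\<integral>u. \<psi> u \<partial>gauss_measure)"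
    using h\<psi>_int \<psi>_int by (subst Bochner_Integration.integral_add) auto
  finally have 6: "(\<integral>u. h u * \<psi> u \<partial>gauss_measure)
      = (\<integral>u. (h u - h 0) * \<psi> u \<partial>gauss_measure) + h 0 * (\<integral>u. \<psi> u \<partial>gauss_measure)" .
  have 7: "(\<integral>u. h u - h 0 \<partial>gauss_measure) = (\<integral>u. h u \<partial>gauss_measure) - m * h 0"
    using h_int by (subst Bochner_Integration.integral_diff) (auto simp: const m_def)
  \<comment> \<open>The contributions of the constant \<open>h 0\<close> to the two products cancel,
    leaving only deviations from it.\<close>
  have "m * (\<integral>u. \<phi> u * \<psi> ((gauss_map ^^ n) u) \<partial>gauss_measure)
        - (\<integral>u. \<phi> u \<partial>gauss_measure) * (\<integral>u. \<psi> u \<partial>gauss_measure)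
      = m * (\<integral>u. (h u - h 0) * \<psi> u \<partial>gauss_measure)
        - (\<integral>u. h u - h 0 \<partial>gauss_measure) * (\<integral>u. \<psi> u \<partial>gauss_measure)"
    unfolding 1 2 6 7 by (simp add: algebra_simps)
  note eq = this
  have "\<bar>m * (\<integral>u. \<phi> u * \<psi> ((gauss_map ^^ n) u) \<partial>gauss_measure)
        - (\<integral>u. \<phi> u \<partial>gauss_measure) * (\<integral>u. \<psi> u \<partial>gauss_measure)\<bar> \<le> m * (m * (q * C)) + (m * q) * (m * C)"
    unfolding eq
  proof (rule order_trans[OF abs_triangle_ineq4], rule add_mono)
    show "\<bar>m * (\<integral>u. (h u - h 0) * \<psi> u \<partial>gauss_measure)\<bar> \<le> m * (m * (q * C))"
      using mult_left_mono[OF 3 m0] m0 by (simp add: abs_mult)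
    show "\<bar>(\<integral>u. h u - h 0 \<partial>gauss_measure) * (\<integral>u. \<psi> u \<partial>gauss_measure)\<bar> \<le> (m * q) * (m * C)"
      unfolding abs_mult using 4 5 m0 q0 by (intro mult_mono) auto
  qed
  also have "m * (m * (q * C)) + (m * q) * (m * C) = 2 * ((7 / 8) ^ n * L) * C * m\<^sup>2"
    by (simp add: q_def power2_eq_square)
  finally show ?thesis .
qed

section \<open>Approximation by Lipschitz functions and rigidity of invariant densities\<close>

lemma real_polynomial_function_lipschitz_on:
  fixes p :: "real \<Rightarrow> real"
  assumes "real_polynomial_function p"
  shows "\<exists>L. L-lipschitz_on {a..b} p"
proof -
  obtain p' where p': "polynomial_function p'" "\<And>x. (p has_vector_derivative p' x) (at x)"
    using assms has_vector_derivative_polynomial_function[of p] by (auto simp: real_polynomial_function_eq)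
  have "bounded (p' ` {a..b})"
    using p'(1) by (intro compact_imp_bounded compact_continuous_image continuous_on_polymonial_function) auto
  then obtain L where L: "L > 0" "\<And>x. x \<in> {a..b} \<Longrightarrow> norm (p' x) \<le> L"
    by (auto simp: bounded_pos)
  have "L-lipschitz_on {a..b} p"
  proof (rule bounded_derivative_imp_lipschitz)
    show "(p has_derivative (\<lambda>h. h *\<^sub>R p' x)) (at x within {a..b})" for x
      using p'(2)[of x] by (auto simp: has_vector_derivative_def intro: has_derivative_at_withinI)
    show "onorm (\<lambda>h. h *\<^sub>R p' x) \<le> L" if "x \<in> {a..b}" for x
      using mult_left_mono[OF L(2)[OF that] abs_ge_zero] by (intro onorm_le) (simp add: abs_mult mult.commute)
  qed (use L in auto)
  then show ?thesis ..
qed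

text \<open>Three errors of \<epsilon> / 3: truncation, almost everywhere approximation by
  continuous functions, and uniform approximation by polynomials, which are Lipschitz on [0, 1]. The
  continuous approximants come without any common bound; clipping them at the same height as
  \<gamma> supplies the majorant for dominated convergence.\<close>

lemma gauss_lipschitz_dense:
  assumes \<gamma>: "integrable gauss_measure \<gamma>" and "0 < (\<epsilon>::real)"
  obtains \<phi> L where "\<phi> \<in> borel_measurable borel" "L-lipschitz_on {0..1} \<phi>" "integrable gauss_measure \<phi>"
    "(\<integral>u. \<bar>\<gamma> u - \<phi> u\<bar> \<partial>gauss_measure) < \<epsilon>"
proof -
  have [measurable]: "\<gamma> \<in> borel_measurable borel" using borel_measurable_integrable[OF \<gamma>] by simp
  define clip where "clip B t = max (- real B) (min (real B) t)" for B :: nat and t :: real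
  have [measurable]: "clip B \<in> borel_measurable borel" for B unfolding clip_def by measurable
  have clip_bd: "\<bar>clip B t\<bar> \<le> real B" for B t by (auto simp: clip_def)
  have clip_int: "integrable gauss_measure (\<lambda>u. clip B (f u))" if "f \<in> borel_measurable borel" for B f
    using that clip_bd by (intro integrable_gauss_bounded[where B = "real B"]) auto
  have "(\<lambda>B. \<integral>u. \<bar>\<gamma> u - clip B (\<gamma> u)\<bar> \<partial>gauss_measure) \<longlonglongrightarrow> (\<integral>u. 0 \<partial>gauss_measure)"
  proof (rule integral_dominated_convergence[where w = "\<lambda>u. \<bar>\<gamma> u\<bar>"])
    have "(\<lambda>B. \<bar>t - clip B t\<bar>) \<longlonglongrightarrow> 0" for t
    proof (rule tendsto_eventually)
      have "t = clip B t" if "B \<ge> nat \<lceil>\<bar>t\<bar>\<rceil>" for B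
        using that by (auto simp: clip_def max_def min_def)
      then show "\<forall>\<^sub>F B in sequentially. \<bar>t - clip B t\<bar> = 0"
        unfolding eventually_sequentially by (intro exI[of _ "nat \<lceil>\<bar>t\<bar>\<rceil>"]) auto
    qed
    then show "AE u in gauss_measure. (\<lambda>B. \<bar>\<gamma> u - clip B (\<gamma> u)\<bar>) \<longlonglongrightarrow> 0" by simp
    show "AE u in gauss_measure. norm \<bar>\<gamma> u - clip B (\<gamma> u)\<bar> \<le> \<bar>\<gamma> u\<bar>" for B
      by (auto simp: clip_def max_def min_def)
  qed (use \<gamma> in auto)
  then have "\<forall>\<^sub>F B in sequentially. (\<integral>u. \<bar>\<gamma> u - clip B (\<gamma> u)\<bar> \<partial>gauss_measure) < \<epsilon> / 3"
    using assms(2) by (intro order_tendstoD(2)[where y = 0]) auto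
  then obtain B where B: "(\<integral>u. \<bar>\<gamma> u - clip B (\<gamma> u)\<bar> \<partial>gauss_measure) < \<epsilon> / 3"
    by (auto simp: eventually_sequentially)
  have "\<gamma> measurable_on UNIV"
    by (rule lebesgue_measurable_imp_measurable_on_real) (auto intro!: measurable_completion)
  then obtain N h where N: "negligible N" and h: "\<And>n. continuous_on UNIV (h n)"
    and lim: "\<And>x. x \<notin> N \<Longrightarrow> (\<lambda>n. h n x) \<longlonglongrightarrow> \<gamma> x"
    by (auto simp: measurable_on_def)
  have [measurable]: "h n \<in> borel_measurable borel" for n
    using h by (rule borel_measurable_continuous_onI)
  obtain N' where N': "N' \<in> null_sets lborel" "N \<subseteq> N'"
    using N by (auto simp: negligible_iff_null_sets null_sets_completion_iff2)
  have AE_lim: "AE x in gauss_measure. (\<lambda>n. h n x) \<longlonglongrightarrow> \<gamma> x"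
    using N' lim by (intro AE_gauss_measure AE_I'[OF N'(1)]) auto
  have "(\<lambda>n. \<integral>u. \<bar>clip B (\<gamma> u) - clip B (h n u)\<bar> \<partial>gauss_measure) \<longlonglongrightarrow> (\<integral>u. 0 \<partial>gauss_measure)"
  proof (rule integral_dominated_convergence[where w = "\<lambda>u. 2 * real B"])
    show "AE u in gauss_measure. (\<lambda>n. \<bar>clip B (\<gamma> u) - clip B (h n u)\<bar>) \<longlonglongrightarrow> 0"
      using AE_lim
    proof eventually_elim
      case (elim u)
      have "(\<lambda>n. \<bar>clip B (\<gamma> u) - clip B (h n u)\<bar>) \<longlonglongrightarrow> \<bar>clip B (\<gamma> u) - clip B (\<gamma> u)\<bar>"
        unfolding clip_def by (intro tendsto_intros elim)
      then show ?case by simp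
    qed
    show "AE u in gauss_measure. norm \<bar>clip B (\<gamma> u) - clip B (h n u)\<bar> \<le> 2 * real B" for n
      using clip_bd by (intro AE_I2) (smt (verit) real_norm_def)
  qed auto
  then have "\<forall>\<^sub>F n in sequentially. (\<integral>u. \<bar>clip B (\<gamma> u) - clip B (h n u)\<bar> \<partial>gauss_measure) < \<epsilon> / 3"
    using assms(2) by (intro order_tendstoD(2)[where y = 0]) auto
  then obtain n where n: "(\<integral>u. \<bar>clip B (\<gamma> u) - clip B (h n u)\<bar> \<partial>gauss_measure) < \<epsilon> / 3"
    by (auto simp: eventually_sequentially)
  define m where "m = measure gauss_measure UNIV"
  have m: "0 < m" using gauss_measure_pos by (simp add: m_def)
  have "continuous_on {0..1} (\<lambda>u. clip B (h n u))"
    unfolding clip_def by (intro continuous_intros continuous_on_subset[OF h]) auto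
  then obtain p where p: "real_polynomial_function p" "\<And>u. u \<in> {0..1} \<Longrightarrow> \<bar>clip B (h n u) - p u\<bar> < \<epsilon> / (3 * m)"
    using Stone_Weierstrass_real_polynomial_function[of "{0..1}" "\<lambda>u. clip B (h n u)" "\<epsilon> / (3 * m)"] assms(2) m
    by auto
  have [measurable]: "p \<in> borel_measurable borel"
    using p(1) by (intro borel_measurable_continuous_onI continuous_on_polymonial_function)
      (simp add: real_polynomial_function_eq)
  obtain L where L: "L-lipschitz_on {0..1} p"
    using real_polynomial_function_lipschitz_on[OF p(1)] by blast
  have p_int: "integrable gauss_measure p"
    by (rule integrable_gauss_bounded[where B = "\<bar>p 0\<bar> + L"])
       (measurable, smt (verit) lipschitz_on_unit_interval_bound[OF L] atLeastAtMost_iff greaterThanLessThan_iff)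
  have "(\<integral>u. \<bar>clip B (h n u) - p u\<bar> \<partial>gauss_measure) \<le> (\<integral>u. \<epsilon> / (3 * m) \<partial>gauss_measure)"
  proof (rule integral_mono_AE)
    show "AE u in gauss_measure. \<bar>clip B (h n u) - p u\<bar> \<le> \<epsilon> / (3 * m)"
      using AE_gauss_measure_unit by eventually_elim (rule less_imp_le[OF p(2)], simp)
  qed (use p_int clip_int in auto)
  also have "\<dots> = \<epsilon> / 3" using m by (simp add: m_def[symmetric])
  finally have 3: "(\<integral>u. \<bar>clip B (h n u) - p u\<bar> \<partial>gauss_measure) \<le> \<epsilon> / 3" .
  have "(\<integral>u. \<bar>\<gamma> u - p u\<bar> \<partial>gauss_measure) \<le> (\<integral>u. \<bar>\<gamma> u - clip B (\<gamma> u)\<bar>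
      + (\<bar>clip B (\<gamma> u) - clip B (h n u)\<bar> + \<bar>clip B (h n u) - p u\<bar>) \<partial>gauss_measure)"
    by (rule integral_mono) (use \<gamma> p_int clip_int in auto)
  also have "\<dots> = (\<integral>u. \<bar>\<gamma> u - clip B (\<gamma> u)\<bar> \<partial>gauss_measure)
      + ((\<integral>u. \<bar>clip B (\<gamma> u) - clip B (h n u)\<bar> \<partial>gauss_measure) + (\<integral>u. \<bar>clip B (h n u) - p u\<bar> \<partial>gauss_measure))"
    using \<gamma> p_int clip_int by (simp add: Bochner_Integration.integral_add)
  also have "\<dots> < \<epsilon>" using B n 3 by linarith
  finally show ?thesis using that L p_int by simp
qed

text \<open>Invariance allows any even iterate to be inserted into the test function at no cost.
  Once \<gamma> is replaced by a nearby Lipschitz function, mixing splits the integral into a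
  product as the iterate grows, so \<gamma> acts on bounded functions like its mean
  \<open>D\<close>.\<close>

lemma gauss_invariant_density_const:
  assumes \<gamma>: "integrable gauss_measure \<gamma>"
    and inv: "\<And>\<psi> C. \<psi> \<in> borel_measurable borel \<Longrightarrow> (\<And>t. \<bar>\<psi> t\<bar> \<le> C) \<Longrightarrow>
       (\<integral>u. \<gamma> u * \<psi> u \<partial>gauss_measure) = (\<integral>u. \<gamma> u * \<psi> (gauss_map (gauss_map u)) \<partial>gauss_measure)"
  shows "\<exists>D::real. AE u in gauss_measure. \<gamma> u = D"
proof -
  have [measurable]: "\<gamma> \<in> borel_measurable borel" using borel_measurable_integrable[OF \<gamma>] by simp
  define m where "m = measure gauss_measure UNIV"
  have m: "0 < m" using gauss_measure_pos by (simp add: m_def)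
  define D where "D = (\<integral>u. \<gamma> u \<partial>gauss_measure) / m"
  have inv_n: "(\<integral>u. \<gamma> u * \<psi> u \<partial>gauss_measure) = (\<integral>u. \<gamma> u * \<psi> ((gauss_map ^^ (2 * n)) u) \<partial>gauss_measure)"
    if [measurable]: "\<psi> \<in> borel_measurable borel" and \<psi>: "\<And>t. \<bar>\<psi> t\<bar> \<le> C" for \<psi> C n
  proof (induction n)
    case (Suc n)
    have "(\<integral>u. \<gamma> u * \<psi> ((gauss_map ^^ (2 * n)) u) \<partial>gauss_measure)
        = (\<integral>u. \<gamma> u * \<psi> ((gauss_map ^^ (2 * n)) (gauss_map (gauss_map u))) \<partial>gauss_measure)"
      using \<psi> by (intro inv[where C = C]) auto
    also have "\<dots> = (\<integral>u. \<gamma> u * \<psi> ((gauss_map ^^ (2 * Suc n)) u) \<partial>gauss_measure)"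
      by (simp add: funpow_swap1)
    finally show ?case using Suc by simp
  qed simp
  have eq: "m * (\<integral>u. \<gamma> u * \<psi> u \<partial>gauss_measure) = (\<integral>u. \<gamma> u \<partial>gauss_measure) * (\<integral>u. \<psi> u \<partial>gauss_measure)"
    if \<psi>_meas [measurable]: "\<psi> \<in> borel_measurable borel" and \<psi>: "\<And>t. \<bar>\<psi> t\<bar> \<le> 1" for \<psi>
  proof -
    have \<psi>_int: "integrable gauss_measure \<psi>"
      by (rule integrable_gauss_bounded[where B = 1]) (use \<psi> in auto)
    have "\<bar>\<integral>u. \<psi> u \<partial>gauss_measure\<bar> \<le> (\<integral>u. 1 \<partial>gauss_measure)"
      by (rule order_trans[OF integral_abs_bound], rule integral_mono) (use \<psi> \<psi>_int in auto)
    then have \<psi>_le: "\<bar>\<integral>u. \<psi> u \<partial>gauss_measure\<bar> \<le> m" by (simp add: m_def)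
    let ?X = "m * (\<integral>u. \<gamma> u * \<psi> u \<partial>gauss_measure) - (\<integral>u. \<gamma> u \<partial>gauss_measure) * (\<integral>u. \<psi> u \<partial>gauss_measure)"
    have "\<bar>?X\<bar> \<le> 0 + \<delta>" if "0 < \<delta>" for \<delta>
    proof -
      \<comment> \<open>Replacing \<gamma> by \<phi> costs at most m \<epsilon> in each of the two
        products, \<delta> altogether; the mixing error is removed afterwards by the limit in
        \<open>n\<close>.\<close>
      define \<epsilon> where "\<epsilon> = \<delta> / (2 * m)"
      have \<epsilon>: "0 < \<epsilon>" "2 * m * \<epsilon> = \<delta>" using that m by (auto simp: \<epsilon>_def)
      obtain \<phi> L where [measurable]: "\<phi> \<in> borel_measurable borel" and L: "L-lipschitz_on {0..1} \<phi>"
        and \<phi>: "integrable gauss_measure \<phi>" and le: "(\<integral>u. \<bar>\<gamma> u - \<phi> u\<bar> \<partial>gauss_measure) < \<epsilon>"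
        by (rule gauss_lipschitz_dense[OF \<gamma> \<epsilon>(1)])
      have dint: "integrable gauss_measure (\<lambda>u. \<bar>\<gamma> u - \<phi> u\<bar>)" using \<gamma> \<phi> by auto
      have b: "\<bar>?X\<bar> \<le> 2 * m * \<epsilon> + 2 * ((7 / 8) ^ (2 * n) * L) * 1 * m\<^sup>2" for n
      proof -
        let ?\<psi> = "\<lambda>u. \<psi> ((gauss_map ^^ (2 * n)) u)"
        have mulint: "integrable gauss_measure (\<lambda>u. f u * ?\<psi> u)" if "integrable gauss_measure f" for f
          by (rule Bochner_Integration.integrable_bound[OF integrable_abs[OF that]])
             (use \<psi> borel_measurable_integrable[OF that] in \<open>auto simp: abs_mult intro!: mult_left_le\<close>)
        have "\<bar>\<integral>u. (\<gamma> u - \<phi> u) * ?\<psi> u \<partial>gauss_measure\<bar> \<le> (\<integral>u. \<bar>\<gamma> u - \<phi> u\<bar> \<partial>gauss_measure)"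
        proof (rule order_trans[OF integral_abs_bound], rule integral_mono)
          show "\<bar>(\<gamma> u - \<phi> u) * ?\<psi> u\<bar> \<le> \<bar>\<gamma> u - \<phi> u\<bar>" for u
            unfolding abs_mult using \<psi> by (intro mult_left_le) auto
          show "integrable gauss_measure (\<lambda>u. \<bar>(\<gamma> u - \<phi> u) * ?\<psi> u\<bar>)"
            using \<gamma> \<phi> by (intro integrable_abs mulint) auto
        qed (rule dint)
        then have 1: "\<bar>\<integral>u. (\<gamma> u - \<phi> u) * ?\<psi> u \<partial>gauss_measure\<bar> \<le> \<epsilon>" using le by simp
        have "\<bar>\<integral>u. \<phi> u - \<gamma> u \<partial>gauss_measure\<bar> \<le> (\<integral>u. \<bar>\<phi> u - \<gamma> u\<bar> \<partial>gauss_measure)"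
          by (rule integral_abs_bound)
        then have 2: "\<bar>\<integral>u. \<phi> u - \<gamma> u \<partial>gauss_measure\<bar> \<le> \<epsilon>" using le by (simp add: abs_minus_commute)
        note 3 = gauss_map_mixing[where \<phi> = \<phi> and \<psi> = \<psi>, OF \<open>\<phi> \<in> borel_measurable borel\<close> \<psi>_meas L \<psi>, where n = "2 * n", folded m_def]
        have 4: "(\<integral>u. (\<gamma> u - \<phi> u) * ?\<psi> u \<partial>gauss_measure)
            = (\<integral>u. \<gamma> u * \<psi> u \<partial>gauss_measure) - (\<integral>u. \<phi> u * ?\<psi> u \<partial>gauss_measure)"
          unfolding inv_n[OF \<psi>_meas \<psi>, of n]
          using \<gamma> \<phi> mulint by (simp add: left_diff_distrib Bochner_Integration.integral_diff)
        have 5: "(\<integral>u. \<phi> u - \<gamma> u \<partial>gauss_measure) = (\<integral>u. \<phi> u \<partial>gauss_measure) - (\<integral>u. \<gamma> u \<partial>gauss_measure)"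
          using \<gamma> \<phi> by (rule Bochner_Integration.integral_diff[OF _ _, rotated])
        have "?X = m * (\<integral>u. (\<gamma> u - \<phi> u) * ?\<psi> u \<partial>gauss_measure)
            + ((\<integral>u. \<phi> u - \<gamma> u \<partial>gauss_measure) * (\<integral>u. \<psi> u \<partial>gauss_measure)
            + (m * (\<integral>u. \<phi> u * ?\<psi> u \<partial>gauss_measure) - (\<integral>u. \<phi> u \<partial>gauss_measure) * (\<integral>u. \<psi> u \<partial>gauss_measure)))"
          unfolding 4 5 by (simp add: algebra_simps)
        moreover have "\<bar>m * (\<integral>u. (\<gamma> u - \<phi> u) * ?\<psi> u \<partial>gauss_measure)\<bar> \<le> m * \<epsilon>"
          unfolding abs_mult using 1 m by (auto intro!: mult_mono)
        moreover have "\<bar>(\<integral>u. \<phi> u - \<gamma> u \<partial>gauss_measure) * (\<integral>u. \<psi> u \<partial>gauss_measure)\<bar> \<le> \<epsilon> * m"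
          unfolding abs_mult using 2 \<psi>_le \<epsilon> by (auto intro!: mult_mono)
        ultimately show ?thesis using 3 mult.commute[of \<epsilon> m] by linarith
      qed
      have "(\<lambda>n. 2 * m * \<epsilon> + 2 * ((7 / 8) ^ (2 * n) * L) * 1 * m\<^sup>2) \<longlonglongrightarrow> 2 * m * \<epsilon> + 2 * (0 * L) * 1 * m\<^sup>2"
        unfolding power_mult by (intro tendsto_intros LIMSEQ_power_zero) (simp add: power2_eq_square)
      then have "\<bar>?X\<bar> \<le> 2 * m * \<epsilon> + 2 * (0 * L) * 1 * m\<^sup>2"
        by (rule LIMSEQ_le_const) (use b in auto)
      then show ?thesis using \<epsilon>(2) by simp
    qed
    then have "\<bar>?X\<bar> \<le> 0" by (rule field_le_epsilon)
    then show ?thesis by simp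
  qed
  have "(\<integral>u. \<bar>\<gamma> u - D\<bar> \<partial>gauss_measure) = 0"
  proof -
    \<comment> \<open>Testing against the sign of \<gamma> - D turns equality of functionals into a
      vanishing L^1 distance.\<close>
    define \<psi> where "\<psi> u = sgn (\<gamma> u - D)" for u
    have [measurable]: "\<psi> \<in> borel_measurable borel" unfolding \<psi>_def by measurable
    have \<psi>: "\<bar>\<psi> t\<bar> \<le> 1" for t by (simp add: \<psi>_def sgn_real_def)
    have \<psi>_int: "integrable gauss_measure \<psi>"
      by (rule integrable_gauss_bounded[where B = 1]) (use \<psi> in auto)
    have \<gamma>\<psi>_int: "integrable gauss_measure (\<lambda>u. \<gamma> u * \<psi> u)"
      by (rule Bochner_Integration.integrable_bound[OF integrable_abs[OF \<gamma>]])
         (use \<psi> in \<open>auto simp: abs_mult intro!: mult_left_le\<close>)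
    have "(\<integral>u. \<bar>\<gamma> u - D\<bar> \<partial>gauss_measure) = (\<integral>u. \<gamma> u * \<psi> u - D * \<psi> u \<partial>gauss_measure)"
      by (simp add: \<psi>_def abs_sgn left_diff_distrib[symmetric])
    also have "\<dots> = (\<integral>u. \<gamma> u * \<psi> u \<partial>gauss_measure) - D * (\<integral>u. \<psi> u \<partial>gauss_measure)"
      using \<gamma>\<psi>_int \<psi>_int by simp
    also have "\<dots> = 0" using eq[OF _ \<psi>] m by (simp add: D_def field_simps)
    finally show ?thesis .
  qed
  then have "AE u in gauss_measure. \<bar>\<gamma> u - D\<bar> = 0"
    using \<gamma> by (subst (asm) integral_nonneg_eq_0_iff_AE) auto
  then show ?thesis by (intro exI[of _ D]) (auto elim: eventually_mono)
qed

section \<open>Fourier integrals against the Gauss measure\<close>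

lemma borel_measurable_cis [measurable]: "cis \<in> borel_measurable borel"
  unfolding cis_conv_exp by measurable

lemma integrable_unit_bounded:
  fixes f :: "real \<Rightarrow> 'a::{banach, second_countable_topology}"
  assumes [measurable]: "f \<in> borel_measurable borel" and f: "\<And>x. x \<in> {0<..<1} \<Longrightarrow> norm (f x) \<le> B"
  shows "integrable lborel (\<lambda>x. indicator {0<..<1} x *\<^sub>R f x)"
proof (rule Bochner_Integration.integrable_bound[of lborel "\<lambda>x. indicator {0<..<1} x *\<^sub>R B"])
  show "AE x in lborel. norm (indicat_real {0<..<1} x *\<^sub>R f x) \<le> norm (indicat_real {0<..<1} x *\<^sub>R B)"
    using f by (intro AE_I2) (auto simp: indicator_def intro: order_trans[OF _ abs_ge_self])
qed (auto intro!: integrable_real_mult_indicator)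

text \<open>Differentiability is asked only inside the interval: the primitive used below for the
  oscillating term involving \<open>cis (y / u)\<close> is known at 0 only to be continuous.\<close>

lemma unit_integral_FTC:
  fixes f F :: "real \<Rightarrow> 'a::euclidean_space"
  assumes [measurable]: "f \<in> borel_measurable borel" and f: "\<And>x. x \<in> {0<..<1} \<Longrightarrow> norm (f x) \<le> B"
    and cont: "continuous_on {0..1} F"
    and der: "\<And>x. x \<in> {0<..<1} \<Longrightarrow> (F has_vector_derivative f x) (at x)"
  shows "(\<integral>x. indicator {0<..<1} x *\<^sub>R f x \<partial>lborel) = F 1 - F 0"
proof -
  have "set_integrable lborel {0<..<1} f"
    unfolding set_integrable_def by (rule integrable_unit_bounded[OF assms(1) f])
  from set_borel_integral_eq_integral(2)[OF this]
  have "(\<integral>x. indicator {0<..<1} x *\<^sub>R f x \<partial>lborel) = integral {0<..<1} f"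
    by (simp add: set_lebesgue_integral_def)
  also have "\<dots> = integral {0..1} f" by (simp add: integral_open_interval_real)
  also have "\<dots> = F 1 - F 0"
    by (intro integral_unique fundamental_theorem_of_calculus_interior cont der) auto
  finally show ?thesis .
qed

text \<open>Both terms are integrated by parts, which makes the tail of the integral over the
  half-line absolutely convergent; the substitutions \<open>w = 1 / (1 + u)\<close> and \<open>w = u / (1 + u)\<close>
  then merge the two remainders into one integral over the unit interval.\<close>

lemma gauss_fourier_formula:
  fixes y :: real
  assumes y: "y \<noteq> 0"
  defines "R \<equiv> \<integral>w. indicator {0<..<1} w *\<^sub>R cis (y / w) \<partial>lborel"
  shows "(\<integral>u. cis (y * u) - cis (y / u) \<partial>gauss_measure) = - \<i> / y * (cis y - 1) * (1 - cis (- y) * R)"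
proof -
  define A where "A u = cis (y * u) /\<^sub>R (1 + u)" for u
  define X where "X u = cis (y * u) /\<^sub>R (1 + u)\<^sup>2" for u
  define A' where "A' u = cis (y / u) /\<^sub>R (1 + u)" for u
  define X' where "X' u = cis (y / u) /\<^sub>R (1 + u)\<^sup>2" for u
  have [measurable]: "A \<in> borel_measurable borel" "A' \<in> borel_measurable borel"
      "X \<in> borel_measurable borel" "X' \<in> borel_measurable borel"
    unfolding A_def A'_def X_def X'_def by measurable
  have bd: "norm (A u) \<le> 1" "norm (A' u) \<le> 1" "norm (X u) \<le> 1" "norm (X' u) \<le> 1" if "u \<in> {0<..<1}" for u
    using that by (auto simp: A_def A'_def X_def X'_def divide_simps power2_eq_square algebra_simps)
  let ?I = "\<lambda>f :: real \<Rightarrow> complex. \<integral>u. indicator {0<..<1} u *\<^sub>R f u \<partial>lborel"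
  have lin: "?I (\<lambda>u. f u + c * g u) = ?I f + c * ?I g"
    if "integrable lborel (\<lambda>u. indicator {0<..<1} u *\<^sub>R f u)" "integrable lborel (\<lambda>u. indicator {0<..<1} u *\<^sub>R g u)"
    for f g :: "real \<Rightarrow> complex" and c
  proof -
    have "?I (\<lambda>u. f u + c * g u)
        = (\<integral>u. indicator {0<..<1} u *\<^sub>R f u + c * (indicator {0<..<1} u *\<^sub>R g u) \<partial>lborel)"
      by (simp only: scaleR_add_right mult_scaleR_right)
    also have "\<dots> = ?I f + (\<integral>u. c * (indicator {0<..<1} u *\<^sub>R g u) \<partial>lborel)"
      by (intro Bochner_Integration.integral_add integrable_mult_right that)
    also have "(\<integral>u. c * (indicator {0<..<1} u *\<^sub>R g u) \<partial>lborel) = c * ?I g"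
      by (rule integral_mult_right_zero)
    finally show ?thesis .
  qed
  have iA: "integrable lborel (\<lambda>u. indicator {0<..<1} u *\<^sub>R A u)"
    by (rule integrable_unit_bounded[OF _ bd(1)]) measurable
  have iA': "integrable lborel (\<lambda>u. indicator {0<..<1} u *\<^sub>R A' u)"
    by (rule integrable_unit_bounded[OF _ bd(2)]) measurable
  have iX: "integrable lborel (\<lambda>u. indicator {0<..<1} u *\<^sub>R X u)"
    by (rule integrable_unit_bounded[OF _ bd(3)]) measurable
  have iX': "integrable lborel (\<lambda>u. indicator {0<..<1} u *\<^sub>R X' u)"
    by (rule integrable_unit_bounded[OF _ bd(4)]) measurable
  have iR: "integrable lborel (\<lambda>u. indicator {0<..<1} u *\<^sub>R cis (y / u))"
    by (rule integrable_unit_bounded[where B = 1]) auto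
  have solve: "a = p * (k + x)" if "a + c * x = p * k" "p = - c" for a c x p k :: complex
    using that by algebra
  have solve': "a = c * (k - r + x)" if "a + c * (r - x) = c * k" for a c x k r :: complex
    using that by algebra
  have E1: "?I A = - \<i> / y * (cis y / 2 - 1 + ?I X)"
  proof -
    \<comment> \<open>Boundary term of the integration by parts; - \<i> / y is 1 / (\<i> y).\<close>
    define F where "F z = - \<i> / y * (exp (\<i> * y * z) * (1 / (1 + z)))" for z :: complex
    have "?I (\<lambda>u. A u + \<i> / y * X u) = F (of_real 1) - F (of_real 0)"
    proof (rule unit_integral_FTC[where B = "1 + 1 / \<bar>y\<bar>"])
      show "norm (A u + \<i> / y * X u) \<le> 1 + 1 / \<bar>y\<bar>" if "u \<in> {0<..<1}" for u
        by (rule norm_triangle_mono)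
          (use bd(1,3)[OF that] in \<open>auto simp: norm_mult norm_divide divide_right_mono\<close>)
      have nz: "1 + complex_of_real u \<noteq> 0" if "0 \<le> u" for u
        using that by (metis add_nonneg_eq_0_iff of_real_1 of_real_add of_real_eq_0_iff zero_le_one zero_neq_one)
      show "continuous_on {0..1} (\<lambda>u. F (of_real u))" unfolding F_def
        by (intro continuous_intros) (use nz in auto)
      show "((\<lambda>u. F (of_real u)) has_vector_derivative A u + \<i> / y * X u) (at u)" if u: "u \<in> {0<..<1}" for u
      proof (rule has_vector_derivative_real_field)
        define z where "z = complex_of_real u"
        have w: "1 + z \<noteq> 0" using nz u by (simp add: z_def)
        have d1: "((\<lambda>z. exp (\<i> * y * z)) has_field_derivative exp (\<i> * y * z) * (\<i> * y)) (at z)"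
          by (auto intro!: derivative_eq_intros)
        have d2: "((\<lambda>z. 1 / (1 + z)) has_field_derivative - (1 / (1 + z)\<^sup>2)) (at z)"
          using w by (auto intro!: derivative_eq_intros simp: power2_eq_square)
        have "c * (e * a * p + - q * e) = (c * a) * (e * p) - c * (e * q)" for c e a p q :: complex
          by (simp add: algebra_simps)
        from this[of "- \<i> / y" "exp (\<i> * y * z)" "\<i> * y" "1 / (1 + z)" "1 / (1 + z)\<^sup>2"]
        have "- \<i> / y * (exp (\<i> * y * z) * (\<i> * y) * (1 / (1 + z)) + - (1 / (1 + z)\<^sup>2) * exp (\<i> * y * z))
            = A u + \<i> / y * X u"
          using y by (simp add: A_def X_def cis_conv_exp z_def scaleR_conv_of_real divide_inverse mult_ac)
        moreover have "(F has_field_derivative - \<i> / y * (exp (\<i> * y * z) * (\<i> * y) * (1 / (1 + z)) + - (1 / (1 + z)\<^sup>2) * exp (\<i> * y * z))) (at z)"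
          unfolding F_def by (rule DERIV_cmult[OF DERIV_mult[OF d1 d2]])
        ultimately show "(F has_field_derivative A u + \<i> / y * X u) (at (of_real u))"
          by (simp only: z_def)
      qed
    qed simp
    moreover have "?I (\<lambda>u. A u + \<i> / y * X u) = ?I A + \<i> / y * ?I X"
      by (rule lin[OF iA iX])
    moreover have "F (of_real 1) - F (of_real 0) = - \<i> / y * (cis y / 2 - 1)"
      by (simp add: F_def cis_conv_exp algebra_simps)
    ultimately have "?I A + \<i> / y * ?I X = - \<i> / y * (cis y / 2 - 1)" by (simp only:)
    then show ?thesis by (rule solve) simp
  qed
  have E2: "?I A' = \<i> / y * (cis y / 2 - R + ?I X')"
  proof -
    \<comment> \<open>Dividing by the derivative - \<i> y / z^2 of the phase produces the factor
      z^2, which tames the oscillation at 0. The derivative of z^2 / (1 + z) is 1 - 1 / (1 + z)^2,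
      the source of the two remainders \<open>R\<close> and \<open>X'\<close>.\<close>
    define F where "F z = \<i> / y * (exp (\<i> * y / z) * (z\<^sup>2 / (1 + z)))" for z :: complex
    have nz: "1 + complex_of_real u \<noteq> 0" if "0 \<le> u" for u
      using that by (metis add_nonneg_eq_0_iff of_real_1 of_real_add of_real_eq_0_iff zero_le_one zero_neq_one)
    have "?I (\<lambda>u. A' u + \<i> / y * (cis (y / u) - X' u)) = F (of_real 1) - F (of_real 0)"
    proof (rule unit_integral_FTC[where B = "1 + 1 / \<bar>y\<bar> * (1 + 1)"])
      show "norm (A' u + \<i> / y * (cis (y / u) - X' u)) \<le> 1 + 1 / \<bar>y\<bar> * (1 + 1)" if "u \<in> {0<..<1}" for u
      proof (rule norm_triangle_mono)
        have "norm (cis (y / u) - X' u) \<le> 1 + 1"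
          using bd(4)[OF that] by (intro order_trans[OF norm_triangle_ineq4[of "cis (y / u)" "X' u"]] add_mono) auto
        then show "norm (\<i> / y * (cis (y / u) - X' u)) \<le> 1 / \<bar>y\<bar> * (1 + 1)"
          unfolding norm_mult by (simp add: norm_divide divide_right_mono)
      qed (use bd(2)[OF that] in auto)
      show "((\<lambda>u. F (of_real u)) has_vector_derivative A' u + \<i> / y * (cis (y / u) - X' u)) (at u)"
        if u: "u \<in> {0<..<1}" for u
      proof (rule has_vector_derivative_real_field)
        define z where "z = complex_of_real u"
        have w: "1 + z \<noteq> 0" "z \<noteq> 0" using nz u by (auto simp: z_def)
        have d1: "((\<lambda>z. exp (\<i> * y / z)) has_field_derivative exp (\<i> * y / z) * (- (\<i> * y) / z\<^sup>2)) (at z)"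
          using w by (auto intro!: derivative_eq_intros simp: power2_eq_square)
        have d2: "((\<lambda>z. z\<^sup>2 / (1 + z)) has_field_derivative 1 - 1 / (1 + z)\<^sup>2) (at z)"
        proof (rule DERIV_cong)
          show "((\<lambda>z. z\<^sup>2 / (1 + z)) has_field_derivative (2 * z * (1 + z) - z\<^sup>2 * 1) / ((1 + z) * (1 + z))) (at z)"
            using w by (auto intro!: derivative_eq_intros)
          show "(2 * z * (1 + z) - z\<^sup>2 * 1) / ((1 + z) * (1 + z)) = 1 - 1 / (1 + z)\<^sup>2"
            using w by (simp add: divide_simps power2_eq_square) (simp add: algebra_simps)
        qed
        have "c * (e * (- a / z\<^sup>2) * (z\<^sup>2 * p) + (1 - q) * e) = - (c * a) * (e * p) + c * (e - e * q)" for c e a p q :: complex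
          using w by (simp add: algebra_simps)
        from this[of "\<i> / y" "exp (\<i> * y / z)" "\<i> * y" "1 / (1 + z)" "1 / (1 + z)\<^sup>2"]
        have "\<i> / y * (exp (\<i> * y / z) * (- (\<i> * y) / z\<^sup>2) * (z\<^sup>2 / (1 + z)) + (1 - 1 / (1 + z)\<^sup>2) * exp (\<i> * y / z))
            = A' u + \<i> / y * (cis (y / u) - X' u)"
          using y by (simp add: A'_def X'_def cis_conv_exp z_def scaleR_conv_of_real divide_inverse mult_ac)
        moreover have "(F has_field_derivative \<i> / y * (exp (\<i> * y / z) * (- (\<i> * y) / z\<^sup>2) * (z\<^sup>2 / (1 + z)) + (1 - 1 / (1 + z)\<^sup>2) * exp (\<i> * y / z))) (at z)"
          unfolding F_def by (rule DERIV_cmult[OF DERIV_mult[OF d1 d2]])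
        ultimately show "(F has_field_derivative A' u + \<i> / y * (cis (y / u) - X' u)) (at (of_real u))"
          by (simp only: z_def)
      qed
      have "continuous (at u within {0..1}) (\<lambda>u. F (of_real u))" if "u \<in> {0..1}" for u
      proof (cases "u = 0")
        case False
        then have "1 + complex_of_real u \<noteq> 0" "complex_of_real u \<noteq> 0" using nz that by auto
        then show ?thesis unfolding F_def by (intro continuous_intros) auto
      next
        \<comment> \<open>With division by zero yielding 0, the factor z^2 makes \<open>F 0\<close>
          equal to 0, which is also the limit because the exponential has modulus 1.\<close>
        case True
        have "((\<lambda>u. F (of_real u)) \<longlongrightarrow> 0) (at 0 within {0..1})"
        proof (rule Lim_null_comparison)
          show "\<forall>\<^sub>F u in at 0 within {0..1}. norm (F (of_real u)) \<le> 1 / \<bar>y\<bar> * u\<^sup>2"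
          proof (rule eventually_at_topological[THEN iffD2], intro exI[of _ UNIV] conjI ballI impI)
            fix u :: real assume "u \<in> {0..1}"
            then have "cmod ((of_real u)\<^sup>2 / (1 + of_real u)) \<le> u\<^sup>2"
              using divide_left_mono[of 1 "1 + u" "u\<^sup>2"] norm_of_real[of "1 + u", where 'a = complex]
              by (simp add: norm_divide norm_power)
            moreover have m: "cmod (exp (\<i> * y / of_real u)) = 1"
              using norm_cis[of "y / u"] by (simp add: cis_conv_exp)
            ultimately show "norm (F (of_real u)) \<le> 1 / \<bar>y\<bar> * u\<^sup>2"
              unfolding F_def norm_mult[of "\<i> / y"] norm_mult[of "exp _"] m
              by (intro mult_mono) (simp_all add: norm_divide)
          qed auto
          show "((\<lambda>u. 1 / \<bar>y\<bar> * u\<^sup>2) \<longlongrightarrow> 0) (at 0 within {0..1})"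
            by (rule tendsto_eq_intros tendsto_ident_at refl)+ simp
        qed
        then show ?thesis unfolding True continuous_within by (simp add: F_def)
      qed
      then show "continuous_on {0..1} (\<lambda>u. F (of_real u))" by (simp add: continuous_on_eq_continuous_within)
    qed simp
    moreover have "?I (\<lambda>u. A' u + \<i> / y * (cis (y / u) - X' u)) = ?I A' + \<i> / y * (R - ?I X')"
    proof -
      have "?I (\<lambda>u. cis (y / u) - X' u) = R - ?I X'"
        using lin[OF iR iX', of "-1"] by (simp add: R_def)
      moreover have i: "integrable lborel (\<lambda>u. indicator {0<..<1} u *\<^sub>R (cis (y / u) - X' u))"
        using Bochner_Integration.integrable_diff[OF iR iX'] by (simp only: scaleR_diff_right)
      ultimately show ?thesis using lin[OF iA' i, of "\<i> / y"] by (simp only:)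
    qed
    moreover have "F (of_real 1) - F (of_real 0) = \<i> / y * (cis y / 2)"
      by (simp add: F_def cis_conv_exp algebra_simps)
    ultimately have "?I A' + \<i> / y * (R - ?I X') = \<i> / y * (cis y / 2)" by (simp only:)
    then show ?thesis by (rule solve')
  qed
  have E3: "?I X + ?I X' = cis (- y) * R"
  proof -
    \<comment> \<open>The shift by - y makes both substitutions fit: y / w - y becomes y u for w = 1
      / (1 + u) and y / u for w = u / (1 + u). These ranges of \<open>w\<close> fill the two halves
      of the unit interval.\<close>
    define f where "f w = cis (y / w - y)" for w
    have [measurable]: "f \<in> borel_measurable borel" unfolding f_def by measurable
    have f_int: "integrable lborel (\<lambda>x. indicator {a<..<b} x *\<^sub>R f x)" for a b
    proof (rule Bochner_Integration.integrable_bound[of lborel "\<lambda>x. indicator {a<..<b} x *\<^sub>R (1::real)"])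
      show "integrable lborel (\<lambda>x. indicator {a<..<b} x *\<^sub>R (1::real))"
        using emeasure_bounded_finite[of "{a<..<b}"] by (simp add: integrable_indicator_iff)
    qed (auto simp: f_def indicator_def)
    have 1: "(\<integral>x. indicator {1/2<..<1} x *\<^sub>R f x \<partial>lborel) = ?I X"
    proof -
      define g where "g u = 1 / (1 + u)" for u :: real
      have img: "g ` {0<..<1} = {1/2<..<1}"
      proof (intro equalityI subsetI)
        fix w :: real assume "w \<in> {1/2<..<1}"
        then show "w \<in> g ` {0<..<1}" by (intro image_eqI[of _ _ "1 / w - 1"]) (auto simp: g_def field_simps)
      qed (auto simp: g_def field_simps)
      have "(\<integral>x. indicator {1/2<..<1} x *\<^sub>R f x \<partial>lborel)
          = (\<integral>u. indicator {0<..<1} u *\<^sub>R (\<bar>- (1 / (1 + u)\<^sup>2)\<bar> *\<^sub>R f (g u)) \<partial>lborel)"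
        unfolding img[symmetric]
      proof (rule lborel_integral_change_of_variables)
        show "(g has_real_derivative - (1 / (1 + u)\<^sup>2)) (at u within {0<..<1})" if "u \<in> {0<..<1}" for u
          unfolding g_def using that by (auto intro!: derivative_eq_intros simp: power2_eq_square divide_simps)
      qed (unfold img, auto simp: inj_on_def f_int, auto simp: g_def)
      also have "\<dots> = ?I X"
        by (intro Bochner_Integration.integral_cong) (auto simp: X_def f_def g_def indicator_def field_simps)
      finally show ?thesis .
    qed
    have 2: "(\<integral>x. indicator {0<..<1/2} x *\<^sub>R f x \<partial>lborel) = ?I X'"
    proof -
      define g where "g u = u / (1 + u)" for u :: real
      have img: "g ` {0<..<1} = {0<..<1/2}"
      proof (intro equalityI subsetI)
        fix w :: real assume "w \<in> {0<..<1/2}"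
        then show "w \<in> g ` {0<..<1}" by (intro image_eqI[of _ _ "w / (1 - w)"]) (auto simp: g_def field_simps)
      qed (auto simp: g_def field_simps)
      have "(\<integral>x. indicator {0<..<1/2} x *\<^sub>R f x \<partial>lborel)
          = (\<integral>u. indicator {0<..<1} u *\<^sub>R (\<bar>1 / (1 + u)\<^sup>2\<bar> *\<^sub>R f (g u)) \<partial>lborel)"
        unfolding img[symmetric]
      proof (rule lborel_integral_change_of_variables)
        show "(g has_real_derivative (1 / (1 + u)\<^sup>2)) (at u within {0<..<1})" if "u \<in> {0<..<1}" for u
          unfolding g_def using that by (auto intro!: derivative_eq_intros simp: power2_eq_square divide_simps)
        show "inj_on g {0<..<1}" by (auto simp: inj_on_def g_def divide_simps) (auto simp: algebra_simps)
      qed (unfold img, auto simp: f_int, auto simp: g_def)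
      also have "\<dots> = ?I X'"
        by (intro Bochner_Integration.integral_cong) (auto simp: X'_def f_def g_def indicator_def field_simps)
      finally show ?thesis .
    qed
    have "?I X + ?I X' = (\<integral>x. indicator {1/2<..<1} x *\<^sub>R f x + indicator {0<..<1/2} x *\<^sub>R f x \<partial>lborel)"
      unfolding 1[symmetric] 2[symmetric] using f_int by (simp add: Bochner_Integration.integral_add)
    also have "\<dots> = (\<integral>x. cis (- y) * (indicator {0<..<1} x *\<^sub>R cis (y / x)) \<partial>lborel)"
    proof (rule integral_cong_AE)
      show "AE x in lborel. indicator {1/2<..<1} x *\<^sub>R f x + indicator {0<..<1/2} x *\<^sub>R f x
          = cis (- y) * (indicator {0<..<1} x *\<^sub>R cis (y / x))"
        using AE_lborel_singleton[of "1/2 :: real"]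
        by eventually_elim (auto simp: indicator_def f_def cis_mult)
    qed measurable
    also have "\<dots> = cis (- y) * R" unfolding R_def by (rule integral_mult_right_zero)
    finally show ?thesis .
  qed
  have "(\<integral>u. cis (y * u) - cis (y / u) \<partial>gauss_measure) = ?I (\<lambda>u. A u + (- 1) * A' u)"
  proof (subst gauss_measure_integral(1))
    show "(\<integral>u. (indicator {0<..<1} u / (1 + u)) *\<^sub>R (cis (y * u) - cis (y / u)) \<partial>lborel)
        = ?I (\<lambda>u. A u + (- 1) * A' u)"
      by (rule Bochner_Integration.integral_cong[OF refl])
         (simp add: A_def A'_def indicator_def scaleR_diff_right inverse_eq_divide)
  qed measurable
  also have "\<dots> = ?I A - ?I A'" by (subst lin[OF iA iA']) simp
  also have "\<dots> = - \<i> / y * (cis y - 1 - R + (?I X + ?I X'))"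
  proof -
    have "- c * (k / 2 - 1 + x) - c * (k / 2 - r + x') = - c * (k - 1 - r + (x + x'))" for c k x r x' :: complex
      by (simp add: algebra_simps)
    from this[of "\<i> / y" "cis y" "?I X" R "?I X'"] show ?thesis
      unfolding E1 E2 by (simp only: minus_divide_left)
  qed
  also have "\<dots> = - \<i> / y * (cis y - 1) * (1 - cis (- y) * R)"
  proof -
    have "cis y * cis (- y) = 1" by (simp add: cis_mult)
    then have "(cis y - 1) * (1 - cis (- y) * R) = cis y - 1 - R + cis (- y) * R"
      by (simp add: algebra_simps mult.assoc[symmetric])
    then show ?thesis unfolding E3 by (simp add: mult.assoc)
  qed
  finally show ?thesis .
qed

text \<open>In the product formula the factor cis y - 1 is nonzero by assumption. The last factor
  could vanish only if the mean of cos (y / w - y) over the unit interval were 1, but that cosine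
  equals 1 for countably many \<open>w\<close> only.\<close>

lemma gauss_fourier_nonzero:
  fixes y :: real
  assumes "cis y \<noteq> 1"
  shows "(\<integral>u. cis (y * u) - cis (y / u) \<partial>gauss_measure) \<noteq> 0"
proof -
  have y: "y \<noteq> 0" using assms by auto
  define f where "f w = indicator {0<..<1} w *\<^sub>R cis (y / w)" for w
  define R where "R = (\<integral>w. f w \<partial>lborel)"
  have f_int: "integrable lborel f"
    unfolding f_def by (rule integrable_unit_bounded[where B = 1]) auto
  have "Re (cis (- y) * R) < 1"
  proof -
    have 1: "integrable lborel (\<lambda>w::real. indicator {0<..<1} w :: real)"
      by (rule integrable_real_indicator) auto
    have 2: "integrable lborel (\<lambda>w. indicator {0<..<1} w * (1 - cos (y / w - y)))"
      using integrable_unit_bounded[of "\<lambda>w. 1 - cos (y / w - y)" 2]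
      by (auto simp: abs_le_iff)
    have "Re (cis (- y) * R) = (\<integral>w. Re (cis (- y) * f w) \<partial>lborel)"
      using integral_Re[OF integrable_mult_right[of "cis (- y)" lborel f]] f_int
      unfolding R_def integral_mult_right_zero by simp
    also have "\<dots> = (\<integral>w. indicator {0<..<1} w - indicator {0<..<1} w * (1 - cos (y / w - y)) \<partial>lborel)"
      by (intro Bochner_Integration.integral_cong) (auto simp: f_def indicator_def cos_diff)
    also have "\<dots> = 1 - (\<integral>w. indicator {0<..<1} w * (1 - cos (y / w - y)) \<partial>lborel)"
      using 1 2 by simp
    finally have eq: "Re (cis (- y) * R) = 1 - (\<integral>w. indicator {0<..<1} w * (1 - cos (y / w - y)) \<partial>lborel)" .
    have nn: "0 \<le> indicator {0<..<1} w * (1 - cos (y / w - y))" for w by (auto simp: indicator_def)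
    have "(\<integral>w. indicator {0<..<1} w * (1 - cos (y / w - y)) \<partial>lborel) \<noteq> 0"
    proof
      assume "(\<integral>w. indicator {0<..<1} w * (1 - cos (y / w - y)) \<partial>lborel) = 0"
      then have ae: "AE w in lborel. indicator {0<..<1} w * (1 - cos (y / w - y)) = 0"
        using integral_nonneg_eq_0_iff_AE[OF 2] nn by simp
      have "{w. cos (y / w - y) = 1} \<subseteq> range (\<lambda>n::int. y / (of_int n * 2 * pi + y))"
      proof
        fix w assume "w \<in> {w. cos (y / w - y) = 1}"
        then obtain n :: int where "y / w - y = of_int n * 2 * pi" by (auto simp: cos_one_2pi_int)
        then have "y / w = of_int n * 2 * pi + y" by simp
        moreover have "y / (y / w) = w" using y by simp
        ultimately have "w = y / (of_int n * 2 * pi + y)" by simp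
        then show "w \<in> range (\<lambda>n::int. y / (of_int n * 2 * pi + y))" by auto
      qed
      then have "countable {w. cos (y / w - y) = 1}" by (rule countable_subset) simp
      then have "{w. cos (y / w - y) = 1} \<in> null_sets lborel" by (rule countable_imp_null_set_lborel)
      then have "AE w in lborel. cos (y / w - y) \<noteq> 1" by (auto dest: AE_not_in)
      with ae have "AE w in lborel. w \<notin> {0<..<1::real}"
        by eventually_elim (auto simp: indicator_def split: if_splits)
      then have "emeasure lborel {0<..<1::real} = 0"
        by (subst (asm) AE_iff_measurable[OF _ refl]) (auto simp: greaterThanLessThan_def greaterThan_def lessThan_def Int_def)
      then show False by simp
    qed
    moreover have "0 \<le> (\<integral>w. indicator {0<..<1} w * (1 - cos (y / w - y)) \<partial>lborel)"
      using nn by (intro integral_nonneg_AE) auto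
    ultimately show ?thesis using eq by linarith
  qed
  then have "cis (- y) * R \<noteq> 1" by (metis less_irrefl one_complex.simps(1))
  then have "1 - cis (- y) * R \<noteq> 0" by (metis right_minus_eq)
  moreover have "R = (\<integral>w. indicator {0<..<1} w *\<^sub>R cis (y / w) \<partial>lborel)"
    by (simp only: R_def f_def)
  ultimately show ?thesis
    using gauss_fourier_formula[OF y] assms y by simp
qed

section \<open>Annihilators of periodic functions\<close>

text \<open>\<open>Arg2pi\<close> jumps across the nonnegative real axis but vanishes on it, so
  multiplying by the indicator of the complement, where it is continuous, changes nothing.\<close>

lemma borel_measurable_Arg2pi [measurable]: "Arg2pi \<in> borel_measurable borel"
proof -
  have "(\<lambda>z. indicator (- \<real>\<^sub>\<ge>\<^sub>0) z *\<^sub>R Arg2pi z) \<in> borel_measurable borel"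
  proof (rule borel_measurable_continuous_on_indicator)
    show "- \<real>\<^sub>\<ge>\<^sub>0 \<in> sets (borel :: complex measure)"
      by (intro borel_open open_Compl closed_nonneg_Reals_complex)
    show "continuous_on (- \<real>\<^sub>\<ge>\<^sub>0) Arg2pi"
      by (intro continuous_at_imp_continuous_on ballI continuous_at_Arg2pi) simp
  qed
  also have "(\<lambda>z. indicator (- \<real>\<^sub>\<ge>\<^sub>0) z *\<^sub>R Arg2pi z) = Arg2pi"
    using Arg2pi_eq_0 by (auto simp: indicator_def fun_eq_iff complex_nonneg_Reals_iff complex_is_Real_iff)
  finally show ?thesis .
qed

text \<open>This recovers the fractional part from the point on the circle, so functions of the
  former become functions of the latter.\<close>

lemma Arg2pi_cis_frac: "Arg2pi (cis (2 * pi * t)) = 2 * pi * frac t"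
proof (rule Arg2pi_unique[where r = 1])
  have "2 * pi * t = 2 * pi * frac t + of_int \<lfloor>t\<rfloor> * (2 * pi)"
    by (simp add: frac_def algebra_simps)
  moreover have "cis (of_int \<lfloor>t\<rfloor> * (2 * pi)) = 1"
    using cis_multiple_2pi[of "of_int \<lfloor>t\<rfloor>"] by (simp add: mult_ac)
  ultimately have "cis (2 * pi * t) = cis (2 * pi * frac t)"
    by (metis cis_mult mult.right_neutral)
  then show "of_real 1 * exp (\<i> * of_real (2 * pi * frac t)) = cis (2 * pi * t)"
    by (simp add: cis_conv_exp)
  show "2 * pi * frac t < 2 * pi" using frac_lt_1[of t] by simp
qed auto

lemma integrable_mult_bounded:
  fixes f :: "'a \<Rightarrow> real" and g :: "'a \<Rightarrow> 'b::{banach, second_countable_topology}"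
  assumes f: "integrable M f" and [measurable]: "g \<in> borel_measurable M" and g: "\<And>x. norm (g x) \<le> B"
  shows "integrable M (\<lambda>x. f x *\<^sub>R g x)"
proof (rule Bochner_Integration.integrable_bound[of M "\<lambda>x. B * f x"])
  show "AE x in M. norm (f x *\<^sub>R g x) \<le> norm (B * f x)"
  proof (intro AE_I2)
    fix x
    have "\<bar>f x\<bar> * norm (g x) \<le> \<bar>f x\<bar> * \<bar>B\<bar>"
      using g[of x] by (intro mult_left_mono) auto
    then show "norm (f x *\<^sub>R g x) \<le> norm (B * f x)" by (simp add: abs_mult mult.commute)
  qed
qed (use f borel_measurable_integrable[OF f] in auto)

lemma real_polynomial_function_bounded_sphere:
  fixes p :: "complex \<Rightarrow> real"
  assumes "real_polynomial_function p"
  shows "\<exists>B. \<forall>t. \<bar>p (cis t)\<bar> \<le> B"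
proof -
  have "bounded (p ` sphere 0 1)"
    using assms by (intro compact_imp_bounded compact_continuous_image continuous_on_polymonial_function)
      (auto simp: real_polynomial_function_eq)
  then obtain B where "\<forall>z \<in> sphere 0 1. norm (p z) \<le> B" by (auto simp: bounded_iff)
  then show ?thesis by (intro exI[of _ B]) auto
qed

lemma borel_measurable_real_polynomial_function:
  fixes p :: "complex \<Rightarrow> real"
  assumes "real_polynomial_function p"
  shows "p \<in> borel_measurable borel"
  using assms by (intro borel_measurable_continuous_onI continuous_on_polymonial_function)
    (auto simp: real_polynomial_function_eq)

text \<open>Quantifying over all frequencies \<open>j\<close> makes the property of \<open>p\<close> proved here
  stable under products.\<close>

lemma fourier_zero_times_polynomial:
  fixes h :: "'a \<Rightarrow> real" and t :: "'a \<Rightarrow> real"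
  assumes "real_polynomial_function p" and [measurable]: "t \<in> borel_measurable M"
    and "integrable M h" and "\<And>j::int. (\<integral>u. h u *\<^sub>R cis (of_int j * t u) \<partial>M) = 0"
  shows "(\<integral>u. (h u * p (cis (t u))) *\<^sub>R cis (of_int j * t u) \<partial>M) = 0"
  using assms(1,3,4)
proof (induction p arbitrary: h j rule: real_polynomial_function.induct)
  case (linear p)
  define a b where "a = p 1" and "b = p \<i>"
  have p: "p z = Re z * a + Im z * b" for z
  proof -
    have "p (Re z *\<^sub>R 1 + Im z *\<^sub>R \<i>) = Re z * p 1 + Im z * p \<i>"
      using linear(1) by (simp add: bounded_linear.linear linear_add linear_cmul)
    moreover have "Re z *\<^sub>R 1 + Im z *\<^sub>R \<i> = z" by (simp add: complex_eq_iff)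
    ultimately show ?thesis by (simp add: a_def b_def)
  qed
  \<comment> \<open>On the circle a real linear functional is a cos t + b sin t, that is, \<kappa>
    cis t + \<tau> cis (- t); multiplying by it shifts the frequency by one either way.\<close>
  define \<kappa> \<tau> where "\<kappa> = Complex (a / 2) (- b / 2)" and "\<tau> = Complex (a / 2) (b / 2)"
  have int: "integrable M (\<lambda>u. h u *\<^sub>R cis (of_int k * t u))" for k :: int
    using linear(2) by (rule integrable_mult_bounded[where B = 1]) auto
  have "(h u * p (cis (t u))) *\<^sub>R cis (of_int j * t u)
      = \<kappa> * (h u *\<^sub>R cis (of_int (j + 1) * t u)) + \<tau> * (h u *\<^sub>R cis (of_int (j - 1) * t u))" for u
  proof -
    have "cis (of_int (j + 1) * t u) = cis (of_int j * t u) * cis (t u)"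
      "cis (of_int (j - 1) * t u) = cis (of_int j * t u) * cis (- t u)"
      by (simp_all add: cis_mult algebra_simps)
    moreover have "complex_of_real (p (cis (t u))) = \<kappa> * cis (t u) + \<tau> * cis (- t u)"
      by (simp add: p \<kappa>_def \<tau>_def complex_eq_iff algebra_simps)
    ultimately show ?thesis
      by (simp add: scaleR_conv_of_real algebra_simps)
  qed
  then have "(\<integral>u. (h u * p (cis (t u))) *\<^sub>R cis (of_int j * t u) \<partial>M)
      = (\<integral>u. \<kappa> * (h u *\<^sub>R cis (of_int (j + 1) * t u)) + \<tau> * (h u *\<^sub>R cis (of_int (j - 1) * t u)) \<partial>M)"
    by (simp only:)
  also have "\<dots> = (\<integral>u. \<kappa> * (h u *\<^sub>R cis (of_int (j + 1) * t u)) \<partial>M) + (\<integral>u. \<tau> * (h u *\<^sub>R cis (of_int (j - 1) * t u)) \<partial>M)"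
    by (intro Bochner_Integration.integral_add integrable_mult_right int)
  also have "\<dots> = 0" unfolding integral_mult_right_zero linear(3) by simp
  finally show ?case .
next
  case (const c)
  have "(\<integral>u. (h u * c) *\<^sub>R cis (of_int j * t u) \<partial>M) = (\<integral>u. c *\<^sub>R (h u *\<^sub>R cis (of_int j * t u)) \<partial>M)"
    by (simp add: mult.commute)
  also have "\<dots> = 0" unfolding integral_scaleR_right const(2) by simp
  finally show ?case .
next
  case (add p q)
  have int: "integrable M (\<lambda>u. (h u * r (cis (t u))) *\<^sub>R cis (of_int j * t u))" if r: "real_polynomial_function r" for r
  proof -
    obtain B where B: "\<And>t. \<bar>r (cis t)\<bar> \<le> B" using real_polynomial_function_bounded_sphere[OF r] by blast
    have [measurable]: "r \<in> borel_measurable borel" by (rule borel_measurable_real_polynomial_function[OF r])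
    have "integrable M (\<lambda>u. h u *\<^sub>R (r (cis (t u)) *\<^sub>R cis (of_int j * t u)))"
      using add.prems(1) by (rule integrable_mult_bounded[where B = B]) (use B in auto)
    then show ?thesis by simp
  qed
  have "(\<integral>u. (h u * (p (cis (t u)) + q (cis (t u)))) *\<^sub>R cis (of_int j * t u) \<partial>M)
      = (\<integral>u. (h u * p (cis (t u))) *\<^sub>R cis (of_int j * t u) + (h u * q (cis (t u))) *\<^sub>R cis (of_int j * t u) \<partial>M)"
    by (simp only: distrib_left scaleR_add_left)
  also have "\<dots> = 0"
    using add by (subst Bochner_Integration.integral_add[OF int int]) auto
  finally show ?case .
next
  case (mult p q)
  obtain B where B: "\<And>t. \<bar>p (cis t)\<bar> \<le> B" using real_polynomial_function_bounded_sphere[OF mult.hyps(1)] by blast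
  have [measurable]: "p \<in> borel_measurable borel" by (rule borel_measurable_real_polynomial_function[OF mult.hyps(1)])
  have "integrable M (\<lambda>u. h u *\<^sub>R p (cis (t u)))"
    using mult.prems(1) by (rule integrable_mult_bounded[where B = B]) (use B in auto)
  then have "integrable M (\<lambda>u. h u * p (cis (t u)))" by simp
  then have "(\<integral>u. (h u * p (cis (t u)) * q (cis (t u))) *\<^sub>R cis (of_int j * t u) \<partial>M) = 0"
    by (rule mult.IH(2)) (rule mult.IH(1)[OF mult.prems])
  then show ?case by (simp add: mult.assoc)
qed

text \<open>Real polynomials in the coordinates are uniformly dense among continuous functions on
  the circle, and they are already annihilated by frequency shifting.\<close>

lemma fourier_zero_continuous:
  fixes f :: "'a \<Rightarrow> real" and t :: "'a \<Rightarrow> real"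
  assumes t [measurable]: "t \<in> borel_measurable M" and f: "integrable M f"
    and zero: "\<And>j::int. (\<integral>u. f u *\<^sub>R cis (of_int j * t u) \<partial>M) = 0"
    and \<Phi>: "continuous_on UNIV \<Phi>"
  shows "(\<integral>u. f u * \<Phi> (cis (t u)) \<partial>M) = 0"
proof -
  have [measurable]: "\<Phi> \<in> borel_measurable borel" using \<Phi> by (rule borel_measurable_continuous_onI)
  have "compact (\<Phi> ` sphere 0 1)" by (intro compact_continuous_image continuous_on_subset[OF \<Phi>]) auto
  then obtain B where B: "\<And>s. \<bar>\<Phi> (cis s)\<bar> \<le> B"
    by (force dest!: compact_imp_bounded simp: bounded_iff)
  have f\<Phi>: "integrable M (\<lambda>u. f u * \<Phi> (cis (t u)))"
    using integrable_mult_bounded[OF f, of "\<lambda>u. \<Phi> (cis (t u))" B] B by simp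
  define K where "K = (\<integral>u. \<bar>f u\<bar> \<partial>M)"
  have K: "0 \<le> K" unfolding K_def by (intro integral_nonneg_AE) auto
  have "\<bar>\<integral>u. f u * \<Phi> (cis (t u)) \<partial>M\<bar> \<le> 0 + \<epsilon>" if \<epsilon>: "0 < \<epsilon>" for \<epsilon>
  proof -
    \<comment> \<open>The added 1 keeps the tolerance meaningful when the L^1 norm \<open>K\<close>
      is 0.\<close>
    have "0 < \<epsilon> / (K + 1)" using \<epsilon> K by simp
    then obtain p where p: "real_polynomial_function p" "\<And>z. z \<in> sphere 0 1 \<Longrightarrow> \<bar>\<Phi> z - p z\<bar> < \<epsilon> / (K + 1)"
      using Stone_Weierstrass_real_polynomial_function[of "sphere 0 1" \<Phi> "\<epsilon> / (K + 1)"] continuous_on_subset[OF \<Phi>]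
      by auto
    obtain C where C: "\<And>s. \<bar>p (cis s)\<bar> \<le> C" using real_polynomial_function_bounded_sphere[OF p(1)] by blast
    have [measurable]: "p \<in> borel_measurable borel" by (rule borel_measurable_real_polynomial_function[OF p(1)])
    have fp: "integrable M (\<lambda>u. f u * p (cis (t u)))"
      using integrable_mult_bounded[OF f, of "\<lambda>u. p (cis (t u))" C] C by simp
    have "(\<integral>u. complex_of_real (f u * p (cis (t u))) \<partial>M) = 0"
      using fourier_zero_times_polynomial[OF p(1) t f zero, of 0] by (simp add: scaleR_conv_of_real)
    then have 0: "(\<integral>u. f u * p (cis (t u)) \<partial>M) = 0"
      by (simp only: integral_complex_of_real of_real_eq_0_iff)
    have "(\<integral>u. f u * \<Phi> (cis (t u)) \<partial>M) = (\<integral>u. f u * \<Phi> (cis (t u)) - f u * p (cis (t u)) \<partial>M)"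
      using f\<Phi> fp 0 by simp
    then have "\<bar>\<integral>u. f u * \<Phi> (cis (t u)) \<partial>M\<bar> \<le> (\<integral>u. \<bar>f u * \<Phi> (cis (t u)) - f u * p (cis (t u))\<bar> \<partial>M)"
      using integral_abs_bound by metis
    also have "\<dots> \<le> (\<integral>u. \<bar>f u\<bar> * (\<epsilon> / (K + 1)) \<partial>M)"
    proof (rule integral_mono)
      show "\<bar>f u * \<Phi> (cis (t u)) - f u * p (cis (t u))\<bar> \<le> \<bar>f u\<bar> * (\<epsilon> / (K + 1))" for u
        using p(2)[of "cis (t u)"] by (simp add: right_diff_distrib[symmetric] abs_mult mult_left_mono del: times_divide_eq_right)
    qed (use f f\<Phi> fp in auto)
    also have "\<dots> = K * (\<epsilon> / (K + 1))" by (simp add: K_def del: times_divide_eq_right)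
    also have "\<dots> \<le> \<epsilon>" using K \<epsilon> by (simp add: divide_simps)
    finally show ?thesis by simp
  qed
  then have "\<bar>\<integral>u. f u * \<Phi> (cis (t u)) \<partial>M\<bar> \<le> 0" by (rule field_le_epsilon)
  then show ?thesis by simp
qed

lemma fourier_zero_closed:
  fixes f :: "'a \<Rightarrow> real" and t :: "'a \<Rightarrow> real"
  assumes t [measurable]: "t \<in> borel_measurable M" and f: "integrable M f"
    and zero: "\<And>j::int. (\<integral>u. f u *\<^sub>R cis (of_int j * t u) \<partial>M) = 0"
    and C: "closed C"
  shows "(\<integral>u. f u * indicator C (cis (t u)) \<partial>M) = 0"
proof (cases "C = {}")
  case False
  have [measurable]: "C \<in> sets borel" "f \<in> borel_measurable M" using C f by auto
  \<comment> \<open>Continuous functions tending to the indicator of \<open>C\<close>. The empty set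
    is treated apart since \<open>infdist\<close> to it is 0 by convention, which would make \<Phi>
    constantly 1.\<close>
  define \<Phi> where "\<Phi> n z = max 0 (1 - real n * infdist z C)" for n z
  have cont: "continuous_on UNIV (\<Phi> n)" for n
    unfolding \<Phi>_def by (intro continuous_intros)
  have [measurable]: "\<Phi> n \<in> borel_measurable borel" for n
    using cont by (rule borel_measurable_continuous_onI)
  have \<Phi>1: "\<bar>\<Phi> n z\<bar> \<le> 1" for n z by (auto simp: \<Phi>_def infdist_nonneg max_def)
  have lim: "(\<lambda>n. \<Phi> n z) \<longlonglongrightarrow> indicator C z" for z
  proof (cases "z \<in> C")
    case True
    then show ?thesis by (simp add: \<Phi>_def)
  next
    case z: False
    then have d: "0 < infdist z C"
      using C False by (metis in_closed_iff_infdist_zero infdist_nonneg less_le)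
    obtain N :: nat where N: "1 < real N * infdist z C" using reals_Archimedean3[OF d] by blast
    have "\<Phi> n z = 0" if "N \<le> n" for n
    proof -
      have "real N * infdist z C \<le> real n * infdist z C" using that d by (intro mult_right_mono) auto
      then have "1 < real n * infdist z C" using N by linarith
      then show ?thesis by (simp add: \<Phi>_def)
    qed
    then have "\<forall>\<^sub>F n in sequentially. \<Phi> n z = indicator C z"
      using z by (auto simp: eventually_sequentially)
    then show ?thesis by (rule tendsto_eventually)
  qed
  have "(\<lambda>n. \<integral>u. f u * \<Phi> n (cis (t u)) \<partial>M) \<longlonglongrightarrow> (\<integral>u. f u * indicator C (cis (t u)) \<partial>M)"
  proof (rule integral_dominated_convergence[where w = "\<lambda>u. \<bar>f u\<bar>"])
    show "AE u in M. (\<lambda>n. f u * \<Phi> n (cis (t u))) \<longlonglongrightarrow> f u * indicator C (cis (t u))"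
      using lim by (intro AE_I2 tendsto_intros)
    show "AE u in M. norm (f u * \<Phi> n (cis (t u))) \<le> \<bar>f u\<bar>" for n
      using \<Phi>1 by (intro AE_I2) (auto simp: abs_mult intro: mult_left_le)
  qed (use f in auto)
  then show ?thesis
    unfolding fourier_zero_continuous[OF t f zero cont] by (simp add: LIMSEQ_const_iff)
qed simp

text \<open>The positive and negative parts of \<open>f\<close> push forward to finite measures on
  the plane that agree on closed sets. Closed sets are stable under intersection and generate the
  Borel sets, so the two measures coincide.\<close>

lemma fourier_zero_borel:
  fixes f :: "'a \<Rightarrow> real" and t :: "'a \<Rightarrow> real"
  assumes t [measurable]: "t \<in> borel_measurable M" and f: "integrable M f"
    and zero: "\<And>j::int. (\<integral>u. f u *\<^sub>R cis (of_int j * t u) \<partial>M) = 0"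
    and \<Phi> [measurable]: "\<Phi> \<in> borel_measurable borel" and B: "\<And>z. \<bar>\<Phi> z\<bar> \<le> (B::real)"
  shows "(\<integral>u. f u * \<Phi> (cis (t u)) \<partial>M) = 0"
proof -
  have [measurable]: "f \<in> borel_measurable M" using f by simp
  \<comment> \<open>The choices s = 1 and s = -1 select the positive and the negative part of
    \<open>f\<close>.\<close>
  define m where "m s = distr (density M (\<lambda>u. ennreal (max 0 (s * f u)))) borel (\<lambda>u. cis (t u))" for s :: real
  have m_int: "integral\<^sup>L (m s) \<Psi> = (\<integral>u. max 0 (s * f u) * \<Psi> (cis (t u)) \<partial>M)"
    if [measurable]: "\<Psi> \<in> borel_measurable borel" for \<Psi> :: "complex \<Rightarrow> real" and s
    unfolding m_def by (subst integral_distr, measurable, subst integral_density) auto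
  have pos_int: "integrable M (\<lambda>u. max 0 (s * f u))" for s
    by (rule Bochner_Integration.integrable_bound[of M "\<lambda>u. s * f u"]) (use f in auto)
  have m_emeasure: "emeasure (m s) A = ennreal (\<integral>u. max 0 (s * f u) * indicator A (cis (t u)) \<partial>M)"
    if [measurable]: "A \<in> sets borel" for A s
  proof -
    have "emeasure (m s) A = (\<integral>\<^sup>+u. ennreal (max 0 (s * f u)) * indicator A (cis (t u)) \<partial>M)"
      unfolding m_def by (subst emeasure_distr, measurable, subst emeasure_density)
        (auto intro!: nn_integral_cong simp: indicator_def)
    also have "\<dots> = (\<integral>\<^sup>+u. ennreal (max 0 (s * f u) * indicator A (cis (t u))) \<partial>M)"
      by (intro nn_integral_cong) (auto simp: indicator_def)
    also have "\<dots> = ennreal (\<integral>u. max 0 (s * f u) * indicator A (cis (t u)) \<partial>M)"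
      using integrable_mult_bounded[OF pos_int, of "\<lambda>u. indicator A (cis (t u)) :: real" 1 s]
      by (intro nn_integral_eq_integral) (auto simp: indicator_def)
    finally show ?thesis .
  qed
  have split: "(\<integral>u. f u * \<Psi> (cis (t u)) \<partial>M)
      = (\<integral>u. max 0 (1 * f u) * \<Psi> (cis (t u)) \<partial>M) - (\<integral>u. max 0 ((-1) * f u) * \<Psi> (cis (t u)) \<partial>M)"
    if [measurable]: "\<Psi> \<in> borel_measurable borel" and C: "\<And>z. \<bar>\<Psi> z\<bar> \<le> C" for \<Psi> :: "complex \<Rightarrow> real" and C
  proof -
    have "integrable M (\<lambda>u. max 0 (s * f u) * \<Psi> (cis (t u)))" for s
      using integrable_mult_bounded[OF pos_int, of "\<lambda>u. \<Psi> (cis (t u))" C s] C by simp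
    then have "(\<integral>u. max 0 (1 * f u) * \<Psi> (cis (t u)) \<partial>M) - (\<integral>u. max 0 ((-1) * f u) * \<Psi> (cis (t u)) \<partial>M)
        = (\<integral>u. max 0 (1 * f u) * \<Psi> (cis (t u)) - max 0 ((-1) * f u) * \<Psi> (cis (t u)) \<partial>M)"
      by (intro Bochner_Integration.integral_diff[symmetric])
    also have "\<dots> = (\<integral>u. f u * \<Psi> (cis (t u)) \<partial>M)"
      by (intro Bochner_Integration.integral_cong) (auto simp: max_def)
    finally show ?thesis by simp
  qed
  have "m 1 = m (-1)"
  proof (rule measure_eqI_generator_eq[where E = "Collect closed" and \<Omega> = UNIV and A = "\<lambda>_. UNIV"])
    fix C :: "complex set" assume "C \<in> Collect closed"
    then have C: "closed C" and [measurable]: "C \<in> sets borel" by auto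
    have "(\<integral>u. max 0 (1 * f u) * indicator C (cis (t u)) \<partial>M) = (\<integral>u. max 0 ((-1) * f u) * indicator C (cis (t u)) \<partial>M)"
      using split[of "indicator C" 1] fourier_zero_closed[OF t f zero C] by (simp add: indicator_def)
    then show "emeasure (m 1) C = emeasure (m (-1)) C" by (simp only: m_emeasure \<open>C \<in> sets borel\<close>)
  next
    show "sets (m 1) = sigma_sets UNIV (Collect closed)" "sets (m (-1)) = sigma_sets UNIV (Collect closed)"
      by (simp_all add: m_def borel_eq_closed)
    show "emeasure (m 1) UNIV \<noteq> \<infinity>" by (subst m_emeasure) auto
  qed (auto simp: Int_stable_def)
  then have "integral\<^sup>L (m 1) \<Phi> = integral\<^sup>L (m (-1)) \<Phi>" by simp
  then show ?thesis using split[OF \<Phi> B] m_int[OF \<Phi>] by simp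
qed

lemma fourier_zero_periodic:
  fixes f \<theta> :: "'a \<Rightarrow> real"
  assumes [measurable]: "\<theta> \<in> borel_measurable M" and f: "integrable M f"
    and zero: "\<And>j::int. (\<integral>u. f u *\<^sub>R cis (2 * pi * of_int j * \<theta> u) \<partial>M) = 0"
    and [measurable]: "\<psi> \<in> borel_measurable borel" and B: "\<And>s. \<bar>\<psi> s\<bar> \<le> (B::real)"
  shows "(\<integral>u. f u * \<psi> (frac (\<theta> u)) \<partial>M) = 0"
proof -
  have "(\<integral>u. f u * (\<lambda>z. \<psi> (Arg2pi z / (2 * pi))) (cis (2 * pi * \<theta> u)) \<partial>M) = 0"
    by (rule fourier_zero_borel[OF _ f]) (use zero B in \<open>auto simp: mult_ac\<close>)
  then show ?thesis by (simp add: Arg2pi_cis_frac)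
qed

section \<open>From periodic annihilation to invariance under the Gauss map\<close>

lemma integral_split_at_1:
  fixes F :: "real \<Rightarrow> real"
  assumes "integrable lborel F" and "\<And>u. u \<le> 0 \<Longrightarrow> F u = 0"
  shows "(\<integral>u. F u \<partial>lborel) = (\<integral>u. indicator {0<..<1} u * F u \<partial>lborel) + (\<integral>u. indicator {1<..} u * F u \<partial>lborel)"
proof -
  have [measurable]: "F \<in> borel_measurable borel" using borel_measurable_integrable[OF assms(1)] by simp
  have int: "integrable lborel (\<lambda>u. indicator A u * F u)" if "A \<in> sets borel" for A
    using integrable_mult_indicator[OF _ assms(1), of A] that by simp
  have "(\<integral>u. F u \<partial>lborel) = (\<integral>u. indicator {0<..<1} u * F u + indicator {1<..} u * F u \<partial>lborel)"
  proof (rule integral_cong_AE)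
    show "AE u in lborel. F u = indicator {0<..<1} u * F u + indicator {1<..} u * F u"
      using AE_lborel_singleton[of "1 :: real"]
    proof eventually_elim
      case (elim u)
      then show ?case using assms(2)[of u] by (cases "u \<le> 0"; cases "u < 1") (auto simp: indicator_def)
    qed
  qed measurable
  also have "\<dots> = (\<integral>u. indicator {0<..<1} u * F u \<partial>lborel) + (\<integral>u. indicator {1<..} u * F u \<partial>lborel)"
    by (intro Bochner_Integration.integral_add int) auto
  finally show ?thesis .
qed

text \<open>Duality applied to the constant 1, which the operator fixes because the weights have
  total mass 1.\<close>

lemma gauss_measure_invariant:
  assumes [measurable]: "\<psi> \<in> borel_measurable borel" and B: "\<And>s. \<bar>\<psi> s\<bar> \<le> (B::real)"
  shows "(\<integral>u. \<psi> (gauss_map u) \<partial>gauss_measure) = (\<integral>u. \<psi> u \<partial>gauss_measure)"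
proof -
  have "(\<integral>u. 1 * \<psi> (gauss_map u) \<partial>gauss_measure) = (\<integral>v. gauss_op (\<lambda>_. 1) v * \<psi> v \<partial>gauss_measure)"
    by (rule gauss_op_integral[where B = 1 and C = B]) (use B in auto)
  also have "\<dots> = (\<integral>v. 1 * \<psi> v \<partial>gauss_measure)"
  proof (rule integral_cong_AE)
    show "AE v in gauss_measure. gauss_op (\<lambda>_. 1) v * \<psi> v = 1 * \<psi> v"
      using AE_gauss_measure_unit
    proof eventually_elim
      case (elim v)
      then have "gauss_op (\<lambda>_. 1) v = 1" using gauss_weight_sums[of v] by (simp add: gauss_op_def sums_iff)
      then show ?case by simp
    qed
  qed measurable
  finally show ?thesis by simp
qed

text \<open>The two vanishing conditions say that integrating over \<open>(0, 1)\<close> and over \<open>(1, \<infinity>)\<close> against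
  a function of the fractional part of \<open>u\<close>, respectively of \<open>1 / u\<close>, gives opposite values. Composing
  both passages shows that the part of \<open>g\<close> on \<open>(0, 1)\<close> is invariant under the second iterate of the Gauss map.\<close>

lemma annihilator_structure:
  fixes g :: "real \<Rightarrow> real"
  assumes g: "integrable lborel g" and g0: "\<And>u. u \<le> 0 \<Longrightarrow> g u = 0"
    and f1: "\<And>j::int. (\<integral>u. g u *\<^sub>R cis (2 * pi * of_int j * u) \<partial>lborel) = 0"
    and f2: "\<And>j::int. (\<integral>u. g u *\<^sub>R cis (2 * pi * of_int j * (1 / u)) \<partial>lborel) = 0"
  obtains D where
    "\<And>c y B. c \<in> borel_measurable borel \<Longrightarrow> (\<And>s. \<bar>c s\<bar> \<le> B) \<Longrightarrow>
      (\<integral>u. g u * c (y * u) \<partial>lborel)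
        = D * ((\<integral>u. c (y * u) \<partial>gauss_measure) - (\<integral>u. c (y / u) \<partial>gauss_measure))"
    "\<And>c y B. c \<in> borel_measurable borel \<Longrightarrow> (\<And>s. \<bar>c s\<bar> \<le> B) \<Longrightarrow>
      (\<integral>u. g u * c (y / u) \<partial>lborel)
        = D * ((\<integral>u. c (y / u) \<partial>gauss_measure) - (\<integral>u. c (y * u) \<partial>gauss_measure))"
    "D = 0 \<Longrightarrow> AE u in lborel. g u = 0"
proof -
  have [measurable]: "g \<in> borel_measurable borel" using borel_measurable_integrable[OF g] by simp
  have gF_int: "integrable lborel (\<lambda>u. g u * F u)" if "F \<in> borel_measurable borel" "\<And>s. \<bar>F s\<bar> \<le> B" for F :: "real \<Rightarrow> real" and B
    using integrable_mult_bounded[OF g, of F B] that by simp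
  have split: "(\<integral>u. g u * F u \<partial>lborel)
      = (\<integral>u. indicator {0<..<1} u * (g u * F u) \<partial>lborel) + (\<integral>u. indicator {1<..} u * (g u * F u) \<partial>lborel)"
    if "F \<in> borel_measurable borel" "\<And>s. \<bar>F s\<bar> \<le> B" for F :: "real \<Rightarrow> real" and B
    using gF_int[OF that] g0 by (intro integral_split_at_1) auto
  \<comment> \<open>Periodicity in \<open>u\<close>: on (0, 1) the fractional part is the identity,
    so one side keeps \<psi> itself.\<close>
  have a: "(\<integral>u. indicator {0<..<1} u * (g u * \<psi> u) \<partial>lborel) = - (\<integral>u. indicator {1<..} u * (g u * \<psi> (frac u)) \<partial>lborel)"
    if [measurable]: "\<psi> \<in> borel_measurable borel" and B: "\<And>s. \<bar>\<psi> s\<bar> \<le> B" for \<psi> and B :: real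
  proof -
    have "0 = (\<integral>u. g u * \<psi> (frac u) \<partial>lborel)"
      using fourier_zero_periodic[where \<psi> = \<psi> and \<theta> = "\<lambda>u. u", OF _ g f1 _ B] by simp
    also have "\<dots> = (\<integral>u. indicator {0<..<1} u * (g u * \<psi> (frac u)) \<partial>lborel) + (\<integral>u. indicator {1<..} u * (g u * \<psi> (frac u)) \<partial>lborel)"
      by (rule split[where B = B]) (use B in auto)
    also have "(\<integral>u. indicator {0<..<1} u * (g u * \<psi> (frac u)) \<partial>lborel) = (\<integral>u. indicator {0<..<1} u * (g u * \<psi> u) \<partial>lborel)"
      by (rule Bochner_Integration.integral_cong) (auto simp: indicator_def frac_eq)
    finally show ?thesis by linarith
  qed
  \<comment> \<open>Periodicity in 1 / u: here it is on (1, \<infinity>) that the fractional part of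
    1 / u is 1 / u itself.\<close>
  have b: "(\<integral>u. indicator {1<..} u * (g u * \<psi> (1 / u)) \<partial>lborel) = - (\<integral>u. indicator {0<..<1} u * (g u * \<psi> (gauss_map u)) \<partial>lborel)"
    if [measurable]: "\<psi> \<in> borel_measurable borel" and B: "\<And>s. \<bar>\<psi> s\<bar> \<le> B" for \<psi> and B :: real
  proof -
    have "0 = (\<integral>u. g u * \<psi> (gauss_map u) \<partial>lborel)"
      using fourier_zero_periodic[where \<psi> = \<psi> and \<theta> = "\<lambda>u. 1 / u", OF _ g f2 _ B] by (simp add: gauss_map_def)
    also have "\<dots> = (\<integral>u. indicator {0<..<1} u * (g u * \<psi> (gauss_map u)) \<partial>lborel) + (\<integral>u. indicator {1<..} u * (g u * \<psi> (gauss_map u)) \<partial>lborel)"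
      by (rule split[where B = B]) (use B in auto)
    also have "(\<integral>u. indicator {1<..} u * (g u * \<psi> (gauss_map u)) \<partial>lborel) = (\<integral>u. indicator {1<..} u * (g u * \<psi> (1 / u)) \<partial>lborel)"
    proof (rule Bochner_Integration.integral_cong[OF refl])
      fix u :: real
      have "gauss_map u = 1 / u" if "1 < u" using that by (simp add: gauss_map_def frac_eq)
      then show "indicator {1<..} u * (g u * \<psi> (gauss_map u)) = indicator {1<..} u * (g u * \<psi> (1 / u))"
        by (simp add: indicator_def)
    qed
    finally show ?thesis by linarith
  qed
  \<comment> \<open>On (0, 1) this is the density of \<open>g\<close> relative to the Gauss measure;
    being constant is what has to be proved of it.\<close>
  define \<gamma> where "\<gamma> u = g u * (1 + u)" for u
  have [measurable]: "\<gamma> \<in> borel_measurable borel" unfolding \<gamma>_def by measurable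
  have \<gamma>_eq: "(indicator {0<..<1} u / (1 + u)) *\<^sub>R (\<gamma> u * s) = indicator {0<..<1} u * (g u * s)" for u s
    by (auto simp: \<gamma>_def indicator_def)
  have \<gamma>_integral: "(\<integral>u. \<gamma> u * F u \<partial>gauss_measure) = (\<integral>u. indicator {0<..<1} u * (g u * F u) \<partial>lborel)"
    if [measurable]: "F \<in> borel_measurable borel" for F
    by (subst gauss_measure_integral(1)) (auto simp only: \<gamma>_eq, measurable)
  have "integrable lborel (\<lambda>u. indicator {0<..<1} u * (g u * 1))"
    using integrable_mult_indicator[OF _ g, of "{0<..<1}"] by simp
  then have \<gamma>_int: "integrable gauss_measure \<gamma>"
    using gauss_measure_integral(2)[of \<gamma>] \<gamma>_eq[of _ 1] by simp
  obtain D where D: "AE u in gauss_measure. \<gamma> u = D"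
  proof -
    have "\<exists>D. AE u in gauss_measure. \<gamma> u = D"
    proof (rule gauss_invariant_density_const[OF \<gamma>_int])
      fix \<psi> :: "real \<Rightarrow> real" and C assume [measurable]: "\<psi> \<in> borel_measurable borel" and C: "\<And>t. \<bar>\<psi> t\<bar> \<le> C"
      \<comment> \<open>Since frac u = gauss_map (1 / u), the half-line integral produced by
        \<open>a\<close> has the shape that \<open>b\<close> accepts; the two signs cancel.\<close>
      have "(\<integral>u. indicator {1<..} u * (g u * \<psi> (frac u)) \<partial>lborel)
          = (\<integral>u. indicator {1<..} u * (g u * \<psi> (gauss_map (1 / u))) \<partial>lborel)"
        by (simp add: gauss_map_def)
      also have "\<dots> = - (\<integral>u. indicator {0<..<1} u * (g u * \<psi> (gauss_map (gauss_map u))) \<partial>lborel)"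
        by (rule b[where B = C]) (use C in auto)
      finally show "(\<integral>u. \<gamma> u * \<psi> u \<partial>gauss_measure) = (\<integral>u. \<gamma> u * \<psi> (gauss_map (gauss_map u)) \<partial>gauss_measure)"
        using a[OF _ C] by (simp add: \<gamma>_integral)
    qed
    then show ?thesis using that by blast
  qed
  have lower: "(\<integral>u. indicator {0<..<1} u * (g u * F u) \<partial>lborel) = D * (\<integral>u. F u \<partial>gauss_measure)"
    if [measurable]: "F \<in> borel_measurable borel" for F
  proof -
    have "(\<integral>u. \<gamma> u * F u \<partial>gauss_measure) = (\<integral>u. D * F u \<partial>gauss_measure)"
    proof (rule integral_cong_AE)
      show "AE u in gauss_measure. \<gamma> u * F u = D * F u" using D by eventually_elim simp
    qed measurable
    then show ?thesis by (simp add: \<gamma>_integral)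
  qed
  \<comment> \<open>On (1, \<infinity>) the function \<open>g\<close> acts as - D times the image of
    the Gauss measure under inversion.\<close>
  have upper: "(\<integral>u. indicator {1<..} u * (g u * \<psi> (1 / u)) \<partial>lborel) = - D * (\<integral>u. \<psi> u \<partial>gauss_measure)"
    if [measurable]: "\<psi> \<in> borel_measurable borel" and B: "\<And>s. \<bar>\<psi> s\<bar> \<le> B" for \<psi> and B :: real
    using b[where \<psi> = \<psi>, OF _ B] lower[of "\<lambda>u. \<psi> (gauss_map u)"] gauss_measure_invariant[where \<psi> = \<psi>, OF _ B] by simp
  show ?thesis
  proof (rule that[of D])
    fix c :: "real \<Rightarrow> real" and y B assume [measurable]: "c \<in> borel_measurable borel" and B: "\<And>s. \<bar>c s\<bar> \<le> B"
    have "(\<integral>u. indicator {1<..} u * (g u * c (y * u)) \<partial>lborel) = - D * (\<integral>u. c (y / u) \<partial>gauss_measure)"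
      using upper[of "\<lambda>u. c (y / u)" B] B by simp
    then show "(\<integral>u. g u * c (y * u) \<partial>lborel)
        = D * ((\<integral>u. c (y * u) \<partial>gauss_measure) - (\<integral>u. c (y / u) \<partial>gauss_measure))"
      using split[of "\<lambda>u. c (y * u)" B] B lower[of "\<lambda>u. c (y * u)"] by (simp add: right_diff_distrib)
    have "(\<integral>u. indicator {1<..} u * (g u * c (y / u)) \<partial>lborel) = - D * (\<integral>u. c (y * u) \<partial>gauss_measure)"
      using upper[of "\<lambda>u. c (y * u)" B] B by simp
    then show "(\<integral>u. g u * c (y / u) \<partial>lborel)
        = D * ((\<integral>u. c (y / u) \<partial>gauss_measure) - (\<integral>u. c (y * u) \<partial>gauss_measure))"
      using split[of "\<lambda>u. c (y / u)" B] B lower[of "\<lambda>u. c (y / u)"] by (simp add: right_diff_distrib)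
  next
    assume D0: "D = 0"
    have s: "\<bar>sgn x\<bar> \<le> (1::real)" for x by (simp add: sgn_real_def)
    have "(\<integral>u. \<bar>g u\<bar> \<partial>lborel) = (\<integral>u. g u * sgn (g u) \<partial>lborel)"
      by (simp add: abs_sgn)
    \<comment> \<open>The half-line formula takes functions of 1 / u, so the sign of
      \<open>g u\<close> enters it as \<open>sgn (g (1 / u))\<close> evaluated at 1 / u.\<close>
    also have "\<dots> = 0"
      using split[of "\<lambda>u. sgn (g u)" 1] lower[of "\<lambda>u. sgn (g u)"] upper[of "\<lambda>u. sgn (g (1 / u))" 1] s D0 by simp
    finally have "AE u in lborel. \<bar>g u\<bar> = 0"
      using g by (subst (asm) integral_nonneg_eq_0_iff_AE) auto
    then show "AE u in lborel. g u = 0" by simp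
  qed
qed

section \<open>Complex densities and the further point of the cross\<close>

text \<open>Conjugating the integral at frequency - t gives the integral of the conjugate of
  \<open>g\<close> at frequency \<open>t\<close>; half the sum and difference isolate the two parts.
  Hence both signs of the frequency are assumed.\<close>

lemma integral_Re_Im_cis:
  fixes g :: "'a \<Rightarrow> complex" and t :: "'a \<Rightarrow> real"
  assumes g: "integrable M g" and [measurable]: "t \<in> borel_measurable M"
    and 0: "(\<integral>u. g u * cis (t u) \<partial>M) = 0" "(\<integral>u. g u * cis (- t u) \<partial>M) = 0"
  shows "(\<integral>u. Re (g u) *\<^sub>R cis (t u) \<partial>M) = 0" and "(\<integral>u. Im (g u) *\<^sub>R cis (t u) \<partial>M) = 0"
proof -
  have [measurable]: "g \<in> borel_measurable M" using g by simp
  have i: "integrable M (\<lambda>u. g u * cis (s u))" if "s \<in> borel_measurable M" for s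
    by (rule Bochner_Integration.integrable_bound[OF g]) (use that in \<open>auto simp: norm_mult\<close>)
  note i1 = i[OF \<open>t \<in> borel_measurable M\<close>]
  have "integrable M (\<lambda>u. g u * cis (- t u))" by (rule i) measurable
  then have i2: "integrable M (\<lambda>u. cnj (g u * cis (- t u)))" by (rule integrable_cnj)
  have 02: "(\<integral>u. cnj (g u * cis (- t u)) \<partial>M) = 0" using 0(2) by (simp only: Bochner_Integration.integral_cnj complex_cnj_zero)
  have "Re (g u) *\<^sub>R cis (t u) = (1 / 2) * (g u * cis (t u) + cnj (g u * cis (- t u)))" for u
    by (auto simp: complex_eq_iff field_simps)
  then show "(\<integral>u. Re (g u) *\<^sub>R cis (t u) \<partial>M) = 0"
    by (simp only: integral_mult_right_zero Bochner_Integration.integral_add[OF i1 i2] 0(1) 02) simp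
  have "Im (g u) *\<^sub>R cis (t u) = (- \<i> / 2) * (g u * cis (t u) - cnj (g u * cis (- t u)))" for u
    by (auto simp: complex_eq_iff field_simps)
  then show "(\<integral>u. Im (g u) *\<^sub>R cis (t u) \<partial>M) = 0"
    by (simp only: integral_mult_right_zero Bochner_Integration.integral_diff[OF i1 i2] 0(1) 02) simp
qed

text \<open>The lattice conditions hold for the real and imaginary parts separately and leave one
  real constant for each. The extra condition concerns only their combination: up to sign it reads
  \<open>Complex D1 D2 * J = 0\<close>, and \<open>J\<close> is nonzero.\<close>

lemma annihilator_trivial:
  fixes g :: "real \<Rightarrow> complex"
  assumes g: "integrable lborel g" and g0: "\<And>u. u \<le> 0 \<Longrightarrow> g u = 0"
    and f1: "\<And>j::int. (\<integral>u. g u * cis (2 * pi * of_int j * u) \<partial>lborel) = 0"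
    and f2: "\<And>j::int. (\<integral>u. g u * cis (2 * pi * of_int j * (1 / u)) \<partial>lborel) = 0"
    and y: "cis y \<noteq> 1"
    and extra: "(\<integral>u. g u * cis (y * u) \<partial>lborel) = 0 \<or> (\<integral>u. g u * cis (y / u) \<partial>lborel) = 0"
  shows "AE u in lborel. g u = 0"
proof -
  have [measurable]: "g \<in> borel_measurable borel" using borel_measurable_integrable[OF g] by simp
  have f1': "(\<integral>u. g u * cis (- (2 * pi * of_int j * u)) \<partial>lborel) = 0" for j :: int
    using f1[of "- j"] by simp
  have f2': "(\<integral>u. g u * cis (- (2 * pi * of_int j * (1 / u))) \<partial>lborel) = 0" for j :: int
    using f2[of "- j"] by simp
  have Re_int: "integrable lborel (\<lambda>u. Re (g u))" and Im_int: "integrable lborel (\<lambda>u. Im (g u))"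
    using g by auto
  define J where "J = (\<integral>u. cis (y * u) - cis (y / u) \<partial>gauss_measure)"
  have J: "J \<noteq> 0" unfolding J_def by (rule gauss_fourier_nonzero[OF y])
  have ci: "integrable gauss_measure (\<lambda>u. cis (f u))" if [measurable]: "f \<in> borel_measurable borel" for f
    by (rule gauss.integrable_const_bound[where B = 1]) auto
  have J_eq: "J = (\<integral>u. cis (y * u) \<partial>gauss_measure) - (\<integral>u. cis (y / u) \<partial>gauss_measure)"
    unfolding J_def by (intro Bochner_Integration.integral_diff ci) measurable
  have ReJ: "Re J = (\<integral>u. cos (y * u) \<partial>gauss_measure) - (\<integral>u. cos (y / u) \<partial>gauss_measure)"
    and ImJ: "Im J = (\<integral>u. sin (y * u) \<partial>gauss_measure) - (\<integral>u. sin (y / u) \<partial>gauss_measure)"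
    using integral_Re[OF ci, of "\<lambda>u. y * u"] integral_Re[OF ci, of "\<lambda>u. y / u"]
      integral_Im[OF ci, of "\<lambda>u. y * u"] integral_Im[OF ci, of "\<lambda>u. y / u"] by (simp_all add: J_eq)
  have real_part: "\<exists>D. (\<integral>u. h u *\<^sub>R cis (y * u) \<partial>lborel) = D *\<^sub>R J \<and> (\<integral>u. h u *\<^sub>R cis (y / u) \<partial>lborel) = - (D *\<^sub>R J)
      \<and> (D = 0 \<longrightarrow> (AE u in lborel. h u = 0))"
    if h: "integrable lborel h" "\<And>u. u \<le> 0 \<Longrightarrow> h u = 0"
      "\<And>j::int. (\<integral>u. h u *\<^sub>R cis (2 * pi * of_int j * u) \<partial>lborel) = 0"
      "\<And>j::int. (\<integral>u. h u *\<^sub>R cis (2 * pi * of_int j * (1 / u)) \<partial>lborel) = 0" for h :: "real \<Rightarrow> real"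
  proof -
    obtain D where D:
      "\<And>c y B. c \<in> borel_measurable borel \<Longrightarrow> (\<And>s. \<bar>c s\<bar> \<le> B) \<Longrightarrow>
        (\<integral>u. h u * c (y * u) \<partial>lborel) = D * ((\<integral>u. c (y * u) \<partial>gauss_measure) - (\<integral>u. c (y / u) \<partial>gauss_measure))"
      "\<And>c y B. c \<in> borel_measurable borel \<Longrightarrow> (\<And>s. \<bar>c s\<bar> \<le> B) \<Longrightarrow>
        (\<integral>u. h u * c (y / u) \<partial>lborel) = D * ((\<integral>u. c (y / u) \<partial>gauss_measure) - (\<integral>u. c (y * u) \<partial>gauss_measure))"
      "D = 0 \<Longrightarrow> AE u in lborel. h u = 0"
      by (rule annihilator_structure[of h]) (rule h(1), erule h(2), rule h(3), rule h(4), (rule that; blast))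
    have hi: "integrable lborel (\<lambda>u. h u *\<^sub>R cis (f u))" if [measurable]: "f \<in> borel_measurable borel" for f
      by (rule integrable_mult_bounded[OF h(1), where B = 1]) auto
    have cs: "(cos :: real \<Rightarrow> real) \<in> borel_measurable borel" "(sin :: real \<Rightarrow> real) \<in> borel_measurable borel"
      by (auto intro!: borel_measurable_continuous_onI continuous_intros)
    note trig = D(1)[OF cs(1) abs_cos_le_one, of y] D(1)[OF cs(2) abs_sin_le_one, of y]
      D(2)[OF cs(1) abs_cos_le_one, of y] D(2)[OF cs(2) abs_sin_le_one, of y]
    have "(\<integral>u. h u *\<^sub>R cis (y * u) \<partial>lborel) = D *\<^sub>R J"
      using integral_Re[OF hi, of "\<lambda>u. y * u"] integral_Im[OF hi, of "\<lambda>u. y * u"] trig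
      by (simp add: complex_eq_iff ReJ ImJ)
    moreover have "(\<integral>u. h u *\<^sub>R cis (y / u) \<partial>lborel) = - (D *\<^sub>R J)"
      using integral_Re[OF hi, of "\<lambda>u. y / u"] integral_Im[OF hi, of "\<lambda>u. y / u"] trig
      by (simp add: complex_eq_iff ReJ ImJ right_diff_distrib)
    ultimately show ?thesis using D(3) by blast
  qed
  obtain D1 where D1: "(\<integral>u. Re (g u) *\<^sub>R cis (y * u) \<partial>lborel) = D1 *\<^sub>R J" "(\<integral>u. Re (g u) *\<^sub>R cis (y / u) \<partial>lborel) = - (D1 *\<^sub>R J)"
      "D1 = 0 \<Longrightarrow> AE u in lborel. Re (g u) = 0"
    using real_part[OF Re_int _ integral_Re_Im_cis(1)[OF g _ f1 f1'] integral_Re_Im_cis(1)[OF g _ f2 f2']] g0 by auto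
  obtain D2 where D2: "(\<integral>u. Im (g u) *\<^sub>R cis (y * u) \<partial>lborel) = D2 *\<^sub>R J" "(\<integral>u. Im (g u) *\<^sub>R cis (y / u) \<partial>lborel) = - (D2 *\<^sub>R J)"
      "D2 = 0 \<Longrightarrow> AE u in lborel. Im (g u) = 0"
    using real_part[OF Im_int _ integral_Re_Im_cis(2)[OF g _ f1 f1'] integral_Re_Im_cis(2)[OF g _ f2 f2']] g0 by auto
  have comb: "(\<integral>u. g u * cis (f u) \<partial>lborel) = (\<integral>u. Re (g u) *\<^sub>R cis (f u) \<partial>lborel) + \<i> * (\<integral>u. Im (g u) *\<^sub>R cis (f u) \<partial>lborel)"
    if [measurable]: "f \<in> borel_measurable borel" for f
  proof -
    have "g u * cis (f u) = Re (g u) *\<^sub>R cis (f u) + \<i> * (Im (g u) *\<^sub>R cis (f u))" for u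
      by (simp add: complex_eq_iff algebra_simps)
    then have "(\<integral>u. g u * cis (f u) \<partial>lborel) = (\<integral>u. Re (g u) *\<^sub>R cis (f u) + \<i> * (Im (g u) *\<^sub>R cis (f u)) \<partial>lborel)"
      by (simp only:)
    also have "\<dots> = (\<integral>u. Re (g u) *\<^sub>R cis (f u) \<partial>lborel) + (\<integral>u. \<i> * (Im (g u) *\<^sub>R cis (f u)) \<partial>lborel)"
      by (intro Bochner_Integration.integral_add integrable_mult_right
            integrable_mult_bounded[OF Re_int, where B = 1] integrable_mult_bounded[OF Im_int, where B = 1]) auto
    finally show ?thesis by (simp only: integral_mult_right_zero)
  qed
  have e1: "(\<integral>u. g u * cis (y * u) \<partial>lborel) = Complex D1 D2 * J"
    unfolding comb[of "\<lambda>u. y * u", simplified] D1(1) D2(1) by (simp add: complex_eq_iff)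
  have e2: "(\<integral>u. g u * cis (y / u) \<partial>lborel) = - (Complex D1 D2 * J)"
    using comb[of "\<lambda>u. y / u"] D1(2) D2(2) by (simp add: complex_eq_iff)
  have "Complex D1 D2 = 0" using extra J unfolding e1 e2 by simp
  then have "D1 = 0" "D2 = 0" by (simp_all add: complex_eq_iff)
  then have "AE u in lborel. Re (g u) = 0" "AE u in lborel. Im (g u) = 0" using D1(3) D2(3) by auto
  then show ?thesis by eventually_elim (simp add: complex_eq_iff)
qed

section \<open>Jordan decomposition of finite signed measures\<close>

locale finite_signed_measure =
  fixes N :: "'a measure" and \<rho> :: "'a set \<Rightarrow> real"
  assumes empty [simp]: "\<rho> {} = 0"
    and sums: "\<And>A. range A \<subseteq> sets N \<Longrightarrow> disjoint_family A \<Longrightarrow> (\<lambda>i. \<rho> (A i)) sums \<rho> (\<Union>i. A i)"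
begin

lemma additive:
  assumes "A \<in> sets N" "B \<in> sets N" "A \<inter> B = {}"
  shows "\<rho> (A \<union> B) = \<rho> A + \<rho> B"
proof -
  have "(\<lambda>i. \<rho> (binaryset A B i)) sums \<rho> (\<Union>i. binaryset A B i)"
    using assms by (intro sums) (auto simp: range_binaryset_eq disjoint_family_on_def binaryset_def)
  moreover have "(\<lambda>i. \<rho> (binaryset A B i)) sums (\<rho> A + \<rho> B)"
    by (rule binaryset_sums) simp
  ultimately show ?thesis by (simp add: UN_binaryset_eq sums_unique2)
qed

lemma diff:
  assumes "A \<in> sets N" "B \<in> sets N" "B \<subseteq> A"
  shows "\<rho> (A - B) = \<rho> A - \<rho> B"
proof -
  have "(A - B) \<inter> B = {}" by auto
  then show ?thesis using additive[of "A - B" B] assms by (simp add: Un_absorb2)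
qed

definition variation_finite :: "'a set \<Rightarrow> bool" where
  "variation_finite A \<longleftrightarrow> (\<exists>K. \<forall>B\<in>sets N. B \<subseteq> A \<longrightarrow> \<bar>\<rho> B\<bar> \<le> K)"

lemma variation_finite_Un:
  assumes "A \<in> sets N" "B \<in> sets N" "variation_finite A" "variation_finite B"
  shows "variation_finite (A \<union> B)"
proof -
  obtain K where K: "\<forall>C\<in>sets N. C \<subseteq> A \<longrightarrow> \<bar>\<rho> C\<bar> \<le> K"
    using assms(3) unfolding variation_finite_def ..
  obtain L where L: "\<forall>C\<in>sets N. C \<subseteq> B \<longrightarrow> \<bar>\<rho> C\<bar> \<le> L"
    using assms(4) unfolding variation_finite_def ..
  have "\<bar>\<rho> C\<bar> \<le> K + L" if C: "C \<in> sets N" "C \<subseteq> A \<union> B" for C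
  proof -
    have "C \<inter> A \<inter> (C - A) = {}" by auto
    then have "\<rho> C = \<rho> (C \<inter> A) + \<rho> (C - A)"
      using additive[of "C \<inter> A" "C - A"] C assms(1) by (simp add: Int_Diff_Un)
    moreover have "\<bar>\<rho> (C \<inter> A)\<bar> \<le> K" "\<bar>\<rho> (C - A)\<bar> \<le> L"
      using C assms(1) by (auto intro!: K[rule_format] L[rule_format])
    ultimately show ?thesis by linarith
  qed
  then show ?thesis unfolding variation_finite_def by (intro exI[of _ "K + L"]) simp
qed

text \<open>A set of infinite variation contains two disjoint measurable parts, one of infinite variation and the
  other of measure at least \<open>1\<close> in modulus; iterating gives a disjoint sequence violating countable additivity.\<close>

lemma variation_finite_space: "variation_finite (space N)"
proof (rule ccontr)
  define S where "S = {A \<in> sets N. \<not> variation_finite A}"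
  assume "\<not> variation_finite (space N)"
  then have S0: "space N \<in> S" by (simp add: S_def)
  have step: "\<exists>B\<in>S. B \<subseteq> A \<and> 1 \<le> \<bar>\<rho> (A - B)\<bar>" if A: "A \<in> S" for A
  proof -
    have A': "A \<in> sets N" "\<not> variation_finite A" using A by (auto simp: S_def)
    \<comment> \<open>The margin \<bar>\<rho> A\<bar> + 1 makes both \<open>C\<close> and
      \<open>A - C\<close> of measure at least 1 in modulus, so it does not matter which of them has
      infinite variation.\<close>
    obtain C where C: "C \<in> sets N" "C \<subseteq> A" "\<bar>\<rho> A\<bar> + 1 < \<bar>\<rho> C\<bar>"
      using A'(2) unfolding variation_finite_def by (meson not_le)
    have d: "\<rho> (A - C) = \<rho> A - \<rho> C" by (rule diff) (use A' C in auto)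
    have "\<not> variation_finite C \<or> \<not> variation_finite (A - C)"
      using variation_finite_Un[of C "A - C"] A' C by (auto simp: Un_absorb1)
    then show ?thesis
    proof
      assume "\<not> variation_finite C"
      then show ?thesis using C d by (intro bexI[of _ C]) (auto simp: S_def)
    next
      assume "\<not> variation_finite (A - C)"
      moreover have "A - (A - C) = C" using C(2) by auto
      ultimately show ?thesis using C A' by (intro bexI[of _ "A - C"]) (auto simp: S_def)
    qed
  qed
  obtain f where f: "\<And>A. A \<in> S \<Longrightarrow> f A \<in> S" "\<And>A. A \<in> S \<Longrightarrow> f A \<subseteq> A" "\<And>A. A \<in> S \<Longrightarrow> 1 \<le> \<bar>\<rho> (A - f A)\<bar>"
    using step by metis
  define E where "E n = (f ^^ n) (space N)" for n
  have E: "E n \<in> S" for n by (induction n) (auto simp: E_def S0 f(1))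
  have E_Suc: "E (Suc n) = f (E n)" for n by (simp add: E_def)
  have anti: "E n \<subseteq> E m" if "m \<le> n" for m n
    using that by (induction n rule: dec_induct) (use f(2)[OF E] E_Suc in blast)+
  define D where "D n = E n - E (Suc n)" for n
  have "disjoint_family D"
  proof (rule disjoint_family_on_def[THEN iffD2], intro ballI impI)
    fix m n :: nat assume "m \<noteq> n"
    then show "D m \<inter> D n = {}"
      using anti[of "Suc m" n] anti[of "Suc n" m] unfolding D_def by (cases "m < n") auto
  qed
  moreover have "range D \<subseteq> sets N" using E by (auto simp: D_def S_def)
  ultimately have "summable (\<lambda>n. \<rho> (D n))" using sums by (auto simp: sums_iff)
  then have "(\<lambda>n. \<rho> (D n)) \<longlonglongrightarrow> 0" by (rule summable_LIMSEQ_zero)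
  then have "\<forall>\<^sub>F n in sequentially. \<bar>\<rho> (D n)\<bar> < 1"
    by (auto dest!: tendstoD[where e = 1] simp: dist_real_def)
  then obtain n where "\<bar>\<rho> (D n)\<bar> < 1" by (auto simp: eventually_sequentially)
  then show False
    using f(3)[OF E, of n] by (simp add: D_def E_Suc)
qed

lemma bounded: "\<exists>K. \<forall>B\<in>sets N. \<bar>\<rho> B\<bar> \<le> K"
proof -
  obtain K where "\<forall>B\<in>sets N. B \<subseteq> space N \<longrightarrow> \<bar>\<rho> B\<bar> \<le> K"
    using variation_finite_space unfolding variation_finite_def ..
  then show ?thesis by (intro exI[of _ K]) (simp add: sets.sets_into_space)
qed

definition upper :: "'a set \<Rightarrow> ennreal" where
  "upper A = (SUP B\<in>{B \<in> sets N. B \<subseteq> A}. ennreal (\<rho> B))"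

lemma upper_ge: "B \<in> sets N \<Longrightarrow> B \<subseteq> A \<Longrightarrow> ennreal (\<rho> B) \<le> upper A"
  unfolding upper_def by (rule SUP_upper) simp

lemma upper_mono: "A \<subseteq> B \<Longrightarrow> upper A \<le> upper B"
  unfolding upper_def by (rule SUP_subset_mono) auto

lemma upper_add_le:
  assumes "A \<in> sets N" "B \<in> sets N" "A \<inter> B = {}"
  shows "upper A + upper B \<le> upper (A \<union> B)"
proof -
  have "ennreal (\<rho> C) + ennreal (\<rho> D) \<le> upper (A \<union> B)"
    if "C \<in> sets N" "C \<subseteq> A" "D \<in> sets N" "D \<subseteq> B" for C D
  proof -
    \<comment> \<open>A set of negative measure counts as 0 under \<open>ennreal\<close> and may be
      replaced by the empty set; with nonnegative values, additivity survives the
      truncation.\<close>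
    define C' D' where "C' = (if \<rho> C \<ge> 0 then C else {})" and "D' = (if \<rho> D \<ge> 0 then D else {})"
    have *: "C' \<in> sets N" "D' \<in> sets N" "C' \<subseteq> A" "D' \<subseteq> B" "0 \<le> \<rho> C'" "0 \<le> \<rho> D'"
      "ennreal (\<rho> C) = ennreal (\<rho> C')" "ennreal (\<rho> D) = ennreal (\<rho> D')"
      using that by (auto simp: C'_def D'_def ennreal_neg)
    then have "ennreal (\<rho> C) + ennreal (\<rho> D) = ennreal (\<rho> (C' \<union> D'))"
      using assms(3) by (subst additive) (auto simp: ennreal_plus)
    also have "\<dots> \<le> upper (A \<union> B)"
      using * by (intro upper_ge) auto
    finally show ?thesis .
  qed
  note * = this
  let ?I = "\<lambda>A. {C \<in> sets N. C \<subseteq> A}"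
  have ne: "?I A \<noteq> {}" for A by force
  have "upper A + upper B = (SUP C\<in>?I A. ennreal (\<rho> C) + upper B)"
    unfolding upper_def[of A] by (rule ennreal_SUP_add_left[OF ne, symmetric])
  also have "\<dots> \<le> upper (A \<union> B)"
  proof (rule SUP_least)
    fix C assume C: "C \<in> ?I A"
    have "ennreal (\<rho> C) + upper B = (SUP D\<in>?I B. ennreal (\<rho> C) + ennreal (\<rho> D))"
      unfolding upper_def[of B] by (rule ennreal_SUP_add_right[OF ne])
    also have "\<dots> \<le> upper (A \<union> B)" using C * by (intro SUP_least) auto
    finally show "ennreal (\<rho> C) + upper B \<le> upper (A \<union> B)" .
  qed
  finally show ?thesis .
qed

text \<open>\<open>measure_of\<close> assigns its values only to a countably additive set function
  and is zero otherwise, so this gives \<open>upper_variation\<close> its meaning. One inequality is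
  superadditivity on finite disjoint unions, the other comes from cutting each competitor along the
  sets \<open>A i\<close>.\<close>

lemma countably_additive_upper: "countably_additive (sets N) upper"
proof (rule countably_additiveI)
  fix A :: "nat \<Rightarrow> 'a set" assume A: "range A \<subseteq> sets N" "disjoint_family A"
  show "(\<Sum>i. upper (A i)) = upper (\<Union>i. A i)"
  proof (rule antisym)
    have le: "(\<Sum>i<n. upper (A i)) \<le> upper (\<Union>i<n. A i)" for n
    proof (induction n)
      case (Suc n)
      have "(\<Sum>i<Suc n. upper (A i)) \<le> upper (\<Union>i<n. A i) + upper (A n)"
        unfolding sum.lessThan_Suc by (rule add_right_mono[OF Suc])
      also have "\<dots> \<le> upper ((\<Union>i<n. A i) \<union> A n)"
      proof (rule upper_add_le)
        show "(\<Union>i<n. A i) \<inter> A n = {}"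
        proof -
          have "A i \<inter> A n = {}" if "i < n" for i
            using disjoint_family_onD[OF A(2), of i n] that by simp
          then show ?thesis by blast
        qed
      qed (use A(1) in auto)
      finally show ?case by (simp add: lessThan_Suc Un_commute)
    qed (simp add: upper_def)
    have "(\<Sum>i<n. upper (A i)) \<le> upper (\<Union>i. A i)" for n
      by (rule order_trans[OF le upper_mono]) auto
    then show "(\<Sum>i. upper (A i)) \<le> upper (\<Union>i. A i)"
      by (rule suminf_le_const[OF summableI])
    have "ennreal (\<rho> B) \<le> (\<Sum>i. upper (A i))" if B: "B \<in> sets N" "B \<subseteq> (\<Union>i. A i)" for B
    proof (cases "0 \<le> \<rho> B")
      case True
      have "(\<Union>i. B \<inter> A i) = B" using B(2) by auto
      moreover have "(\<lambda>i. \<rho> (B \<inter> A i)) sums \<rho> (\<Union>i. B \<inter> A i)"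
        using A B by (intro sums) (auto simp: disjoint_family_on_def)
      ultimately have s: "(\<lambda>i. \<rho> (B \<inter> A i)) sums \<rho> B" by simp
      have l: "(\<lambda>n. ennreal (\<Sum>i<n. \<rho> (B \<inter> A i))) \<longlonglongrightarrow> ennreal (\<rho> B)"
        using s by (intro tendsto_ennrealI) (simp add: sums_def)
      have "ennreal (\<Sum>i<n. \<rho> (B \<inter> A i)) \<le> (\<Sum>i. upper (A i))" for n
      proof -
        have "ennreal (\<Sum>i<n. \<rho> (B \<inter> A i)) \<le> ennreal (\<Sum>i<n. max 0 (\<rho> (B \<inter> A i)))"
          by (intro ennreal_leI sum_mono) auto
        also have "\<dots> = (\<Sum>i<n. ennreal (max 0 (\<rho> (B \<inter> A i))))"
          by (rule sum_ennreal[symmetric]) simp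
        also have "\<dots> = (\<Sum>i<n. ennreal (\<rho> (B \<inter> A i)))"
          by (intro sum.cong) (auto simp: max_def ennreal_neg)
        also have "\<dots> \<le> (\<Sum>i<n. upper (A i))"
          by (rule sum_mono, rule upper_ge) (use A(1) B(1) in auto)
        also have "\<dots> \<le> (\<Sum>i. upper (A i))" by (rule sum_le_suminf) auto
        finally show ?thesis .
      qed
      then show ?thesis by (intro LIMSEQ_le_const2[OF l] exI[of _ 0] allI impI)
    qed (simp add: ennreal_neg)
    note * = this
    show "upper (\<Union>i. A i) \<le> (\<Sum>i. upper (A i))"
      unfolding upper_def[of "\<Union>i. A i"]
    proof (rule SUP_least)
      fix B assume "B \<in> {B \<in> sets N. B \<subseteq> (\<Union>i. A i)}"
      then show "ennreal (\<rho> B) \<le> (\<Sum>i. upper (A i))" by (intro *) simp_all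
    qed
  qed
qed

lemma emeasure_upper_variation: "A \<in> sets N \<Longrightarrow> emeasure (upper_variation N \<rho>) A = upper A"
proof -
  have eq: "upper_variation N \<rho> = measure_of (space N) (sets N) upper"
    by (simp add: upper_variation_def upper_def[abs_def])
  show "A \<in> sets N \<Longrightarrow> emeasure (upper_variation N \<rho>) A = upper A"
    unfolding eq by (rule emeasure_measure_of_sigma)
      (auto simp: positive_def countably_additive_upper sets.sigma_algebra_axioms upper_def)
qed

lemma sets_upper_variation [simp, measurable_cong]: "sets (upper_variation N \<rho>) = sets N"
  and space_upper_variation [simp]: "space (upper_variation N \<rho>) = space N"
  by (auto simp: upper_variation_def)

lemma upper_finite: "upper A < \<infinity>"
proof -
  obtain K where K: "\<And>B. B \<in> sets N \<Longrightarrow> \<bar>\<rho> B\<bar> \<le> K" using bounded by blast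
  have "upper A \<le> ennreal K"
    unfolding upper_def using K by (intro SUP_least ennreal_leI) (auto dest: abs_le_D1)
  then show ?thesis by (simp add: le_less_trans)
qed

lemma finite_upper_variation: "finite_measure (upper_variation N \<rho>)"
  using upper_finite[of "space N"] by (intro finite_measureI) (simp add: emeasure_upper_variation)

lemma upper_eq_0:
  assumes "\<And>B. B \<in> sets N \<Longrightarrow> B \<subseteq> A \<Longrightarrow> \<rho> B = 0"
  shows "upper A = 0"
  unfolding upper_def using assms by (intro antisym SUP_least) auto

lemma uminus: "finite_signed_measure N (\<lambda>A. - \<rho> A)"
  by unfold_locales (auto intro: sums_minus sums)

lemma measure_upper_variation: "A \<in> sets N \<Longrightarrow> measure (upper_variation N \<rho>) A = (SUP B\<in>{B \<in> sets N. B \<subseteq> A}. \<rho> B)"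
proof -
  assume A: "A \<in> sets N"
  let ?I = "{B \<in> sets N. B \<subseteq> A}"
  obtain K where K: "\<And>B. B \<in> sets N \<Longrightarrow> \<bar>\<rho> B\<bar> \<le> K" using bounded by blast
  have bdd: "bdd_above (\<rho> ` ?I)" using K by (intro bdd_aboveI[of _ K]) (auto dest: abs_le_D1)
  \<comment> \<open>The empty set as competitor keeps the real supremum nonnegative, so truncation
    by \<open>ennreal\<close> leaves it unchanged.\<close>
  have ne: "{} \<in> ?I" by simp
  have nn: "0 \<le> (SUP B\<in>?I. \<rho> B)" using cSUP_upper[OF ne bdd] by simp
  have "upper A = ennreal (SUP B\<in>?I. \<rho> B)"
  proof (rule antisym)
    show "upper A \<le> ennreal (SUP B\<in>?I. \<rho> B)"
      unfolding upper_def by (intro SUP_least ennreal_leI cSUP_upper bdd)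
    show "ennreal (SUP B\<in>?I. \<rho> B) \<le> upper A"
    proof -
      obtain r where r: "upper A = ennreal r" "0 \<le> r" using upper_finite[of A] by (cases "upper A") auto
      have "\<rho> B \<le> r" if "B \<in> ?I" for B
      proof -
        have "ennreal (\<rho> B) \<le> upper A" using that by (intro upper_ge) auto
        then show ?thesis using r by (simp add: ennreal_le_iff2) linarith
      qed
      then have "(SUP B\<in>?I. \<rho> B) \<le> r" using ne by (intro cSUP_least) auto
      then show ?thesis by (simp add: r ennreal_leI)
    qed
  qed
  then show ?thesis using nn by (simp add: measure_def emeasure_upper_variation A)
qed

text \<open>Complementation inside \<open>A\<close> turns the supremum of \<open>- \<rho>\<close> into that of \<open>\<rho>\<close>, shifted by \<open>\<rho> A\<close>.\<close>

lemma Jordan_decomposition: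
  assumes A: "A \<in> sets N"
  shows "\<rho> A = measure (upper_variation N \<rho>) A - measure (upper_variation N (\<lambda>A. - \<rho> A)) A"
proof -
  interpret minus: finite_signed_measure N "\<lambda>A. - \<rho> A" by (rule uminus)
  let ?I = "{B \<in> sets N. B \<subseteq> A}"
  obtain K where K: "\<And>B. B \<in> sets N \<Longrightarrow> \<bar>\<rho> B\<bar> \<le> K" using bounded by blast
  have bdd: "bdd_above (\<rho> ` ?I)" "bdd_above ((\<lambda>B. - \<rho> B) ` ?I)"
    using K by (auto intro!: bdd_aboveI[of _ K] simp: abs_le_iff)
  have le: "\<rho> B \<le> (SUP B\<in>?I. \<rho> B)" "- \<rho> B \<le> (SUP B\<in>?I. - \<rho> B)" if "B \<in> ?I" for B
    using that by (auto intro!: cSUP_upper bdd)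
  have "(SUP B\<in>?I. \<rho> B) \<le> (SUP B\<in>?I. - \<rho> B) + \<rho> A"
  proof (rule cSUP_least)
    fix B assume "B \<in> ?I"
    then show "\<rho> B \<le> (SUP B\<in>?I. - \<rho> B) + \<rho> A" using le(2)[of "A - B"] diff[of A B] A by auto
  qed (use A in auto)
  moreover have "(SUP B\<in>?I. - \<rho> B) \<le> (SUP B\<in>?I. \<rho> B) - \<rho> A"
  proof (rule cSUP_least)
    fix B assume "B \<in> ?I"
    then show "- \<rho> B \<le> (SUP B\<in>?I. \<rho> B) - \<rho> A" using le(1)[of "A - B"] diff[of A B] A by auto
  qed (use A in auto)
  ultimately show ?thesis by (simp add: measure_upper_variation minus.measure_upper_variation A)
qed

end

section \<open>Densities of measures on the hyperbola\<close>

lemma finite_signed_measure_Re_Im: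
  assumes "\<mu> \<in> complex_measures N"
  shows "finite_signed_measure N (\<lambda>A. Re (\<mu> A))" and "finite_signed_measure N (\<lambda>A. Im (\<mu> A))"
  using assms unfolding complex_measures_def finite_signed_measure_def
  by (auto intro: sums_Re sums_Im)

lemma borel_measurable_fst_real2: "(fst :: real \<times> real \<Rightarrow> real) \<in> borel_measurable borel"
  by (intro borel_measurable_continuous_onI continuous_intros)

lemma fst_vimage_borel: "A \<in> sets borel \<Longrightarrow> fst -` A \<in> sets (borel :: (real \<times> real) measure)"
  using measurable_sets[OF borel_measurable_fst_real2, of A] by simp

lemma hyperbola_borel: "hyperbola M \<in> sets borel"
  unfolding hyperbola_def by (intro borel_closed closed_Collect_eq continuous_intros)

text \<open>The hyperbola is a graph over the first coordinate, so projection to that coordinate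
  loses nothing. The projected measure has a Lebesgue density by Radon-Nikodym, and the
  parametrisation lifts it back to the plane.\<close>

lemma upper_variation_hyperbola:
  fixes \<rho> :: "(real \<times> real) set \<Rightarrow> real" and M :: real
  defines "c \<equiv> M\<^sup>2 / (4 * pi\<^sup>2)"
  assumes "0 < M" and \<rho>: "finite_signed_measure borel \<rho>"
    and supp: "\<And>A. A \<in> sets borel \<Longrightarrow> A \<inter> hyperbola M = {} \<Longrightarrow> \<rho> A = 0"
    and ac: "\<And>A. A \<in> sets borel \<Longrightarrow> emeasure (hyperbola_arc_length M) A = 0 \<Longrightarrow> \<rho> A = 0"
  shows "\<exists>f. integrable lborel f \<and> (\<forall>t. 0 \<le> f t) \<and>
    upper_variation borel \<rho> = distr (density lborel (\<lambda>t. ennreal (f t))) borel (\<lambda>t. (t, c / t))"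
proof -
  interpret finite_signed_measure borel \<rho> by fact
  define V where "V = upper_variation borel \<rho>"
  interpret V: finite_measure V unfolding V_def by (rule finite_upper_variation)
  have [simp, measurable_cong]: "sets V = sets borel" by (simp add: V_def)
  have [simp]: "space V = UNIV" by (simp add: V_def)
  have c: "0 < c" using \<open>0 < M\<close> by (simp add: c_def)
  define \<Phi> where "\<Phi> t = (t, c / t)" for t :: real
  have [measurable]: "\<Phi> \<in> borel_measurable borel" unfolding \<Phi>_def by measurable
  have H: "hyperbola M = {x. fst x * snd x = c}" by (simp add: hyperbola_def c_def)
  note hyperbola_borel [measurable]
  have fst_V [measurable]: "fst \<in> measurable V borel"
    using borel_measurable_fst_real2 measurable_cong_sets[OF \<open>sets V = sets borel\<close> refl] by blast
  have "emeasure V (- hyperbola M) = 0"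
  proof -
    have "upper (- hyperbola M) = 0"
      by (rule upper_eq_0) (use supp in blast)
    then show ?thesis unfolding V_def by (subst emeasure_upper_variation) auto
  qed
  then have AE_H: "AE x in V. x \<in> hyperbola M"
    by (intro AE_I[of _ _ "- hyperbola M"]) auto
  define r where "r = distr V borel fst"
  have "absolutely_continuous lborel r"
    unfolding absolutely_continuous_def
  proof
    fix Z :: "real set" assume Z: "Z \<in> null_sets lborel"
    then have [measurable]: "Z \<in> sets borel" by auto
    have Z': "fst -` Z \<in> sets (borel :: (real \<times> real) measure)"
      by (rule fst_vimage_borel) measurable
    \<comment> \<open>The upper variation is a supremum over subsets, and every Borel subset of the
      preimage of a null set has arc length 0.\<close>
    have "upper (fst -` Z) = 0"
    proof (rule upper_eq_0)
      fix B :: "(real \<times> real) set" assume [measurable]: "B \<in> sets borel" and B: "B \<subseteq> fst -` Z"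
      have "emeasure (hyperbola_arc_length M) B
          = emeasure (density lborel (\<lambda>t. ennreal (norm (1 :: real, - c / t\<^sup>2)))) (\<Phi> -` B)"
        unfolding hyperbola_arc_length_def Let_def c_def[symmetric] \<Phi>_def[symmetric]
        by (subst emeasure_distr) auto
      also have "\<dots> \<le> emeasure (density lborel (\<lambda>t. ennreal (norm (1 :: real, - c / t\<^sup>2)))) Z"
        using B by (intro emeasure_mono) (auto simp: \<Phi>_def)
      also have "\<dots> = 0"
      proof (subst emeasure_density)
        show "(\<integral>\<^sup>+t. ennreal (norm (1 :: real, - c / t\<^sup>2)) * indicator Z t \<partial>lborel) = 0"
          using AE_not_in[OF Z] by (subst nn_integral_0_iff_AE) (auto elim!: eventually_mono)
      qed auto
      finally show "\<rho> B = 0" by (intro ac) auto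
    qed
    then have "emeasure V (fst -` Z) = 0" unfolding V_def using Z' by (subst emeasure_upper_variation) auto
    then show "Z \<in> null_sets r" by (auto simp: null_sets_def r_def emeasure_distr[OF fst_V])
  qed
  then obtain h where h [measurable]: "h \<in> borel_measurable lborel" "density lborel h = r"
    using sigma_finite_measure.Radon_Nikodym[OF sigma_finite_lborel, of r] by (auto simp: r_def)
  have h_fin: "(\<integral>\<^sup>+t. h t \<partial>lborel) < \<infinity>"
  proof -
    have "(\<integral>\<^sup>+t. h t \<partial>lborel) = emeasure r UNIV"
      unfolding h(2)[symmetric] by (subst emeasure_density) auto
    also have "\<dots> = emeasure V UNIV" by (simp add: r_def emeasure_distr[OF fst_V])
    finally show ?thesis using V.emeasure_finite[of UNIV] by (simp add: less_top[symmetric])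
  qed
  \<comment> \<open>Radon-Nikodym yields an extended density; finite total mass makes it finite
    almost everywhere.\<close>
  define f where "f t = enn2real (h t)" for t
  have [measurable]: "f \<in> borel_measurable borel" unfolding f_def by measurable
  have AE_h: "AE t in lborel. h t = ennreal (f t)"
  proof -
    have "AE t in lborel. h t \<noteq> \<infinity>" using h_fin by (intro nn_integral_PInf_AE) auto
    then show ?thesis by eventually_elim (simp add: f_def less_top)
  qed
  have r_eq: "r = density lborel (\<lambda>t. ennreal (f t))"
    unfolding h(2)[symmetric] using AE_h by (intro density_cong) auto
  have f_int: "integrable lborel f"
  proof (rule integrableI_bounded)
    have "(\<integral>\<^sup>+t. ennreal (norm (f t)) \<partial>lborel) = (\<integral>\<^sup>+t. h t \<partial>lborel)"
      using AE_h by (intro nn_integral_cong_AE) (auto elim!: eventually_mono simp: f_def)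
    then show "(\<integral>\<^sup>+t. ennreal (norm (f t)) \<partial>lborel) < \<infinity>" using h_fin by simp
  qed measurable
  have "V = distr V borel (\<lambda>x. x)" by (subst distr_id2) auto
  \<comment> \<open>Points of the hyperbola are recovered from their first coordinate, so this
    composition is the identity almost everywhere for \<open>V\<close>.\<close>
  also have "\<dots> = distr V borel (\<Phi> \<circ> fst)"
  proof (rule distr_cong_AE)
    show "AE x in V. x = (\<Phi> \<circ> fst) x"
      using AE_H by eventually_elim (use c in \<open>auto simp: H \<Phi>_def prod_eq_iff field_simps\<close>)
  qed auto
  also have "\<dots> = distr r borel \<Phi>"
    unfolding r_def by (subst distr_distr) auto
  finally have "V = distr (density lborel (\<lambda>t. ennreal (f t))) borel \<Phi>" unfolding r_eq .
  then show ?thesis using f_int by (intro exI[of _ f]) (auto simp: V_def \<Phi>_def[abs_def] f_def)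
qed

lemma integral_distr_density:
  fixes F :: "'a::topological_space \<Rightarrow> 'b::{banach, second_countable_topology}" and s :: "real \<Rightarrow> real"
  assumes "s \<in> borel_measurable borel" and "\<And>t. 0 \<le> s t"
    and "\<Phi> \<in> borel_measurable borel" and "F \<in> borel_measurable borel"
  shows "integral\<^sup>L (distr (density lborel (\<lambda>t. ennreal (s t))) borel \<Phi>) F = (\<integral>t. s t *\<^sub>R F (\<Phi> t) \<partial>lborel)"
proof -
  note [measurable] = assms(1,3,4)
  have "integral\<^sup>L (distr (density lborel (\<lambda>t. ennreal (s t))) borel \<Phi>) F
      = integral\<^sup>L (density lborel (\<lambda>t. ennreal (s t))) (\<lambda>t. F (\<Phi> t))"
    by (rule integral_distr) auto
  also have "\<dots> = (\<integral>t. s t *\<^sub>R F (\<Phi> t) \<partial>lborel)"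
    by (rule integral_density) (use assms(2) in auto)
  finally show ?thesis .
qed

text \<open>This turns a measure on the hyperbola into one integrable function of the first
  coordinate. The positive and negative parts of the real and imaginary parts each have a density,
  and the same four densities compute both the values of the measure and its transform.\<close>

lemma AC_density:
  fixes M :: real
  defines "c \<equiv> M\<^sup>2 / (4 * pi\<^sup>2)"
  assumes "0 < M" and \<mu>: "\<mu> \<in> AC M \<Lambda>"
  shows "\<exists>f. integrable lborel f
    \<and> (\<forall>A\<in>sets borel. \<mu> A = (\<integral>t. indicator A (t, c / t) *\<^sub>R f t \<partial>lborel))
    \<and> (\<forall>\<xi>. fourier_transform \<mu> \<xi> = (\<integral>t. f t * cis (pi * ((t, c / t) \<bullet> \<xi>)) \<partial>lborel))"
proof -
  define \<Phi> where "\<Phi> t = (t, c / t)" for t :: real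
  have [measurable]: "\<Phi> \<in> borel_measurable borel" unfolding \<Phi>_def by measurable
  have real_density: "\<exists>p q. integrable lborel p \<and> integrable lborel q \<and>
      (\<forall>A\<in>sets borel. \<rho> A = (\<integral>t. (p t - q t) * indicator A (\<Phi> t) \<partial>lborel)) \<and>
      (\<forall>F :: real \<times> real \<Rightarrow> complex. F \<in> borel_measurable borel \<longrightarrow>
        integral\<^sup>L (upper_variation borel \<rho>) F = (\<integral>t. p t *\<^sub>R F (\<Phi> t) \<partial>lborel) \<and>
        integral\<^sup>L (upper_variation borel (\<lambda>A. - \<rho> A)) F = (\<integral>t. q t *\<^sub>R F (\<Phi> t) \<partial>lborel))"
    \<comment> \<open>Vanishing wherever \<mu> does is all that is asked of \<rho>; it makes support
      and absolute continuity pass to the real and the imaginary part alike.\<close>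
    if \<rho>: "finite_signed_measure borel \<rho>" "\<And>A. \<mu> A = 0 \<Longrightarrow> \<rho> A = 0" for \<rho>
  proof -
    interpret finite_signed_measure borel \<rho> by fact
    have z: "\<rho> A = 0" if "A \<in> sets borel" "A \<inter> hyperbola M = {} \<or> emeasure (hyperbola_arc_length M) A = 0" for A
      using \<mu> that \<rho>(2)[of A] by (auto simp: AC_def)
    obtain p where p: "integrable lborel p" "\<And>t. 0 \<le> p t"
      "upper_variation borel \<rho> = distr (density lborel (\<lambda>t. ennreal (p t))) borel \<Phi>"
      using upper_variation_hyperbola[OF \<open>0 < M\<close> \<rho>(1)] z by (auto simp: \<Phi>_def[abs_def] c_def)
    obtain q where q: "integrable lborel q" "\<And>t. 0 \<le> q t"
      "upper_variation borel (\<lambda>A. - \<rho> A) = distr (density lborel (\<lambda>t. ennreal (q t))) borel \<Phi>"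
      using upper_variation_hyperbola[OF \<open>0 < M\<close> uminus] z by (auto simp: \<Phi>_def[abs_def] c_def)
    have pq [measurable]: "p \<in> borel_measurable borel" "q \<in> borel_measurable borel"
      using p(1) q(1) borel_measurable_integrable by auto
    have ind: "integrable lborel (\<lambda>t. s t * indicator A (\<Phi> t))" if "integrable lborel s" "A \<in> sets borel" for s :: "real \<Rightarrow> real" and A
      using integrable_mult_bounded[OF that(1), of "\<lambda>t. indicator A (\<Phi> t) :: real" 1] that(2)
      by (auto simp: indicator_def)
    have "\<rho> A = (\<integral>t. (p t - q t) * indicator A (\<Phi> t) \<partial>lborel)" if [measurable]: "A \<in> sets borel" for A
    proof -
      have "measure (distr (density lborel (\<lambda>t. ennreal (s t))) borel \<Phi>) A = (\<integral>t. s t * indicator A (\<Phi> t) \<partial>lborel)"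
        if "s \<in> borel_measurable borel" "\<And>t. 0 \<le> s t" for s
        using integral_distr_density[OF that, of \<Phi> "indicator A :: _ \<Rightarrow> real"] by simp
      then have "\<rho> A = (\<integral>t. p t * indicator A (\<Phi> t) \<partial>lborel) - (\<integral>t. q t * indicator A (\<Phi> t) \<partial>lborel)"
        using Jordan_decomposition[of A] p q by simp
      also have "\<dots> = (\<integral>t. p t * indicator A (\<Phi> t) - q t * indicator A (\<Phi> t) \<partial>lborel)"
        by (rule Bochner_Integration.integral_diff[symmetric]) (intro ind p q that)+
      finally show ?thesis by (simp only: left_diff_distrib)
    qed
    note * = this
    show ?thesis unfolding p(3) q(3)
      by (rule exI[of _ p], rule exI[of _ q])
         (use p(1) q(1) * integral_distr_density[OF pq(1) p(2), where \<Phi> = \<Phi> and 'b = complex] integral_distr_density[OF pq(2) q(2), where \<Phi> = \<Phi> and 'b = complex] in simp)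
  qed
  have \<mu>': "\<mu> \<in> complex_measures borel" using \<mu> by (simp add: AC_def)
  obtain p1 q1 where 1: "integrable lborel p1" "integrable lborel q1"
    "\<And>A. A \<in> sets borel \<Longrightarrow> Re (\<mu> A) = (\<integral>t. (p1 t - q1 t) * indicator A (\<Phi> t) \<partial>lborel)"
    "\<And>F :: real \<times> real \<Rightarrow> complex. F \<in> borel_measurable borel \<Longrightarrow>
        integral\<^sup>L (upper_variation borel (\<lambda>A. Re (\<mu> A))) F = (\<integral>t. p1 t *\<^sub>R F (\<Phi> t) \<partial>lborel)"
    "\<And>F :: real \<times> real \<Rightarrow> complex. F \<in> borel_measurable borel \<Longrightarrow>
        integral\<^sup>L (upper_variation borel (\<lambda>A. - Re (\<mu> A))) F = (\<integral>t. q1 t *\<^sub>R F (\<Phi> t) \<partial>lborel)"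
    using real_density[OF finite_signed_measure_Re_Im(1)[OF \<mu>']] by auto
  obtain p2 q2 where 2: "integrable lborel p2" "integrable lborel q2"
    "\<And>A. A \<in> sets borel \<Longrightarrow> Im (\<mu> A) = (\<integral>t. (p2 t - q2 t) * indicator A (\<Phi> t) \<partial>lborel)"
    "\<And>F :: real \<times> real \<Rightarrow> complex. F \<in> borel_measurable borel \<Longrightarrow>
        integral\<^sup>L (upper_variation borel (\<lambda>A. Im (\<mu> A))) F = (\<integral>t. p2 t *\<^sub>R F (\<Phi> t) \<partial>lborel)"
    "\<And>F :: real \<times> real \<Rightarrow> complex. F \<in> borel_measurable borel \<Longrightarrow>
        integral\<^sup>L (upper_variation borel (\<lambda>A. - Im (\<mu> A))) F = (\<integral>t. q2 t *\<^sub>R F (\<Phi> t) \<partial>lborel)"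
    using real_density[OF finite_signed_measure_Re_Im(2)[OF \<mu>']] by auto
  define f where "f t = Complex (p1 t - q1 t) (p2 t - q2 t)" for t
  have f_eq: "f t = complex_of_real (p1 t - q1 t) + \<i> * complex_of_real (p2 t - q2 t)" for t
    by (simp add: f_def complex_eq_iff)
  have f_int: "integrable lborel f"
    unfolding f_eq[abs_def] using 1 2 by (intro Bochner_Integration.integrable_add integrable_mult_right integrable_of_real Bochner_Integration.integrable_diff) auto
  show ?thesis
  proof (intro exI[of _ f] conjI ballI allI f_int)
    fix A :: "(real \<times> real) set" assume A [measurable]: "A \<in> sets borel"
    have i: "integrable lborel (\<lambda>t. indicator A (\<Phi> t) *\<^sub>R f t)"
      by (rule Bochner_Integration.integrable_bound[OF f_int])
         (use borel_measurable_integrable[OF f_int] in \<open>auto simp: indicator_def\<close>)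
    show "\<mu> A = (\<integral>t. indicator A (t, c / t) *\<^sub>R f t \<partial>lborel)"
      using integral_Re[OF i] integral_Im[OF i] 1(3)[OF A] 2(3)[OF A]
      by (simp add: complex_eq_iff \<Phi>_def f_def mult.commute)
  next
    fix \<xi> :: "real \<times> real"
    define F where "F x = cis (pi * (x \<bullet> \<xi>))" for x :: "real \<times> real"
    have F [measurable]: "F \<in> borel_measurable borel" unfolding F_def by measurable
    have iF: "integrable lborel (\<lambda>t. s t *\<^sub>R F (\<Phi> t))" if "integrable lborel s" for s
      by (rule integrable_mult_bounded[OF that, where B = 1]) (auto simp: F_def)
    have "fourier_transform \<mu> \<xi> = complex_measure_integral borel \<mu> F"
      by (simp add: fourier_transform_def F_def[abs_def] cis_conv_exp mult_ac)
    also have "\<dots> = ((\<integral>t. p1 t *\<^sub>R F (\<Phi> t) \<partial>lborel) - (\<integral>t. q1 t *\<^sub>R F (\<Phi> t) \<partial>lborel))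
        + \<i> * ((\<integral>t. p2 t *\<^sub>R F (\<Phi> t) \<partial>lborel) - (\<integral>t. q2 t *\<^sub>R F (\<Phi> t) \<partial>lborel))"
      unfolding complex_measure_integral_def using 1(4,5)[OF F] 2(4,5)[OF F] by simp
    also have "\<dots> = (\<integral>t. (p1 t *\<^sub>R F (\<Phi> t) - q1 t *\<^sub>R F (\<Phi> t)) + \<i> * (p2 t *\<^sub>R F (\<Phi> t) - q2 t *\<^sub>R F (\<Phi> t)) \<partial>lborel)"
      using 1(1,2) 2(1,2) by (simp add: iF)
    also have "\<dots> = (\<integral>t. f t * cis (pi * ((t, c / t) \<bullet> \<xi>)) \<partial>lborel)"
      by (intro Bochner_Integration.integral_cong)
         (simp_all add: f_eq F_def \<Phi>_def scaleR_conv_of_real algebra_simps)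
    finally show "fourier_transform \<mu> \<xi> = (\<integral>t. f t * cis (pi * ((t, c / t) \<bullet> \<xi>)) \<partial>lborel)" .
  qed
qed

section \<open>Uniqueness on the negative branch\<close>

text \<open>Testing on the subset of \<open>S\<close> where \<open>h\<close>, or - h, is positive
  leaves a nonnegative integrand with integral 0.\<close>

lemma AE_zero_if_set_integrals_zero:
  fixes h :: "'a \<Rightarrow> real"
  assumes h: "integrable M h" and S: "S \<in> sets M"
    and zero: "\<And>A. A \<in> sets M \<Longrightarrow> A \<subseteq> S \<Longrightarrow> (\<integral>t. indicator A t * h t \<partial>M) = 0"
  shows "AE t in M. t \<in> S \<longrightarrow> h t = 0"
proof -
  have [measurable]: "h \<in> borel_measurable M" using h by simp
  have main: "AE t in M. t \<in> S \<longrightarrow> s * h t \<le> 0" if s: "s \<in> {1, - 1}" for s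
  proof -
    define A where "A = {t \<in> S. 0 < s * h t}"
    have "{t \<in> space M. t \<in> S \<and> 0 < s * h t} \<in> sets M" using S by measurable
    also have "{t \<in> space M. t \<in> S \<and> 0 < s * h t} = A"
      using sets.sets_into_space[OF S] by (auto simp: A_def)
    finally have A: "A \<in> sets M" .
    have i: "integrable M (\<lambda>t. indicator A t * h t)"
      using integrable_mult_indicator[OF A h] by simp
    have "(\<integral>t. s * (indicator A t * h t) \<partial>M) = 0"
      using zero[OF A] by (simp add: A_def)
    then have "AE t in M. s * (indicator A t * h t) = 0"
      using i by (subst (asm) integral_nonneg_eq_0_iff_AE) (auto simp: A_def indicator_def)
    then show ?thesis
      by eventually_elim (use s in \<open>auto simp: A_def indicator_def split: if_splits\<close>)
  qed
  from main[of 1] main[of "- 1"] show ?thesis by auto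
qed

theorem corollary6p1p2:
  fixes \<alpha> \<beta> M :: real and \<xi> :: "real \<times> real"
    and \<mu> \<nu> :: "(real \<times> real) set \<Rightarrow> complex"
  assumes "0 < \<alpha>" and "0 < \<beta>" and "0 < M"
    and "\<alpha> * \<beta> * M\<^sup>2 = 16 * pi\<^sup>2"
    and "\<xi> \<in> cross" and "\<xi> \<notin> lattice_cross \<alpha> \<beta>"
    and "\<mu> \<in> AC M (lattice_cross \<alpha> \<beta> \<union> {\<xi>})"
    and "\<nu> \<in> AC M (lattice_cross \<alpha> \<beta> \<union> {\<xi>})"
    and "\<forall>A \<in> sets borel. A \<subseteq> hyperbola_plus M \<longrightarrow> \<mu> A = \<nu> A"
  shows "\<mu> = \<nu>"
proof -
  define c where "c = M\<^sup>2 / (4 * pi\<^sup>2)"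
  \<comment> \<open>The critical condition in the form \<alpha> \<beta> c = 4, which fixes the
    second frequency after rescaling.\<close>
  have c: "0 < c" "\<alpha> * \<beta> * c = 4" using \<open>0 < M\<close> assms(4) by (auto simp: c_def field_simps)
  define \<Phi> where "\<Phi> t = (t, c / t)" for t :: real
  obtain f\<^sub>\<mu> where f\<^sub>\<mu>: "integrable lborel f\<^sub>\<mu>"
    "\<And>A. A \<in> sets borel \<Longrightarrow> \<mu> A = (\<integral>t. indicator A (\<Phi> t) *\<^sub>R f\<^sub>\<mu> t \<partial>lborel)"
    "\<And>\<eta>. fourier_transform \<mu> \<eta> = (\<integral>t. f\<^sub>\<mu> t * cis (pi * (\<Phi> t \<bullet> \<eta>)) \<partial>lborel)"
    using AC_density[OF \<open>0 < M\<close> assms(7), folded c_def, folded \<Phi>_def] by blast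
  obtain f\<^sub>\<nu> where f\<^sub>\<nu>: "integrable lborel f\<^sub>\<nu>"
    "\<And>A. A \<in> sets borel \<Longrightarrow> \<nu> A = (\<integral>t. indicator A (\<Phi> t) *\<^sub>R f\<^sub>\<nu> t \<partial>lborel)"
    "\<And>\<eta>. fourier_transform \<nu> \<eta> = (\<integral>t. f\<^sub>\<nu> t * cis (pi * (\<Phi> t \<bullet> \<eta>)) \<partial>lborel)"
    using AC_density[OF \<open>0 < M\<close> assms(8), folded c_def, folded \<Phi>_def] by blast
  have [measurable]: "\<Phi> \<in> borel_measurable borel" unfolding \<Phi>_def by measurable
  define f where "f t = f\<^sub>\<mu> t - f\<^sub>\<nu> t" for t
  have f_int: "integrable lborel f" unfolding f_def using f\<^sub>\<mu>(1) f\<^sub>\<nu>(1) by simp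
  have [measurable]: "f \<in> borel_measurable borel" "f\<^sub>\<mu> \<in> borel_measurable borel" "f\<^sub>\<nu> \<in> borel_measurable borel"
    using f_int f\<^sub>\<mu>(1) f\<^sub>\<nu>(1) borel_measurable_integrable by auto
  have ind_int: "integrable lborel (\<lambda>t. indicator A (\<Phi> t) *\<^sub>R s t)"
    if "integrable lborel s" "A \<in> sets borel" for s :: "real \<Rightarrow> complex" and A
    by (rule Bochner_Integration.integrable_bound[OF that(1)])
       (use that borel_measurable_integrable[OF that(1)] in \<open>auto simp: indicator_def\<close>)
  have cis_int: "integrable lborel (\<lambda>t. s t * cis (k t))"
    if "integrable lborel s" "k \<in> borel_measurable borel" for s :: "real \<Rightarrow> complex" and k
    by (rule Bochner_Integration.integrable_bound[OF that(1)])
       (use that borel_measurable_integrable[OF that(1)] in \<open>auto simp: norm_mult\<close>)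
  have diff: "\<mu> A - \<nu> A = (\<integral>t. indicator A (\<Phi> t) *\<^sub>R f t \<partial>lborel)" if "A \<in> sets borel" for A
    using Bochner_Integration.integral_diff[OF ind_int[OF f\<^sub>\<mu>(1) that] ind_int[OF f\<^sub>\<nu>(1) that]]
    by (simp add: f\<^sub>\<mu>(2)[OF that] f\<^sub>\<nu>(2)[OF that] f_def scaleR_diff_right)
  have fourier: "(\<integral>t. f t * cis (pi * (\<Phi> t \<bullet> \<eta>)) \<partial>lborel) = 0" if "\<eta> \<in> lattice_cross \<alpha> \<beta> \<union> {\<xi>}" for \<eta>
  proof -
    have "(\<integral>t. f\<^sub>\<mu> t * cis (pi * (\<Phi> t \<bullet> \<eta>)) \<partial>lborel) = 0" "(\<integral>t. f\<^sub>\<nu> t * cis (pi * (\<Phi> t \<bullet> \<eta>)) \<partial>lborel) = 0"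
      using assms(7,8) that f\<^sub>\<mu>(3)[of \<eta>] f\<^sub>\<nu>(3)[of \<eta>] by (auto simp: AC_def)
    moreover have "(\<lambda>t. pi * (\<Phi> t \<bullet> \<eta>)) \<in> borel_measurable borel" by measurable
    ultimately show ?thesis
      using Bochner_Integration.integral_diff[OF cis_int[OF f\<^sub>\<mu>(1)] cis_int[OF f\<^sub>\<nu>(1)]]
      by (simp add: f_def left_diff_distrib)
  qed
  have AE_pos: "AE t in lborel. 0 < t \<longrightarrow> f t = 0"
  proof -
    have z: "(\<integral>t. indicator A t *\<^sub>R f t \<partial>lborel) = 0" if A: "A \<in> sets borel" "A \<subseteq> {0<..}" for A
    proof -
      \<comment> \<open>The lift of \<open>A\<close> to the plus branch, where the measures agree;
        pulling it back along the parametrisation returns \<open>A\<close>.\<close>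
      define A' where "A' = fst -` A \<inter> hyperbola M"
      have "hyperbola M \<in> sets borel" by (rule hyperbola_borel)
      moreover have "fst -` A \<in> sets (borel :: (real \<times> real) measure)"
        using A(1) by (rule fst_vimage_borel)
      ultimately have A': "A' \<in> sets borel" by (simp add: A'_def)
      moreover have "A' \<subseteq> hyperbola_plus M" using A by (auto simp: A'_def hyperbola_plus_def)
      ultimately have "(\<integral>t. indicator A' (\<Phi> t) *\<^sub>R f t \<partial>lborel) = 0"
        using assms(9) diff[OF A'] by simp
      moreover have "indicator A' (\<Phi> t) = (indicator A t :: real)" for t
        using A(2) by (auto simp: A'_def \<Phi>_def hyperbola_def c_def indicator_def)
      ultimately show ?thesis by simp
    qed
    have i: "integrable lborel (\<lambda>t. indicator A t *\<^sub>R f t)" if "A \<in> sets borel" for A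
      using integrable_mult_indicator[OF _ f_int] that by simp
    have "AE t in lborel. t \<in> {0<..} \<longrightarrow> Re (f t) = 0"
    proof (rule AE_zero_if_set_integrals_zero)
      show "(\<integral>t. indicator A t * Re (f t) \<partial>lborel) = 0" if "A \<in> sets lborel" "A \<subseteq> {0<..}" for A
        using integral_Re[OF i[of A]] z[of A] that by simp
    qed (use f_int in auto)
    moreover have "AE t in lborel. t \<in> {0<..} \<longrightarrow> Im (f t) = 0"
    proof (rule AE_zero_if_set_integrals_zero)
      show "(\<integral>t. indicator A t * Im (f t) \<partial>lborel) = 0" if "A \<in> sets lborel" "A \<subseteq> {0<..}" for A
        using integral_Im[OF i[of A]] z[of A] that by simp
    qed (use f_int in auto)
    ultimately show ?thesis by eventually_elim (auto simp: complex_eq_iff)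
  qed
  \<comment> \<open>A representative vanishing at every t \<ge> 0, since the half-line result asks
    for pointwise vanishing on the other side.\<close>
  define f' where "f' t = indicator {..<0} t *\<^sub>R f t" for t
  have f'_int: "integrable lborel f'"
    unfolding f'_def using integrable_mult_indicator[OF _ f_int] by simp
  have [measurable]: "f' \<in> borel_measurable borel" unfolding f'_def by measurable
  have f_f': "AE t in lborel. f t = f' t"
    using AE_pos AE_lborel_singleton[of "0 :: real"]
    by eventually_elim (auto simp: f'_def indicator_def)
  \<comment> \<open>The scale 2 / \<alpha> turns pi t \<alpha> j into - 2 pi j u, and \<alpha>
    \<beta> c = 4 then turns pi (c / t) \<beta> k into - 2 pi k / u. The minus sign moves the
    negative branch to (0, \<infinity>).\<close>
  define g where "g u = f' (- (2 / \<alpha>) * u)" for u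
  have \<alpha>': "- (2 / \<alpha>) \<noteq> 0" using \<open>0 < \<alpha>\<close> by simp
  have g_int: "integrable lborel g"
    unfolding g_def using lborel_integrable_real_affine[OF f'_int \<alpha>', of 0] by simp
  have g0: "g u = 0" if "u \<le> 0" for u
  proof -
    have "0 \<le> - (2 / \<alpha>) * u" using that \<open>0 < \<alpha>\<close> by (intro mult_nonpos_nonpos) auto
    then show ?thesis by (simp add: g_def f'_def indicator_def)
  qed
  have transfer: "(\<integral>u. g u * cis (k u) \<partial>lborel) = 0"
    if "\<eta> \<in> lattice_cross \<alpha> \<beta> \<union> {\<xi>}" "\<And>u. pi * (\<Phi> (- (2 / \<alpha>) * u) \<bullet> \<eta>) = k u" for \<eta> k
  proof -
    have "0 = (\<integral>t. f' t * cis (pi * (\<Phi> t \<bullet> \<eta>)) \<partial>lborel)"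
      unfolding fourier[OF that(1), symmetric] using f_f' by (intro integral_cong_AE) (auto elim!: eventually_mono)
    also have "\<dots> = \<bar>- (2 / \<alpha>)\<bar> *\<^sub>R (\<integral>u. g u * cis (k u) \<partial>lborel)"
      unfolding g_def that(2)[symmetric] using lborel_integral_real_affine[OF \<alpha>', of _ 0] by simp
    finally show ?thesis using \<open>0 < \<alpha>\<close> by simp
  qed
  have \<Phi>1: "pi * (\<Phi> (- (2 / \<alpha>) * u) \<bullet> (s, 0)) = - (2 * pi * (s / \<alpha>)) * u" for s u
    by (simp add: \<Phi>_def)
  have \<Phi>2: "pi * (\<Phi> (- (2 / \<alpha>) * u) \<bullet> (0, s)) = - (2 * pi * (s / \<beta>)) / u" for s u
  proof -
    have "c = 4 / (\<alpha> * \<beta>)" using c(2) assms(1,2) by (simp add: field_simps)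
    then show ?thesis using assms(1,2) by (cases "u = 0") (simp_all add: \<Phi>_def field_simps)
  qed
  have f1: "(\<integral>u. g u * cis (2 * pi * of_int j * u) \<partial>lborel) = 0" for j :: int
  proof (rule transfer)
    \<comment> \<open>The negated index compensates for the reflection in \<open>g\<close>.\<close>
    show "(\<alpha> * of_int (- j), 0) \<in> lattice_cross \<alpha> \<beta> \<union> {\<xi>}" unfolding lattice_cross_def by blast
    show "pi * (\<Phi> (- (2 / \<alpha>) * u) \<bullet> (\<alpha> * of_int (- j), 0)) = 2 * pi * of_int j * u" for u
      unfolding \<Phi>1 using assms(1) by simp
  qed
  have f2: "(\<integral>u. g u * cis (2 * pi * of_int j * (1 / u)) \<partial>lborel) = 0" for j :: int
  proof (rule transfer)
    show "(0, \<beta> * of_int (- j)) \<in> lattice_cross \<alpha> \<beta> \<union> {\<xi>}" unfolding lattice_cross_def by blast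
    show "pi * (\<Phi> (- (2 / \<alpha>) * u) \<bullet> (0, \<beta> * of_int (- j))) = 2 * pi * of_int j * (1 / u)" for u
      unfolding \<Phi>2 using assms(2) by simp
  qed
  \<comment> \<open>A trivial phase would put the coordinate \<open>s\<close> on the lattice of step
    \<open>r\<close>; hence a point off the lattice cross meets the condition on \<open>y\<close> in
    the half-line result.\<close>
  have cis_neq: "cis (- (2 * pi * (s / r))) \<noteq> 1" if "0 < r" "s \<notin> range (\<lambda>j :: int. r * of_int j)" for s r
  proof
    assume "cis (- (2 * pi * (s / r))) = 1"
    then have "cos (- (2 * pi * (s / r))) = 1" by (simp add: complex_eq_iff)
    then obtain n :: int where "- (2 * pi * (s / r)) = of_int n * 2 * pi" unfolding cos_one_2pi_int by blast
    then have "2 * pi * (q + of_int n) = 0" if "q = s / r" for q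
      using that by (simp add: algebra_simps)
    then have "s / r + of_int n = 0" by simp
    then have "s = r * of_int (- n)" using \<open>0 < r\<close> by (simp add: field_simps)
    then show False using that(2) by blast
  qed
  have "AE u in lborel. g u = 0"
  proof -
    consider s where "\<xi> = (s, 0)" | s where "\<xi> = (0, s)"
      using assms(5) by (cases \<xi>) (auto simp: cross_def)
    then show ?thesis
    proof cases
      case 1
      then have "s \<notin> range (\<lambda>j :: int. \<alpha> * of_int j)" using assms(6) by (auto simp: lattice_cross_def)
      moreover have "(\<integral>u. g u * cis (- (2 * pi * (s / \<alpha>)) * u) \<partial>lborel) = 0"
        by (rule transfer[of \<xi>]) (use \<Phi>1 1 in auto)
      ultimately show ?thesis
        by (intro annihilator_trivial[OF g_int g0 f1 f2 cis_neq[OF \<open>0 < \<alpha>\<close>]] disjI1)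
    next
      case 2
      then have "s \<notin> range (\<lambda>j :: int. \<beta> * of_int j)" using assms(6) by (auto simp: lattice_cross_def)
      moreover have "(\<integral>u. g u * cis (- (2 * pi * (s / \<beta>)) / u) \<partial>lborel) = 0"
        by (rule transfer[of \<xi>]) (use \<Phi>2 2 in auto)
      ultimately show ?thesis
        by (intro annihilator_trivial[OF g_int g0 f1 f2 cis_neq[OF \<open>0 < \<beta>\<close>]] disjI2)
    qed
  qed
  then have "(\<integral>u. norm (g u) \<partial>lborel) = 0"
    by (intro integral_eq_zero_AE) (auto elim!: eventually_mono)
  moreover have "(\<integral>t. norm (f' t) \<partial>lborel) = \<bar>- (2 / \<alpha>)\<bar> *\<^sub>R (\<integral>u. norm (g u) \<partial>lborel)"
    unfolding g_def using lborel_integral_real_affine[OF \<alpha>', of "\<lambda>t. norm (f' t)" 0] by simp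
  ultimately have "(\<integral>t. norm (f' t) \<partial>lborel) = 0" by simp
  then have "AE t in lborel. norm (f' t) = 0"
    using f'_int by (subst (asm) integral_nonneg_eq_0_iff_AE) auto
  with f_f' have f_zero: "AE t in lborel. f t = 0" by eventually_elim simp
  show ?thesis
  proof
    fix A
    show "\<mu> A = \<nu> A"
    proof (cases "A \<in> sets borel")
      case True
      have "(\<integral>t. indicator A (\<Phi> t) *\<^sub>R f t \<partial>lborel) = 0"
        using f_zero by (intro integral_eq_zero_AE) (auto elim!: eventually_mono)
      then show ?thesis using diff[OF True] by simp
    next
      \<comment> \<open>Outside the Borel sets both set functions take the default value 0, so
        equality holds for every set.\<close>
      case False
      then show ?thesis using assms(7,8) by (simp add: AC_def complex_measures_def)
    qed
  qed
qed

end
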